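(* Let $A(n)$ be one of the $15$ known sporadic Apéry-like sequences $\mathbf{A},\mathbf{B},\mathbf{C},\mathbf{D},\mathbf{E},\mathbf{F}$, $(\alpha),(\gamma),(\delta),(\epsilon),(\eta),(\zeta)$, $s_7,s_{10},s_{18}$. Then, for all primes $p\geq 3$ and all positive integers $n,r$, $$A(p^r n)\equiv A(p^{r-1}n)\pmod{p^{2r}}.$$
   Context: The $15$ known sporadic Apéry-like sequences are the following integer sequences $A(n)$, $n\ge 0$ (it is known that all their terms are integers), each determined by a three-term recurrence valid for all integers $n\geq 0$ together with the initial conditions $A(-1)=0$, $A(0)=1$. (1) Zagier's six sequences satisfy $$(n+1)^2A(n+1)=(an^2+an+b)A(n)-cn^2A(n-1),$$ with $(a,b,c)$ equal to: $\mathbf{A}$: $(7,2,-8)$; $\mathbf{B}$: $(9,3,27)$; $\mathbf{C}$: $(10,3,9)$; $\mathbf{D}$: $(11,3,-1)$; $\mathbf{E}$: $(12,4,32)$; $\mathbf{F}$: $(17,6,72)$. (2) The six sequences of Almkvist--Zudilin and the three sequences of Cooper satisfy $$(n+1)^3A(n+1)=(2n+1)(an^2+an+b)A(n)-n(cn^2+d)A(n-1),$$ with $(a,b,c,d)$ equal to: $(\alpha)$: $(10,4,64,0)$; $(\gamma)$: $(17,5,1,0)$; $(\delta)$: $(7,3,81,0)$; $(\epsilon)$: $(12,4,16,0)$; $(\eta)$: $(11,5,125,0)$; $(\zeta)$: $(9,3,-27,0)$; $s_7$: $(13,4,-27,3)$; $s_{10}$: $(6,2,-64,4)$; $s_{18}$: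 $(14,6,192,-12)$. For example, $(\gamma)$ is $\sum_{k=0}^n\binom{n}{k}^2\binom{n+k}{k}^2$; $\mathbf{D}$ is $\sum_{k=0}^n\binom{n}{k}^2\binom{n+k}{k}$; $\mathbf{F}$ is $\sum_{k=0}^n(-1)^k8^{n-k}\binom{n}{k}\sum_{l=0}^k\binom{k}{l}^3$; and $(\delta)$ is $\sum_{k=0}^n(-1)^k3^{n-3k}\binom{n}{3k}\binom{n+k}{n}\frac{(3k)!}{k!^3}$ (terms with $3k>n$ being zero). *)

theory Defs
  imports "HOL-Number_Theory.Number_Theory"
begin

text \<open>The convention \<open>A(-1) = 0\<close>: the term preceding \<open>A n\<close>, extended by 0 at \<open>n = 0\<close>.\<close>

definition prev_term :: "(nat \<Rightarrow> int) \<Rightarrow> nat \<Rightarrow> int" where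
  "prev_term A n = (if n = 0 then 0 else A (n - 1))"

text \<open>
  The leading coefficients \<open>(n+1)\<^sup>2\<close> and \<open>(n+1)\<^sup>3\<close> are nonzero, so for given parameters each of the
  following two predicates has at most one solution. For the parameters listed below the solution
  over the rationals is known to be integer-valued.
\<close>

definition zagier_sequence :: "int \<Rightarrow> int \<Rightarrow> int \<Rightarrow> (nat \<Rightarrow> int) \<Rightarrow> bool" where
  "zagier_sequence a b c A \<longleftrightarrow>
     A 0 = 1 \<and>
     (\<forall>n. (int n + 1)^2 * A (n + 1) =
            (a * (int n)^2 + a * int n + b) * A n - c * (int n)^2 * prev_term A n)"

definition cooper_sequence :: "int \<Rightarrow> int \<Rightarrow> int \<Rightarrow> int \<Rightarrow> (nat \<Rightarrow> int) \<Rightarrow> bool" where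
  "cooper_sequence a b c d A \<longleftrightarrow>
     A 0 = 1 \<and>
     (\<forall>n. (int n + 1)^3 * A (n + 1) =
            (2 * int n + 1) * (a * (int n)^2 + a * int n + b) * A n
              - int n * (c * (int n)^2 + d) * prev_term A n)"

definition zagier_params :: "(int \<times> int \<times> int) set" where
  "zagier_params =
    {(7, 2, -8),      \<comment> \<open>\<open>A\<close>\<close>
     (9, 3, 27),      \<comment> \<open>\<open>B\<close>\<close>
     (10, 3, 9),      \<comment> \<open>\<open>C\<close>\<close>
     (11, 3, -1),     \<comment> \<open>\<open>D\<close>\<close>
     (12, 4, 32),     \<comment> \<open>\<open>E\<close>\<close>
     (17, 6, 72)}     \<comment> \<open>\<open>F\<close>\<close>"

definition cooper_params :: "(int \<times> int \<times> int \<times> int) set" where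
  "cooper_params =
    {(10, 4, 64, 0),      \<comment> \<open>\<open>\<alpha>\<close>\<close>
     (17, 5, 1, 0),       \<comment> \<open>\<open>\<gamma>\<close>\<close>
     (7, 3, 81, 0),       \<comment> \<open>\<open>\<delta>\<close>\<close>
     (12, 4, 16, 0),      \<comment> \<open>\<open>\<epsilon>\<close>\<close>
     (11, 5, 125, 0),     \<comment> \<open>\<open>\<eta>\<close>\<close>
     (9, 3, -27, 0),      \<comment> \<open>\<open>\<zeta>\<close>\<close>
     (13, 4, -27, 3),     \<comment> \<open>\<open>s\<^sub>7\<close>\<close>
     (6, 2, -64, 4),      \<comment> \<open>\<open>s\<^sub>1\<^sub>0\<close>\<close>
     (14, 6, 192, -12)}   \<comment> \<open>\<open>s\<^sub>1\<^sub>8\<close>\<close>"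

definition sporadic_apery_like :: "(nat \<Rightarrow> int) \<Rightarrow> bool" where
  "sporadic_apery_like A \<longleftrightarrow>
     (\<exists>(a, b, c) \<in> zagier_params. zagier_sequence a b c A) \<or>
     (\<exists>(a, b, c, d) \<in> cooper_params. cooper_sequence a b c d A)"

end

theory Submission
  imports Defs "HOL.Complex" "HOL-Library.Poly_Mapping" "HOL-Library.Product_Plus" "HOL-Library.Product_Lexorder"
begin

text \<open>
  Apart from \<open>E\<close> and \<open>s\<^sub>1\<^sub>8\<close>, every sequence is written as the constant terms of the powers of a
  Laurent polynomial \<open>\<Lambda> = \<Prod>\<^sub>i L\<^sub>i / x\<^bsup>\<mu>\<^esup>\<close>. If the exponents of a polynomial \<open>L\<close> with coefficients
  \<open>\<plusminus>1\<close> are affinely independent modulo \<open>p\<close>, the coefficients of \<open>L\<^bsup>N\<^esup>\<close> are multinomials, and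
  comparing the coefficients of \<open>x\<^bsup>pe\<^esup>\<close> in \<open>L\<^bsup>pN\<^esup>\<close> and of \<open>x\<^bsup>e\<^esup>\<close> in \<open>L\<^bsup>N\<^esup>\<close> gives a unit
  congruent to 1 modulo \<open>p\<^bsup>2t\<^esup>\<close>, where \<open>p\<^bsup>t\<^esup>\<close> divides the exponents, while the coefficients
  themselves gain the factors \<open>p\<close> that \<open>e\<close> lacks. The resulting congruence modulo
  \<open>p\<^bsup>r+s+1\<^esup>\<close> survives products: each summand of a convolution either has two deficient
  factors or satisfies it in both. At \<open>e = N\<mu>\<close> it is the supercongruence modulo \<open>p\<^bsup>2r\<^esup>\<close>.
  The recurrence of the constant terms is certified by a vector field whose divergence is the
  recurrence operator applied to the powers of \<open>\<Lambda>\<close>.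

  For \<open>B\<close> the polynomial \<open>3xyz - x\<^sup>3 - y\<^sup>3 - z\<^sup>3\<close> splits into linear forms over the cube roots of
  unity. For \<open>E\<close> and \<open>s\<^sub>1\<^sub>8\<close> there is a single sum whose summand is divisible by the square of a
  binomial coefficient, which plays the role of the two deficient factors.
\<close>

section \<open>Factorial quotients modulo powers of a prime\<close>

text \<open>Each sequence is known only through its recurrence, so an explicit formula has to be
  certified before p can enter. The factors \<open>L_i\<close> get coefficients 1 and -1 because
  c^(p i) = c^i then holds exactly for odd p; for another c prime to p and p^t dividing p i, it
  would hold in general only modulo p^t, half the precision required. The simplices of exponents
  have volumes that are powers of 2, so p = 3 is treated like any larger prime. Three obstacles
  remain. The factors of eta have five terms, one more than a simplex has vertices; their affine
  relation costs divisibility that the multinomial coefficient has to return. For B the linear forms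
  are simplices, but their coefficients are roots of unity, moved by p-th powers: only the trace to
  the rationals is preserved, and at p = 3, where every cube root of unity collapses to 1, a
  symmetry has to take its place. For E and s18 the binomial (n choose k) is visible only once; its
  second copy is hidden in the central binomial coefficients, with a super Catalan number as
  cofactor.\<close>

definition unit_fact :: "nat \<Rightarrow> nat \<Rightarrow> int" where
  "unit_fact p a = (\<Prod>j | j \<in> {1..p * a} \<and> \<not> p dvd j. int j)"

lemma fact_mult_eq_unit_fact:
  assumes "p > 0"
  shows "(fact (p * a) :: int) = int p ^ a * fact a * unit_fact p a"
proof -
  have split: "{1..p * a} = {j \<in> {1..p * a}. \<not> p dvd j} \<union> (*) p ` {1..a}"
    using assms by (auto simp: image_iff dvd_def) 
  have "(fact (p * a) :: int) = (\<Prod>j\<in>{1..p * a}. int j)"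
    by (simp add: fact_prod)
  also have "\<dots> = unit_fact p a * (\<Prod>j\<in>(*) p ` {1..a}. int j)"
    unfolding unit_fact_def by (subst split, subst prod.union_disjoint) auto
  also have "(\<Prod>j\<in>(*) p ` {1..a}. int j) = (\<Prod>j\<in>{1..a}. int p * int j)"
    using assms by (subst prod.reindex) (auto simp: inj_on_def)
  also have "\<dots> = int p ^ a * fact a"
    by (simp add: prod.distrib fact_prod)
  finally show ?thesis by (simp add: ac_simps)
qed

lemma not_dvd_prod:
  fixes p :: nat
  assumes "prime p" "finite S" "\<And>j. j \<in> S \<Longrightarrow> \<not> int p dvd f j"
  shows "\<not> int p dvd (\<Prod>j\<in>S. f j)"
  using assms(2,3,1) by (induction S rule: finite_induct) (auto simp: prime_dvd_mult_iff)

lemma unit_fact_not_dvd: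
  assumes "prime p"
  shows "\<not> int p dvd unit_fact p a"
  unfolding unit_fact_def by (rule not_dvd_prod) (use assms in auto)

lemma cong_prod_int:
  fixes f g :: "'a \<Rightarrow> int"
  assumes "\<And>x. x \<in> S \<Longrightarrow> [f x = g x] (mod m)"
  shows "[prod f S = prod g S] (mod m)"
  using assms by (induction S rule: infinite_finite_induct) (auto intro: cong_mult)

text \<open>
  Reflecting \<open>j \<mapsto> p b - j\<close> shows that the squares of both sides agree modulo \<open>p\<^bsup>2t\<^esup>\<close>.
\<close>
lemma shifted_unit_fact_cong:
  assumes p: "prime p" "odd p" and t: "int p ^ t dvd x" "p ^ t dvd p * b" "t \<ge> 1"
  shows "[(\<Prod>j | j \<in> {1..p * b} \<and> \<not> p dvd j. x + int j) = unit_fact p b] (mod int p ^ (2 * t))"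
proof -
  define S where "S = {j \<in> {1..p * b}. \<not> p dvd j}"
  define V where "V = (\<Prod>j\<in>S. x + int j)"
  define U where "U = (\<Prod>j\<in>S. int j)"
  have fin: "finite S" unfolding S_def by auto
  have refl: "(\<Prod>j\<in>S. f (p * b - j)) = (\<Prod>j\<in>S. f j)" for f :: "nat \<Rightarrow> int"
  proof (rule prod.reindex_bij_witness[of _ "\<lambda>j. p * b - j" "\<lambda>j. p * b - j"])
    show closed: "p * b - j \<in> S" if "j \<in> S" for j
    proof -
      have j: "1 \<le> j" "j \<le> p * b" "\<not> p dvd j" using that by (auto simp: S_def)
      then have "\<not> p dvd p * b - j" using dvd_diffD1[of p "p * b" j] dvd_triv_left by blast
      moreover have "j \<noteq> p * b" using j by auto
      ultimately show ?thesis using j by (auto simp: S_def)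
    qed
    show "p * b - j \<in> S" if "j \<in> S" for j by (rule closed[OF that])
  qed (auto simp: S_def)
  have refl': "(\<Prod>j\<in>S. x + (int (p * b) - int j)) = V"
    unfolding V_def using refl[of "\<lambda>j. x + int j"]
    by (simp add: S_def of_nat_diff cong: prod.cong_simp)
  have refl'': "(\<Prod>j\<in>S. (int (p * b) - int j)) = U"
    unfolding U_def using refl[of "\<lambda>j. int j"]
    by (simp add: S_def of_nat_diff cong: prod.cong_simp)
  have tb: "int p ^ t dvd int (p * b)"
    using t(2) by (metis of_nat_dvd_iff of_nat_power)
  have "[V * V = U * U] (mod int p ^ (2 * t))"
  proof -
    have "V * V = (\<Prod>j\<in>S. (x + int j) * (x + (int (p * b) - int j)))"
      using refl' by (simp add: prod.distrib V_def)
    moreover have "U * U = (\<Prod>j\<in>S. int j * (int (p * b) - int j))"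
      using refl'' by (simp add: prod.distrib U_def)
    moreover have "[(x + int j) * (x + (int (p * b) - int j)) = int j * (int (p * b) - int j)] (mod int p ^ (2 * t))" for j
    proof -
      have "int p ^ t * int p ^ t dvd x * (x + int (p * b))"
        by (intro mult_dvd_mono dvd_add t tb)
      moreover have "(x + int j) * (x + (int (p * b) - int j)) - int j * (int (p * b) - int j) = x * (x + int (p * b))"
        by (simp add: algebra_simps)
      ultimately show ?thesis
        by (simp add: cong_iff_dvd_diff mult_2 power_add)
    qed
    ultimately show ?thesis by (auto intro: cong_prod_int)
  qed
  then have d1: "int p ^ (2 * t) dvd (V + U) * (V - U)"
    by (simp add: cong_iff_dvd_diff algebra_simps)
  \<comment> \<open>The whole power of p falls to V - U: modulo p the other factor V + U is 2 U, a
    unit because p is odd.\<close>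
  have "[V = U] (mod int p)"
    unfolding V_def U_def
  proof (rule cong_prod_int)
    fix j
    have "int p dvd int p ^ t" using t(3) by (simp add: dvd_power)
    then have "int p dvd x" using t(1) by (rule dvd_trans)
    then show "[x + int j = int j] (mod int p)" by (simp add: cong_iff_dvd_diff)
  qed
  then have VU: "[V + U = 2 * U] (mod int p)" by (simp add: cong_iff_dvd_diff)
  have "\<not> int p dvd U"
    unfolding U_def by (rule not_dvd_prod) (use p fin in \<open>auto simp: S_def\<close>)
  moreover have "\<not> int p dvd 2"
  proof
    assume "int p dvd 2"
    then have "p dvd 2" by (metis int_dvd_int_iff of_nat_numeral)
    then have "p = 2" using p primes_dvd_imp_eq two_is_prime_nat by blast
    then show False using p by simp
  qed
  ultimately have "\<not> int p dvd 2 * U"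
    using p by (simp add: prime_dvd_mult_iff)
  with VU have "\<not> int p dvd V + U"
    by (metis cong_dvd_iff)
  then have "coprime (int p ^ (2 * t)) (V + U)"
    using p by (simp add: prime_imp_coprime)
  then have "int p ^ (2 * t) dvd V - U"
    using d1 coprime_dvd_mult_right_iff by blast
  then show ?thesis
    unfolding V_def U_def S_def unit_fact_def by (simp add: cong_iff_dvd_diff)
qed

text \<open>The factors between p a and p (a + b) are p a + j with j prime to p, so the upper part
  is the product of the previous lemma with shift p a.\<close>

lemma unit_fact_add_cong:
  assumes p: "prime p" "odd p" and t: "p ^ t dvd p * a" "p ^ t dvd p * b" "t \<ge> 1"
  shows "[unit_fact p (a + b) = unit_fact p a * unit_fact p b] (mod int p ^ (2 * t))"
proof -
  define S where "S = {j \<in> {1..p * b}. \<not> p dvd j}"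
  have split: "{j \<in> {1..p * (a + b)}. \<not> p dvd j} = {j \<in> {1..p * a}. \<not> p dvd j} \<union> (\<lambda>j. p * a + j) ` S"
  proof (intro equalityI subsetI)
    fix j assume j: "j \<in> {j \<in> {1..p * (a + b)}. \<not> p dvd j}"
    show "j \<in> {j \<in> {1..p * a}. \<not> p dvd j} \<union> (\<lambda>j. p * a + j) ` S"
    proof (cases "j \<le> p * a")
      case False
      then have "j = p * a + (j - p * a)" "j - p * a \<in> S"
        using j by (auto simp: S_def algebra_simps dvd_diff_nat dest: dvd_diffD)
      then show ?thesis by blast
    qed (use j in auto)
  qed (auto simp: S_def algebra_simps dvd_add_right_iff)
  have "unit_fact p (a + b) = unit_fact p a * (\<Prod>j\<in>(\<lambda>j. p * a + j) ` S. int j)"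
    unfolding unit_fact_def split by (subst prod.union_disjoint) (auto simp: S_def)
  also have "(\<Prod>j\<in>(\<lambda>j. p * a + j) ` S. int j) = (\<Prod>j\<in>S. int (p * a) + int j)"
    by (subst prod.reindex) (auto simp: inj_on_def)
  finally have eq: "unit_fact p (a + b) = unit_fact p a * (\<Prod>j\<in>S. int (p * a) + int j)" .
  have "int p ^ t dvd int (p * a)"
    using t(1) by (metis of_nat_dvd_iff of_nat_power)
  from shifted_unit_fact_cong[OF p this t(2,3)] show ?thesis
    unfolding eq S_def by (intro cong_mult cong_refl) (simp add: conj_commute)
qed

text \<open>\<open>x / y\<close> is a \<open>p\<close>-adic unit congruent to 1 modulo \<open>p\<^bsup>m\<^esup>\<close>, or \<open>x = y = 0\<close>.\<close>
definition ucong :: "nat \<Rightarrow> nat \<Rightarrow> int \<Rightarrow> int \<Rightarrow> bool" where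
  "ucong p m x y \<longleftrightarrow> (\<exists>u v. \<not> int p dvd u \<and> \<not> int p dvd v \<and> [u = v] (mod int p ^ m) \<and> u * x = v * y)"

lemma ucong_refl: "prime p \<Longrightarrow> ucong p m x x"
  unfolding ucong_def by (rule exI[of _ 1], rule exI[of _ 1]) auto

lemma ucong_sym: "ucong p m x y \<Longrightarrow> ucong p m y x"
  unfolding ucong_def by (metis cong_sym)

lemma ucong_mult:
  assumes "prime p" "ucong p m x y" "ucong p m x' y'"
  shows "ucong p m (x * x') (y * y')"
proof -
  from assms obtain u v u' v' where
    "\<not> int p dvd u" "\<not> int p dvd v" "[u = v] (mod int p ^ m)" "u * x = v * y"
    "\<not> int p dvd u'" "\<not> int p dvd v'" "[u' = v'] (mod int p ^ m)" "u' * x' = v' * y'"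
    unfolding ucong_def by blast
  moreover from this have "(u * u') * (x * x') = (v * v') * (y * y')"
    by (metis mult.assoc mult.left_commute)
  ultimately show ?thesis unfolding ucong_def using assms(1)
    by (intro exI[of _ "u * u'"] exI[of _ "v * v'"])
       (simp add: prime_dvd_mult_iff cong_mult)
qed

text \<open>The relative precision m and the k factors p of y add up: u (x - y) = (v - u) y, and u
  is a unit.\<close>

lemma ucong_diff_dvd:
  assumes "prime p" "ucong p m x y" "int p ^ k dvd y"
  shows "int p ^ (m + k) dvd x - y"
proof -
  from assms obtain u v where uv: "\<not> int p dvd u" "[u = v] (mod int p ^ m)" "u * x = v * y"
    unfolding ucong_def by blast
  have "u * (x - y) = (v - u) * y" using uv(3) by (simp add: algebra_simps)
  moreover have "int p ^ (m + k) dvd (v - u) * y"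
    unfolding power_add using uv(2) assms(3)
    by (intro mult_dvd_mono) (auto simp: cong_iff_dvd_diff dvd_diff_commute)
  ultimately have "int p ^ (m + k) dvd u * (x - y)" by simp
  moreover have "coprime (int p ^ (m + k)) u"
    using uv(1) assms(1) by (simp add: prime_imp_coprime)
  ultimately show ?thesis using coprime_dvd_mult_right_iff by blast
qed

lemma ex_boundary:
  fixes D :: "nat \<Rightarrow> bool"
  assumes "D 0" "\<not> D m"
  shows "\<exists>t<m. D t \<and> \<not> D (Suc t)"
  using ex_least_nat_less[of "\<lambda>k. \<not> D k" m] assms by auto

text \<open>\<open>D t\<close> will say that p^t divides all indices involved. Where it fails for
  the first time after a level t < r, the quotient of x and y is known modulo p^(2 t), and x itself
  supplies the other 2 (r - t) factors.\<close>

lemma ucong_diff_dvd_levels: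
  assumes p: "prime p" and "D 0" and uc: "\<And>t. D t \<Longrightarrow> ucong p (2 * t) x y"
    and x: "\<And>t. t < r \<Longrightarrow> D t \<Longrightarrow> \<not> D (Suc t) \<Longrightarrow> int p ^ (2 * (r - t)) dvd x"
  shows "int p ^ (2 * r) dvd x - y"
proof (cases "D r")
  case True
  from ucong_diff_dvd[OF p uc[OF this], of 0] show ?thesis by simp
next
  case False
  with ex_boundary[of D] assms(2) obtain t where t: "t < r" "D t" "\<not> D (Suc t)" by blast
  from ucong_diff_dvd[OF p ucong_sym[OF uc[OF t(2)]] x[OF t]]
  have "int p ^ (2 * t + 2 * (r - t)) dvd y - x" .
  moreover have "2 * t + 2 * (r - t) = 2 * r" using t(1) by simp
  ultimately show ?thesis by (metis dvd_diff_commute)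
qed

text \<open>In the applications \<open>\<phi>\<close> multiplies the summation indices by p: terms
  outside its image vanish modulo d, the others are compared with their preimages.\<close>

lemma sum_diff_dvd:
  fixes f :: "'a \<Rightarrow> int" and g :: "'b \<Rightarrow> int"
  assumes "finite I" "inj_on \<phi> J" "\<phi> ` J \<subseteq> I"
    and "\<And>x. x \<in> I - \<phi> ` J \<Longrightarrow> d dvd f x" "\<And>x. x \<in> J \<Longrightarrow> d dvd f (\<phi> x) - g x"
  shows "d dvd sum f I - sum g J"
proof -
  have "sum f I = sum f (I - \<phi> ` J) + sum f (\<phi> ` J)"
    using assms(3,1) by (rule sum.subset_diff)
  then have "sum f I - sum g J = sum f (I - \<phi> ` J) + (\<Sum>x\<in>J. f (\<phi> x) - g x)"
    by (simp add: sum.reindex[OF assms(2)] sum_subtractf)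
  then show ?thesis using assms(4,5) by (auto intro!: dvd_add dvd_sum)
qed

text \<open>A congruence of Jacobsthal type. Taking the multiples of p out of each factorial leaves
  a quotient of \<open>unit_fact\<close> values. Since p^t need only divide p a and p b, t = 1 is
  always available.\<close>

lemma ucong_binomial:
  assumes p: "prime p" "odd p" and t: "p ^ t dvd p * a" "p ^ t dvd p * b"
  shows "ucong p (2 * t) (int (p * (a + b) choose (p * a))) (int ((a + b) choose a))"
proof -
  have pos: "p > 0" using p prime_gt_0_nat by blast
  have "(fact (p * a) :: int) * fact (p * b) * int (p * (a + b) choose (p * a)) = fact (p * (a + b))"
    using arg_cong[OF binomial_fact_lemma[of "p * a" "p * (a + b)"], of int]
    by (simp add: algebra_simps)
  moreover have "(fact a :: int) * fact b * int ((a + b) choose a) = fact (a + b)"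
    using arg_cong[OF binomial_fact_lemma[of a "a + b"], of int] by (simp add: algebra_simps)
  moreover have "(fact (p * (a + b)) :: int) = int p ^ (a + b) * fact (a + b) * unit_fact p (a + b)"
    by (rule fact_mult_eq_unit_fact[OF pos])
  ultimately have "int p ^ a * fact a * unit_fact p a * (int p ^ b * fact b * unit_fact p b) *
      int (p * (a + b) choose (p * a)) = int p ^ a * int p ^ b * (fact a * fact b * int ((a + b) choose a)) * unit_fact p (a + b)"
    by (simp only: fact_mult_eq_unit_fact[OF pos, of a] fact_mult_eq_unit_fact[OF pos, of b] power_add)
  then have "(int p ^ a * int p ^ b * fact a * fact b) *
      (unit_fact p a * unit_fact p b * int (p * (a + b) choose (p * a))) =
      (int p ^ a * int p ^ b * fact a * fact b) * (unit_fact p (a + b) * int ((a + b) choose a))"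
    by (simp only: ac_simps)
  then have eq: "unit_fact p a * unit_fact p b * int (p * (a + b) choose (p * a)) =
      unit_fact p (a + b) * int ((a + b) choose a)"
    using pos by (subst (asm) mult_cancel_left) auto
  have "[unit_fact p a * unit_fact p b = unit_fact p (a + b)] (mod int p ^ (2 * t))"
  proof (cases "t = 0")
    case False
    then show ?thesis using unit_fact_add_cong[OF p t] by (simp add: cong_sym)
  qed simp
  moreover have "\<not> int p dvd unit_fact p a * unit_fact p b"
    using unit_fact_not_dvd[OF p(1)] p by (simp add: prime_dvd_mult_iff)
  ultimately show ?thesis
    unfolding ucong_def using unit_fact_not_dvd[OF p(1)] eq by blast
qed

section \<open>Laurent polynomials in three variables\<close>

text \<open>The lexicographic order on exponents makes Laurent polynomials over an integral domain
  an integral domain, as needed for cancelling factors and for applying identities proved by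
  \<open>algebra\<close> over \<open>idom\<close>.\<close>

instance prod :: (linordered_ab_group_add, linordered_ab_group_add) ordered_ab_group_add
  by standard (auto simp: less_eq_prod_def)

instance prod :: (linordered_ab_group_add, linordered_ab_group_add) linordered_ab_group_add ..

type_synonym expo = "int \<times> int \<times> int"
type_synonym 'a laurent = "expo \<Rightarrow>\<^sub>0 'a"

abbreviation "cf \<equiv> Poly_Mapping.lookup"
abbreviation "laurent_supp \<equiv> Poly_Mapping.keys"

lemma laurent_sum_singles:
  fixes f :: "'a \<Rightarrow>\<^sub>0 'b::comm_monoid_add"
  shows "(\<Sum>h\<in>laurent_supp f. Poly_Mapping.single h (cf f h)) = f"
proof (rule poly_mapping_eqI)
  fix k
  have "cf (\<Sum>h\<in>laurent_supp f. Poly_Mapping.single h (cf f h)) k =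
      (\<Sum>h\<in>laurent_supp f. if h = k then cf f h else 0)"
    by (simp add: lookup_sum lookup_single when_def)
  also have "\<dots> = cf f k" by (simp add: in_keys_iff)
  finally show "cf (\<Sum>h\<in>laurent_supp f. Poly_Mapping.single h (cf f h)) k = cf f k" .
qed

lemma laurent_induct [case_names single add]:
  fixes f :: "'a \<Rightarrow>\<^sub>0 'b::comm_monoid_add"
  assumes "\<And>e c. P (Poly_Mapping.single e c)" "\<And>f g. P f \<Longrightarrow> P g \<Longrightarrow> P (f + g)"
  shows "P f"
proof -
  have "P (\<Sum>h\<in>S. Poly_Mapping.single h (cf f h))" if "finite S" for S
    using that
  proof (induction S rule: finite_induct)
    case empty
    show ?case using assms(1)[of undefined 0] by simp
  qed (simp add: assms)
  from this[of "laurent_supp f"] show ?thesis by (simp add: laurent_sum_singles)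
qed

section \<open>Exponent vectors and Euler derivations\<close>

definition scale :: "int \<Rightarrow> expo \<Rightarrow> expo" where
  "scale k e = (case e of (a, b, c) \<Rightarrow> (k * a, k * b, k * c))"

definition expo_dvd :: "int \<Rightarrow> expo \<Rightarrow> bool" where
  "expo_dvd k e \<longleftrightarrow> (case e of (a, b, c) \<Rightarrow> k dvd a \<and> k dvd b \<and> k dvd c)"

text \<open>A derivation for additive \<open>l\<close>; the three coordinate projections give x
  d/dx, y d/dy and z d/dz.\<close>

definition theta :: "(expo \<Rightarrow> int) \<Rightarrow> 'a laurent \<Rightarrow> 'a::comm_ring_1 laurent" where
  "theta l f = Poly_Mapping.mapp (\<lambda>e c. of_int (l e) * c) f"

lemma lookup_theta: "cf (theta l f) e = of_int (l e) * cf f e"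
  by (cases "e \<in> laurent_supp f") (auto simp: theta_def lookup_mapp in_keys_iff)

lemma theta_add: "theta l (f + g) = theta l f + theta l g"
  by (rule poly_mapping_eqI) (simp add: lookup_theta lookup_add algebra_simps)

lemma theta_zero [simp]: "theta l 0 = 0"
  by (rule poly_mapping_eqI) (simp add: lookup_theta)

lemma theta_single: "theta l (Poly_Mapping.single e c) = Poly_Mapping.single e (of_int (l e) * c)"
  by (rule poly_mapping_eqI) (simp add: lookup_theta lookup_single when_def)

lemma theta_mult:
  assumes l: "\<And>a b. l (a + b) = l a + l b"
  shows "theta l (f * g) = theta l f * g + f * theta l g"
proof (induction f rule: laurent_induct)
  case (single e c)
  show ?case
  proof (induction g rule: laurent_induct)
    case (single e' c')
    have "of_int (l (e + e')) * (c * c') = of_int (l e) * c * c' + c * (of_int (l e') * c')"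
      by (simp add: l algebra_simps)
    then show ?case
      by (simp only: mult_single theta_single single_add)
  qed (simp add: theta_add distrib_left distrib_right add_ac)
qed (simp add: theta_add distrib_left distrib_right add_ac)

lemma theta_one:
  assumes l: "\<And>a b. l (a + b) = l a + l b"
  shows "theta l 1 = 0"
proof -
  have "l 0 = 0" using l[of 0 0] by simp
  then show ?thesis
    by (intro poly_mapping_eqI) (auto simp: lookup_theta lookup_one when_def)
qed

lemma theta_power:
  assumes l: "\<And>a b. l (a + b) = l a + l b"
  shows "theta l (f ^ n) = of_nat n * f ^ (n - 1) * theta l f"
proof (induction n)
  case (Suc n)
  then show ?case
    by (cases n) (simp_all add: theta_mult[OF l] theta_one[OF l] distrib_left distrib_right mult_ac)
qed (simp add: theta_one[OF l])

text \<open>The range \<open>S\<close> is left free so that the two convolutions compared in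
  \<open>good_mult\<close> can run over sets matched by scaling with p.\<close>

lemma lookup_mult_sum:
  fixes f g :: "'a::comm_ring_1 laurent"
  assumes "finite S" "laurent_supp f \<subseteq> S"
  shows "cf (f * g) e = (\<Sum>h\<in>S. cf f h * cf g (e - h))"
proof -
  have "f * g = (\<Sum>h\<in>laurent_supp f. Poly_Mapping.single h (cf f h)) * g"
    by (simp only: laurent_sum_singles)
  also have "\<dots> = (\<Sum>h\<in>laurent_supp f. Poly_Mapping.single h (cf f h) * g)"
    by (rule sum_distrib_right)
  finally have fg: "f * g = (\<Sum>h\<in>laurent_supp f. Poly_Mapping.single h (cf f h) * g)" .
  have "cf (f * g) e = (\<Sum>h\<in>laurent_supp f. cf (Poly_Mapping.single h (cf f h) * g) e)"
    by (subst fg) (simp only: lookup_sum)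
  also have "\<dots> = (\<Sum>h\<in>laurent_supp f. cf f h * cf g (e - h))"
  proof (rule sum.cong)
    fix h
    have "cf (Poly_Mapping.single h c * g) e = c * cf g (e - h)" for c
    proof (induction g rule: laurent_induct)
      case (single e' c')
      have "h + e' = e \<longleftrightarrow> e' = e - h" by (auto simp: eq_diff_eq add.commute)
      then show ?case by (simp add: mult_single lookup_single when_def)
    qed (simp add: distrib_left lookup_add)
    then show "cf (Poly_Mapping.single h (cf f h) * g) e = cf f h * cf g (e - h)" .
  qed simp
  also have "\<dots> = (\<Sum>h\<in>S. cf f h * cf g (e - h))"
    by (rule sum.mono_neutral_left) (use assms in \<open>auto simp: in_keys_iff\<close>)
  finally show ?thesis .
qed

section \<open>A supercongruence for coefficients of powers\<close>

lemma prime_power_dvd_cofactor: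
  fixes a b :: int
  assumes p: "prime p" and "int p ^ r dvd a * b" "\<not> int p ^ Suc s dvd a"
  shows "int p ^ (r - s) dvd b"
proof -
  have pi: "prime (int p)" using p by simp
  have "a \<noteq> 0" using assms(3) by auto
  then obtain a' where a': "a = int p ^ multiplicity (int p) a * a'" "\<not> int p dvd a'"
    using multiplicity_decompose'[of a "int p"] pi not_prime_unit by metis
  define t where "t = multiplicity (int p) a"
  have "t \<le> s"
  proof (rule ccontr)
    assume "\<not> t \<le> s"
    then have "int p ^ Suc s dvd int p ^ t" by (intro le_imp_power_dvd) simp
    then show False using assms(3) a'(1) t_def by (metis dvd_mult2)
  qed
  have "int p ^ (r - t) dvd a' * b"
  proof (cases "t \<le> r")
    case True
    then have "int p ^ r = int p ^ t * int p ^ (r - t)" by (simp flip: power_add)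
    moreover have "int p \<noteq> 0" using pi by auto
    ultimately show ?thesis
      using assms(2) a'(1) t_def by (metis dvd_times_left_cancel_iff mult.assoc power_not_zero)
  qed simp
  moreover have "coprime (int p ^ (r - t)) a'"
    using a'(2) pi by (simp add: prime_imp_coprime)
  ultimately have "int p ^ (r - t) dvd b"
    using coprime_dvd_mult_right_iff by blast
  then show ?thesis using \<open>t \<le> s\<close> by (meson diff_le_mono2 dvd_trans le_imp_power_dvd)
qed

lemma coordinate_additive:
  "fst (a + b) = fst a + fst b" "fst (snd (a + b)) = fst (snd a) + fst (snd b)"
  "snd (snd (a + b)) = snd (snd a) + snd (snd b)"
  by simp_all

text \<open>The operator \<open>theta l\<close> maps \<open>P\<^bsup>N\<^esup>\<close> to a multiple of \<open>N\<close>.\<close>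
lemma power_coeff_dvd:
  fixes P :: "int laurent"
  assumes p: "prime p" and N: "p ^ r dvd N" and e: "\<not> expo_dvd (int p ^ Suc s) e"
  shows "int p ^ (r - s) dvd cf (P ^ N) e"
proof -
  have *: "int p ^ r dvd l e * cf (P ^ N) e" if l: "\<And>a b. l (a + b) = l a + l b" for l
  proof -
    have "l e * cf (P ^ N) e = cf (theta l (P ^ N)) e" by (simp add: lookup_theta)
    also have "\<dots> = cf (of_nat N * (P ^ (N - 1) * theta l P)) e"
      by (simp add: theta_power[OF l] mult.assoc)
    also have "\<dots> = int N * cf (P ^ (N - 1) * theta l P) e"
    proof -
      have "cf (of_nat k * f) e = int k * cf f e" for k and f :: "int laurent"
        by (induction k) (simp_all add: lookup_add algebra_simps)
      then show ?thesis .
    qed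
    finally show ?thesis
      using N by (metis dvd_mult2 of_nat_dvd_iff of_nat_power)
  qed
  obtain a b c where abc: "e = (a, b, c)" by (cases e)
  \<comment> \<open>A coordinate not divisible by p^(s + 1) absorbs at most s of the r factors p of
    N.\<close>
  from e consider "\<not> int p ^ Suc s dvd a" | "\<not> int p ^ Suc s dvd b" | "\<not> int p ^ Suc s dvd c"
    unfolding expo_dvd_def abc by auto
  then show ?thesis
  proof cases
    case 1
    show ?thesis
      by (rule prime_power_dvd_cofactor[OF p _ 1])
         (use *[of fst] abc in \<open>simp add: coordinate_additive\<close>)
  next
    case 2
    show ?thesis
      by (rule prime_power_dvd_cofactor[OF p _ 2])
         (use *[of "\<lambda>e. fst (snd e)"] abc in \<open>simp add: coordinate_additive\<close>)
  next
    case 3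
    show ?thesis
      by (rule prime_power_dvd_cofactor[OF p _ 3])
         (use *[of "\<lambda>e. snd (snd e)"] abc in \<open>simp add: coordinate_additive\<close>)
  qed
qed

text \<open>The bound is stated for every level s, because a convolution at e meets pairs h, e - h
  that are less divisible than e. In the end only s = r - 1 is used.\<close>

definition good :: "nat \<Rightarrow> int laurent \<Rightarrow> bool" where
  "good p P \<longleftrightarrow> (\<forall>r n s e. s < r \<longrightarrow> expo_dvd (int p ^ s) e \<longrightarrow>
     int p ^ (r + s + 1) dvd cf (P ^ (p ^ r * n)) (scale (int p) e) - cf (P ^ (p ^ (r - 1) * n)) e)"

lemma expo_dvd_scale: "k \<noteq> 0 \<Longrightarrow> expo_dvd (k * m) (scale k e) \<longleftrightarrow> expo_dvd m e"
  by (cases e) (simp add: expo_dvd_def scale_def)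

lemma expo_dvd_diff: "expo_dvd k e \<Longrightarrow> expo_dvd k h \<Longrightarrow> expo_dvd k (e - h)"
  by (cases e; cases h) (simp add: expo_dvd_def)

lemma expo_dvd_diff_iff: "expo_dvd k e \<Longrightarrow> expo_dvd k (e - h) \<longleftrightarrow> expo_dvd k h"
  by (cases e; cases h) (simp add: expo_dvd_def dvd_diff_right_iff)

lemma expo_dvd_trans: "k dvd m \<Longrightarrow> expo_dvd m e \<Longrightarrow> expo_dvd k e"
  by (cases e) (auto simp: expo_dvd_def)

lemma expo_dvd_scale_self: "expo_dvd k (scale k e)"
  by (cases e) (simp add: expo_dvd_def scale_def)

lemma expo_dvd_iff_scale: "expo_dvd k e \<longleftrightarrow> (\<exists>e'. e = scale k e')"
  by (cases e) (auto simp: expo_dvd_def scale_def dvd_def)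

lemma scale_diff: "scale k (e - h) = scale k e - scale k h"
  by (cases e; cases h) (simp add: scale_def algebra_simps)

lemma inj_scale: "k \<noteq> 0 \<Longrightarrow> inj (scale k)"
  by (rule injI) (auto simp: scale_def split: prod.splits)

lemma dvd_mult_diff_mult:
  fixes a b c d :: int
  assumes "m dvd a * (b - d)" "m dvd (a - c) * d"
  shows "m dvd a * b - c * d"
proof -
  have "a * b - c * d = a * (b - d) + (a - c) * d" by (simp add: algebra_simps)
  then show ?thesis using assms by simp
qed

text \<open>If h has exact level t < s, so has e - h. In each product one factor contributes r - t -
  1 and the difference of the others r + t + 1 factors p, together 2 r, which is at least r + s +
  1.\<close>

lemma good_mult:
  assumes p: "prime p" and P: "good p P" and Q: "good p Q"
  shows "good p (P * Q)"
  unfolding good_def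
proof (intro allI impI)
  fix r n s :: nat and e :: expo
  assume s: "s < r" and e: "expo_dvd (int p ^ s) e"
  define N M where "N = p ^ r * n" and "M = p ^ (r - 1) * n"
  define F F' G G' where "F = cf (P ^ N)" and "F' = cf (P ^ M)" and "G = cf (Q ^ N)" and "G' = cf (Q ^ M)"
  have p0: "int p \<noteq> 0" using p by auto
  have inj: "inj (scale (int p))" using inj_scale p0 by blast
  \<comment> \<open>\<open>T\<close> contains every h such that p h occurs in the larger power, so
    the part of \<open>S\<close> outside the scaled \<open>T\<close> has only exponents not
    divisible by p.\<close>
  define T where "T = laurent_supp (P ^ M) \<union> scale (int p) -` laurent_supp (P ^ N)"
  define S where "S = scale (int p) ` T \<union> laurent_supp (P ^ N)"
  have finT: "finite T" unfolding T_def by (intro finite_UnI finite_vimageI inj) auto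
  then have finS: "finite S" unfolding S_def by auto
  have ST: "\<not> expo_dvd (int p) h" if "h \<in> S - scale (int p) ` T" for h
    using that unfolding S_def T_def by (auto simp: expo_dvd_iff_scale)
  have eqN: "cf ((P * Q) ^ N) (scale (int p) e) = (\<Sum>h\<in>S. F h * G (scale (int p) e - h))"
    unfolding power_mult_distrib F_def G_def
    by (rule lookup_mult_sum[OF finS]) (auto simp: S_def)
  have eqM: "cf ((P * Q) ^ M) e = (\<Sum>h\<in>T. F' h * G' (e - h))"
    unfolding power_mult_distrib F'_def G'_def
    by (rule lookup_mult_sum[OF finT]) (auto simp: T_def)
  have prN: "p ^ r dvd N" and prM: "p ^ (r - 1) dvd M" by (simp_all add: N_def M_def)
  \<comment> \<open>If p does not divide h, it does not divide p e - h either, so both coefficients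
    have all r factors p.\<close>
  have d1: "int p ^ (r + s + 1) dvd F h * G (scale (int p) e - h)" if h: "\<not> expo_dvd (int p) h" for h
  proof -
    have "\<not> expo_dvd (int p) (scale (int p) e - h)"
      using h expo_dvd_diff_iff expo_dvd_scale_self by blast
    then have "int p ^ r dvd F h" "int p ^ r dvd G (scale (int p) e - h)"
      unfolding F_def G_def using h power_coeff_dvd[OF p prN, of 0] by auto
    then have "int p ^ (r + r) dvd F h * G (scale (int p) e - h)"
      unfolding power_add by (rule mult_dvd_mono)
    moreover have "r + s + 1 \<le> r + r" using s by simp
    ultimately show ?thesis by (meson dvd_trans le_imp_power_dvd)
  qed
  have d2: "int p ^ (r + s + 1) dvd F (scale (int p) h) * G (scale (int p) (e - h)) - F' h * G' (e - h)" for h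
  proof (cases "expo_dvd (int p ^ s) h")
    case True
    then have "int p ^ (r + s + 1) dvd F (scale (int p) h) - F' h"
      using P s unfolding good_def F_def F'_def N_def M_def by blast
    moreover have "int p ^ (r + s + 1) dvd G (scale (int p) (e - h)) - G' (e - h)"
      using Q s True expo_dvd_diff[OF e True] unfolding good_def G_def G'_def N_def M_def by blast
    ultimately show ?thesis by (intro dvd_mult_diff_mult) auto
  next
    case False
    moreover have "expo_dvd (int p ^ 0) h" by (cases h) (simp add: expo_dvd_def)
    ultimately obtain t where ts: "t < s" and th: "expo_dvd (int p ^ t) h" and k: "\<not> expo_dvd (int p ^ Suc t) h"
      using ex_boundary[of "\<lambda>t. expo_dvd (int p ^ t) h" s] by blast
    have te: "expo_dvd (int p ^ t) e" "expo_dvd (int p ^ Suc t) e"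
      using ts by (simp_all only: expo_dvd_trans[OF le_imp_power_dvd e] less_imp_le Suc_leI)
    have th': "expo_dvd (int p ^ t) (e - h)" using th te expo_dvd_diff by blast
    have nh': "\<not> expo_dvd (int p ^ Suc t) (e - h)" using k te expo_dvd_diff_iff by blast
    have tr: "t < r" using ts s by simp
    have a: "int p ^ (r + t + 1) dvd F (scale (int p) h) - F' h"
      using P tr th unfolding good_def F_def F'_def N_def M_def by blast
    have b: "int p ^ (r + t + 1) dvd G (scale (int p) (e - h)) - G' (e - h)"
      using Q tr th' unfolding good_def G_def G'_def N_def M_def by blast
    \<comment> \<open>The two bounds lose t + 1 for different reasons: p h has level t + 1, whereas
      e - h has level t but M has one factor p less than N.\<close>
    have "\<not> expo_dvd (int p ^ Suc (Suc t)) (scale (int p) h)"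
      using k expo_dvd_scale[OF p0, of "int p ^ Suc t" h] by simp
    then have c: "int p ^ (r - Suc t) dvd F (scale (int p) h)"
      unfolding F_def by (rule power_coeff_dvd[OF p prN])
    have d: "int p ^ (r - 1 - t) dvd G' (e - h)"
      unfolding G'_def by (rule power_coeff_dvd[OF p prM nh'])
    have "int p ^ ((r - Suc t) + (r + t + 1)) dvd F (scale (int p) h) * (G (scale (int p) (e - h)) - G' (e - h))"
      unfolding power_add[of _ "r - Suc t"] by (rule mult_dvd_mono[OF c b])
    moreover have "int p ^ ((r + t + 1) + (r - 1 - t)) dvd (F (scale (int p) h) - F' h) * G' (e - h)"
      unfolding power_add[of _ "r + t + 1"] by (rule mult_dvd_mono[OF a d])
    moreover have "r + s + 1 \<le> (r - Suc t) + (r + t + 1)" "r + s + 1 \<le> (r + t + 1) + (r - 1 - t)"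
      using s tr by simp_all
    ultimately show ?thesis
      by (intro dvd_mult_diff_mult) (meson dvd_trans le_imp_power_dvd)+
  qed
  show "int p ^ (r + s + 1) dvd cf ((P * Q) ^ (p ^ r * n)) (scale (int p) e) - cf ((P * Q) ^ (p ^ (r - 1) * n)) e"
    unfolding N_def[symmetric] M_def[symmetric] eqN eqM
    by (rule sum_diff_dvd[OF finS inj_on_subset[OF inj subset_UNIV]]) (use ST d1 d2 in \<open>auto simp: S_def scale_diff\<close>)
qed

lemma good_supercongruence:
  assumes "good p P" "r \<ge> 1"
  shows "[cf (P ^ (p ^ r * n)) (scale (int (p ^ r * n)) e) =
      cf (P ^ (p ^ (r - 1) * n)) (scale (int (p ^ (r - 1) * n)) e)] (mod int p ^ (2 * r))"
proof -
  have "expo_dvd (int p ^ (r - 1)) (scale (int (p ^ (r - 1) * n)) e)"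
    by (cases e) (simp add: expo_dvd_def scale_def)
  moreover have "scale (int p) (scale (int (p ^ (r - 1) * n)) e) = scale (int (p ^ r * n)) e"
    using assms(2) by (cases e; cases r) (simp_all add: scale_def ac_simps)
  moreover have "r + (r - 1) + 1 = 2 * r" using assms(2) by simp
  ultimately show ?thesis
    using assms unfolding good_def cong_iff_dvd_diff
    by (metis (no_types, lifting) Suc_pred diff_less less_le_trans zero_less_one)
qed

section \<open>Powers of sums of monomials\<close>

fun mnom :: "nat list \<Rightarrow> nat" where
  "mnom [] = 1"
| "mnom (i # is) = (i + sum_list is choose i) * mnom is"

definition mindex :: "nat \<Rightarrow> nat \<Rightarrow> nat list set" where
  "mindex m N = {is. length is = m \<and> sum_list is = N}"

fun wt :: "expo list \<Rightarrow> nat list \<Rightarrow> expo" where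
  "wt (e # es) (i # is) = scale (int i) e + wt es is"
| "wt _ _ = 0"

fun pows :: "'a::comm_semiring_1 list \<Rightarrow> nat list \<Rightarrow> 'a" where
  "pows (c # cs) (i # is) = c ^ i * pows cs is"
| "pows _ _ = 1"

definition terms :: "(expo \<times> 'a) list \<Rightarrow> 'a::comm_ring_1 laurent" where
  "terms L = (\<Sum>(e, c)\<leftarrow>L. Poly_Mapping.single e c)"

lemma mindex_0: "mindex 0 N = (if N = 0 then {[]} else {})"
  by (auto simp: mindex_def)

lemma mindex_Suc: "mindex (Suc m) N = (\<Union>i\<in>{..N}. (#) i ` mindex m (N - i))"
proof (intro equalityI subsetI)
  fix xs assume "xs \<in> mindex (Suc m) N"
  then obtain i "is" where "xs = i # is" "length is = m" "i + sum_list is = N"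
    by (auto simp: mindex_def length_Suc_conv)
  then show "xs \<in> (\<Union>i\<in>{..N}. (#) i ` mindex m (N - i))"
    by (intro UN_I[of i]) (auto simp: mindex_def)
qed (auto simp: mindex_def)

lemma finite_mindex [simp]: "finite (mindex m N)"
  by (induction m arbitrary: N) (auto simp: mindex_0 mindex_Suc)

lemma sum_mindex_Suc: "sum f (mindex (Suc m) N) = (\<Sum>i\<le>N. \<Sum>is\<in>mindex m (N - i). f (i # is))"
  unfolding mindex_Suc
  by (subst sum.UNION_disjoint) (auto simp: sum.reindex)

lemma scale_of_nat_Suc: "scale (int (Suc i)) e = e + scale (int i) e"
  by (cases e) (simp add: scale_def algebra_simps)

lemma scale_0 [simp]: "scale 0 e = 0"
  by (cases e) (simp add: scale_def zero_prod_def)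

lemma single_power: "Poly_Mapping.single e c ^ i = Poly_Mapping.single (scale (int i) e) (c ^ i)"
proof (induction i)
  case (Suc i)
  then show ?case unfolding scale_of_nat_Suc by (simp add: mult_single)
qed (simp add: zero_prod_def[symmetric])

lemma terms_power:
  "terms L ^ N = (\<Sum>is\<in>mindex (length L) N.
     Poly_Mapping.single (wt (map fst L) is) (of_nat (mnom is) * pows (map snd L) is))"
proof (induction L arbitrary: N)
  case Nil
  then show ?case by (simp add: terms_def mindex_0 power_0_left)
next
  case (Cons x L)
  obtain e c where x: "x = (e, c)" by (cases x)
  have "terms (x # L) ^ N = (Poly_Mapping.single e c + terms L) ^ N"
    by (simp add: terms_def x)
  also have "\<dots> = (\<Sum>i\<le>N. of_nat (N choose i) * Poly_Mapping.single e c ^ i * terms L ^ (N - i))"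
    by (rule binomial_ring)
  also have "\<dots> = (\<Sum>i\<le>N. \<Sum>is\<in>mindex (length L) (N - i).
      Poly_Mapping.single (wt (map fst (x # L)) (i # is))
        (of_nat (mnom (i # is)) * pows (map snd (x # L)) (i # is)))"
  proof (rule sum.cong[OF refl])
    fix i assume i: "i \<in> {..N}"
    have "Poly_Mapping.single (scale (int i) e) (of_nat (N choose i) * c ^ i) *
        Poly_Mapping.single (wt (map fst L) is) (of_nat (mnom is) * pows (map snd L) is) =
        Poly_Mapping.single (wt (map fst (x # L)) (i # is))
        (of_nat (mnom (i # is)) * pows (map snd (x # L)) (i # is))"
      if "is \<in> mindex (length L) (N - i)" for "is"
      using that i by (simp add: mult_single x mindex_def algebra_simps)
    moreover have "of_nat (N choose i) * Poly_Mapping.single e c ^ i =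
        Poly_Mapping.single (scale (int i) e) (of_nat (N choose i) * c ^ i)"
      by (simp add: single_power mult_single flip: single_of_nat)
    ultimately show "of_nat (N choose i) * Poly_Mapping.single e c ^ i * terms L ^ (N - i) =
      (\<Sum>is\<in>mindex (length L) (N - i).
      Poly_Mapping.single (wt (map fst (x # L)) (i # is))
        (of_nat (mnom (i # is)) * pows (map snd (x # L)) (i # is)))"
      unfolding Cons.IH by (simp add: sum_distrib_left cong: sum.cong_simp)
  qed
  also have "\<dots> = (\<Sum>is\<in>mindex (length (x # L)) N.
     Poly_Mapping.single (wt (map fst (x # L)) is) (of_nat (mnom is) * pows (map snd (x # L)) is))"
    by (simp only: sum_mindex_Suc list.size add_0_right add_Suc_right)
  finally show ?case .
qed

lemma cf_terms_power:
  "cf (terms L ^ N) e = (\<Sum>is\<in>{is\<in>mindex (length L) N. wt (map fst L) is = e}.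
     of_nat (mnom is) * pows (map snd L) is)"
proof -
  have "cf (terms L ^ N) e = (\<Sum>is\<in>mindex (length L) N.
      if wt (map fst L) is = e then of_nat (mnom is) * pows (map snd L) is else 0)"
    unfolding terms_power by (simp add: lookup_sum lookup_single when_def)
  also have "\<dots> = (\<Sum>is\<in>{is\<in>mindex (length L) N. wt (map fst L) is = e}.
     of_nat (mnom is) * pows (map snd L) is)"
    by (rule sum.inter_filter[symmetric]) simp
  finally show ?thesis .
qed

text \<open>The multinomial form of k (N choose k) = N (N - 1 choose k - 1): a part with few factors
  p forces many into the coefficient.\<close>

lemma sum_list_dvd_mnom: "i \<in> set is \<Longrightarrow> sum_list is dvd i * mnom is"
proof (induction "is")
  case (Cons a "is")
  let ?b = "a + sum_list is choose a"
  have 1: "a + sum_list is dvd a * ?b"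
  proof (cases a)
    case (Suc k)
    have "a * ?b = (a + sum_list is) * ((a + sum_list is - 1) choose (a - 1))"
      using times_binomial_minus1_eq[of a "a + sum_list is"] Suc by simp
    then show ?thesis by simp
  qed simp
  have "(a + sum_list is) * ?b = a * ?b + sum_list is * ?b" by (simp add: algebra_simps)
  then have 2: "a + sum_list is dvd sum_list is * ?b"
    using 1 by (metis dvd_add_right_iff dvd_triv_left)
  show ?case
  proof (cases "i = a")
    case False
    then obtain k where "i * mnom is = sum_list is * k"
      using Cons by (auto elim: dvdE)
    then have "i * mnom (a # is) = sum_list is * ?b * k"
      by (metis mnom.simps(2) mult.assoc mult.commute)
    then show ?thesis using 2 by (metis dvd_mult2 sum_list.Cons)
  qed (use 1 in \<open>auto simp flip: mult.assoc\<close>)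
qed simp

lemma mnom_dvd:
  assumes "prime p" "p ^ r dvd sum_list is" "i \<in> set is" "\<not> p ^ Suc t dvd i"
  shows "int p ^ (r - t) dvd int (mnom is)"
proof (rule prime_power_dvd_cofactor[OF assms(1), of r "int i"])
  have "p ^ r dvd i * mnom is"
    using sum_list_dvd_mnom[OF assms(3)] assms(2) by (rule dvd_trans[rotated])
  then show "int p ^ r dvd int i * int (mnom is)"
    by (metis of_nat_dvd_iff of_nat_mult of_nat_power)
  show "\<not> int p ^ Suc t dvd int i"
    using assms(4) by (metis of_nat_dvd_iff of_nat_power)
qed

lemma sum_list_mult: "sum_list (map ((*) (p::nat)) is) = p * sum_list is"
  by (induction "is") (auto simp: algebra_simps)

lemma dvd_sum_list: "(\<And>i. i \<in> set is \<Longrightarrow> (d::nat) dvd i) \<Longrightarrow> d dvd sum_list is"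
  by (induction "is") auto

text \<open>Because \<open>mnom\<close> is an iterated product of binomials, the congruence passes
  from \<open>ucong_binomial\<close> by induction on the list.\<close>

lemma ucong_mnom:
  assumes p: "prime p" "odd p" and "\<And>i. i \<in> set is \<Longrightarrow> p ^ t dvd p * i"
  shows "ucong p (2 * t) (int (mnom (map ((*) p) is))) (int (mnom is))"
  using assms(3)
proof (induction "is")
  case (Cons a "is")
  have "p ^ t dvd p * sum_list is"
    using Cons.prems dvd_sum_list[of "map ((*) p) is" "p ^ t"] by (auto simp: sum_list_mult)
  then have "ucong p (2 * t) (int (p * (a + sum_list is) choose (p * a))) (int ((a + sum_list is) choose a))"
    using Cons.prems by (intro ucong_binomial p) auto
  moreover have "ucong p (2 * t) (int (mnom (map ((*) p) is))) (int (mnom is))"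
    using Cons by auto
  ultimately have "ucong p (2 * t) (int (p * (a + sum_list is) choose (p * a)) * int (mnom (map ((*) p) is)))
      (int ((a + sum_list is) choose a) * int (mnom is))"
    by (rule ucong_mult[OF p(1)])
  then show ?case
    by (simp add: sum_list_mult distrib_left)
qed (simp add: ucong_refl p)

lemma wt_map_mult: "wt es (map ((*) p) is) = scale (int p) (wt es is)"
proof (induction es "is" rule: wt.induct)
  case (1 e es i "is")
  then show ?case
    by (cases e; cases "wt es is") (simp add: scale_def algebra_simps)
qed (auto simp: scale_def zero_prod_def)

lemma pows_map_mult:
  assumes "odd p" "set cs \<subseteq> {1, -1 :: int}"
  shows "pows cs (map ((*) p) is) = pows cs is"
  using assms(2)
proof (induction cs "is" rule: pows.induct)
  case (1 c cs i "is")
  then have "c ^ (p * i) = c ^ i" using assms(1) by (auto simp: power_mult)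
  then show ?case using 1 by simp
qed auto

text \<open>
  Kummer-type condition on the exponents: a multi-index that is not divisible by \<open>p\<^bsup>s\<^esup>\<close> although its
  degree and its weight are has enough carries. It holds vacuously for affinely independent exponents.
\<close>
definition carry :: "nat \<Rightarrow> expo list \<Rightarrow> bool" where
  "carry p es \<longleftrightarrow> (\<forall>r s t is. t < s \<longrightarrow> s \<le> r \<longrightarrow> length is = length es \<longrightarrow> p ^ r dvd sum_list is \<longrightarrow>
     expo_dvd (int p ^ s) (wt es is) \<longrightarrow> (\<forall>i\<in>set is. p ^ t dvd i) \<longrightarrow> (\<exists>i\<in>set is. \<not> p ^ Suc t dvd i) \<longrightarrow>
     int p ^ (r + s - 2 * t) dvd int (mnom is))"

text \<open>Multi-indices with all parts divisible by p correspond to those of the smaller power;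
  the others are handled by \<open>carry\<close> at t = 0. For a corresponding pair the quotient of
  the multinomials is known modulo p^(2 t), where p^t divides the scaled parts.\<close>

lemma good_terms:
  assumes p: "prime p" "odd p" and carry: "carry p (map fst L)" and c: "set (map snd L) \<subseteq> {1, -1}"
  shows "good p (terms L)"
  unfolding good_def
proof (intro allI impI)
  fix r n s :: nat and e :: expo
  assume s: "s < r" and e: "expo_dvd (int p ^ s) e"
  define N M where "N = p ^ r * n" and "M = p ^ (r - 1) * n"
  have NM: "N = p * M" using s by (cases r) (auto simp: N_def M_def)
  have p0: "p > 0" using p prime_gt_0_nat by blast
  define \<phi> where "\<phi> = map ((*) p)"
  define es cs where "es = map fst L" and "cs = map snd L"
  define I J where "I = {is\<in>mindex (length L) N. wt es is = scale (int p) e}"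
    and "J = {is\<in>mindex (length L) M. wt es is = e}"
  have fin: "finite I" unfolding I_def by simp
  have inj: "inj \<phi>" unfolding \<phi>_def using p0 by (intro inj_mapI) (auto simp: inj_on_def)
  have wt_e: "expo_dvd (int p ^ Suc s) (wt es is)" if "is \<in> I" for "is"
    using that e expo_dvd_scale[of "int p" "int p ^ s" e] p0 by (simp add: I_def)
  have sub: "\<phi> ` J \<subseteq> I"
    by (auto simp: I_def J_def \<phi>_def wt_map_mult mindex_def sum_list_mult NM)
  have nd: "\<exists>i\<in>set is. \<not> p dvd i" if "is \<in> I - \<phi> ` J" for "is"
  proof (rule ccontr)
    assume "\<not> ?thesis"
    then have "is = \<phi> (map (\<lambda>i. i div p) is)"
      unfolding \<phi>_def by (simp add: map_idI)
    then obtain js where js: "is = \<phi> js" by blast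
    have "js \<in> J"
      using that inj_scale[of "int p"] p0 unfolding js
      by (auto simp: I_def J_def \<phi>_def wt_map_mult mindex_def sum_list_mult NM dest: injD)
    then show False using that js by blast
  qed
  have eqN: "cf (terms L ^ N) (scale (int p) e) = (\<Sum>is\<in>I. int (mnom is) * pows cs is)"
    unfolding cf_terms_power I_def es_def cs_def by simp
  have eqM: "cf (terms L ^ M) e = (\<Sum>is\<in>J. int (mnom is) * pows cs is)"
    unfolding cf_terms_power J_def es_def cs_def by simp
  \<comment> \<open>\<open>carry\<close> is applied at s + 1, as the weight p e has one factor p
    more than e.\<close>
  have key: "int p ^ (r + Suc s - 2 * t) dvd int (mnom is)"
    if "is \<in> I" "t < Suc s" "\<forall>i\<in>set is. p ^ t dvd i" "\<exists>i\<in>set is. \<not> p ^ Suc t dvd i" for "is" t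
  proof -
    have "length is = length (map fst L)" "p ^ r dvd sum_list is"
      using that(1) by (auto simp: I_def mindex_def N_def)
    then show ?thesis
      using carry that wt_e[OF that(1)] s unfolding carry_def es_def by (metis Suc_leI)
  qed
  have d1: "int p ^ (r + s + 1) dvd int (mnom is) * pows cs is" if "is \<in> I - \<phi> ` J" for "is"
    using key[of "is" 0] nd[OF that] that by (intro dvd_mult2) auto
  have d2: "int p ^ (r + s + 1) dvd int (mnom (\<phi> is)) * pows cs (\<phi> is) - int (mnom is) * pows cs is" if J: "is \<in> J" for "is"
  proof -
    have pows: "pows cs (\<phi> is) = pows cs is"
      using pows_map_mult[OF p(2), of cs] c by (simp add: \<phi>_def cs_def)
    have u: "ucong p (2 * t) (int (mnom (\<phi> is))) (int (mnom is))" if "\<forall>i\<in>set is. p ^ t dvd p * i" for t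
      unfolding \<phi>_def using that by (intro ucong_mnom p) auto
    have "int p ^ (r + s + 1) dvd int (mnom (\<phi> is)) - int (mnom is)"
    proof (cases "\<forall>i\<in>set is. p ^ r dvd p * i")
      case True
      have "int p ^ (2 * r + 0) dvd int (mnom (\<phi> is)) - int (mnom is)"
        by (rule ucong_diff_dvd[OF p(1) u[OF True]]) simp
      moreover have "r + s + 1 \<le> 2 * r + 0" using s by simp
      ultimately show ?thesis by (meson dvd_trans le_imp_power_dvd)
    next
      case False
      moreover have "\<forall>i\<in>set is. p ^ 0 dvd p * i" by simp
      ultimately obtain t where kr: "t < r" and th: "\<forall>i\<in>set is. p ^ t dvd p * i"
        and k: "\<not> (\<forall>i\<in>set is. p ^ Suc t dvd p * i)"
        using ex_boundary[of "\<lambda>t. \<forall>i\<in>set is. p ^ t dvd p * i" r] by blast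
      have I: "\<phi> is \<in> I" using sub J by blast
      have set\<phi>: "set (\<phi> is) = (*) p ` set is" by (simp add: \<phi>_def)
      \<comment> \<open>For t <= s the carries make up what the quotient lacks. Beyond s the r - t
        factors of any such multinomial suffice, since 2 t + (r - t) = r + t.\<close>
      have "\<exists>m. int p ^ m dvd int (mnom (\<phi> is)) \<and> r + s + 1 \<le> 2 * t + m"
      proof (cases "t < Suc s")
        case True
        have "int p ^ (r + Suc s - 2 * t) dvd int (mnom (\<phi> is))"
          using key[OF I True] th k by (auto simp: set\<phi>)
        then show ?thesis by (intro exI[of _ "r + Suc s - 2 * t"]) auto
      next
        case False
        from k obtain i where "i \<in> set (\<phi> is)" "\<not> p ^ Suc t dvd i" unfolding set\<phi> by blast
        moreover have "p ^ r dvd sum_list (\<phi> is)" using I by (auto simp: I_def mindex_def N_def)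
        ultimately have "int p ^ (r - t) dvd int (mnom (\<phi> is))"
          using mnom_dvd[OF p(1)] by blast
        then show ?thesis using False kr by (intro exI[of _ "r - t"]) auto
      qed
      then obtain m where m: "int p ^ m dvd int (mnom (\<phi> is))" "r + s + 1 \<le> 2 * t + m" by blast
      have "int p ^ (2 * t + m) dvd int (mnom is) - int (mnom (\<phi> is))"
        by (rule ucong_diff_dvd[OF p(1) ucong_sym[OF u[OF th]] m(1)])
      then show ?thesis
        using m(2) by (metis dvd_diff_commute dvd_trans le_imp_power_dvd)
    qed
    then show ?thesis unfolding pows by (simp flip: left_diff_distrib)
  qed
  show "int p ^ (r + s + 1) dvd cf (terms L ^ (p ^ r * n)) (scale (int p) e) - cf (terms L ^ (p ^ (r - 1) * n)) e"
    unfolding N_def[symmetric] M_def[symmetric] eqN eqM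
    by (rule sum_diff_dvd[OF fin inj_on_subset[OF inj subset_UNIV] sub]) (erule d1, erule d2)
qed

section \<open>Recurrences for constant terms\<close>

lemma carryI:
  assumes "\<And>s is. length is = length es \<Longrightarrow> int p ^ s dvd int (sum_list is) \<Longrightarrow>
    expo_dvd (int p ^ s) (wt es is) \<Longrightarrow> \<forall>i\<in>set is. int p ^ s dvd int i"
  shows "carry p es"
  unfolding carry_def
proof (intro allI impI)
  fix r s t :: nat and "is" :: "nat list"
  assume *: "t < s" "s \<le> r" "length is = length es" "p ^ r dvd sum_list is"
    "expo_dvd (int p ^ s) (wt es is)" "\<exists>i\<in>set is. \<not> p ^ Suc t dvd i"
  have "p ^ s dvd sum_list is" using *(2,4) by (meson dvd_trans le_imp_power_dvd)
  then have "int p ^ s dvd int (sum_list is)" by (metis of_nat_dvd_iff of_nat_power)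
  from assms[OF *(3) this *(5)] have "\<forall>i\<in>set is. p ^ s dvd i"
    by (metis of_nat_dvd_iff of_nat_power)
  moreover have "p ^ Suc t dvd p ^ s" using *(1) by (intro le_imp_power_dvd) simp
  ultimately have False using *(6) dvd_trans by blast
  then show "int p ^ (r + s - 2 * t) dvd int (mnom is)" ..
qed

text \<open>The signed normalized volume (six times the volume) of the simplex; if p does not divide
  it, the points are affinely independent modulo p.\<close>

definition det4 :: "expo \<Rightarrow> expo \<Rightarrow> expo \<Rightarrow> expo \<Rightarrow> int" where
  "det4 e0 e1 e2 e3 = (case (e1 - e0, e2 - e0, e3 - e0) of ((a, b, c), (d, e, f), (g, h, i)) \<Rightarrow>
     a * (e * i - f * h) - b * (d * i - f * g) + c * (d * h - e * g))"

text \<open>Cramer's rule: D times the multiplicity of a vertex is the determinant whose row for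
  that vertex is replaced by the weight minus the degree times \<open>e0\<close>, a row divisible by
  q. The multiplicity of \<open>e0\<close> follows from the degree.\<close>

lemma simplex_dvd:
  fixes q :: int
  assumes q: "coprime q (det4 e0 e1 e2 e3)" and s: "q dvd i + j + k + l"
    and w: "expo_dvd q (scale i e0 + scale j e1 + scale k e2 + scale l e3)"
  shows "q dvd i \<and> q dvd j \<and> q dvd k \<and> q dvd l"
proof -
  obtain a0 b0 c0 a1 b1 c1 a2 b2 c2 a3 b3 c3 where
    e: "e0 = (a0, b0, c0)" "e1 = (a1, b1, c1)" "e2 = (a2, b2, c2)" "e3 = (a3, b3, c3)"
    by (metis surj_pair)
  define S A B C where "S = i + j + k + l" and "A = i * a0 + j * a1 + k * a2 + l * a3"
    and "B = i * b0 + j * b1 + k * b2 + l * b3" and "C = i * c0 + j * c1 + k * c2 + l * c3"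
  have d: "q dvd A - a0 * S" "q dvd B - b0 * S" "q dvd C - c0 * S" "q dvd S"
    using s w by (auto simp: e expo_dvd_def scale_def S_def A_def B_def C_def)
  define D where "D = det4 e0 e1 e2 e3"
  have D: "D = (a1 - a0) * ((b2 - b0) * (c3 - c0) - (c2 - c0) * (b3 - b0)) -
      (b1 - b0) * ((a2 - a0) * (c3 - c0) - (c2 - c0) * (a3 - a0)) +
      (c1 - c0) * ((a2 - a0) * (b3 - b0) - (b2 - b0) * (a3 - a0))"
    by (simp add: D_def det4_def e)
  have "D * j = (A - a0 * S) * ((b2 - b0) * (c3 - c0) - (c2 - c0) * (b3 - b0)) -
      (B - b0 * S) * ((a2 - a0) * (c3 - c0) - (c2 - c0) * (a3 - a0)) +
      (C - c0 * S) * ((a2 - a0) * (b3 - b0) - (b2 - b0) * (a3 - a0))"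
    unfolding D S_def A_def B_def C_def by Groebner_Basis.algebra
  then have "q dvd D * j" using d by (simp add: dvd_add dvd_diff)
  moreover have "D * k = (a1 - a0) * ((B - b0 * S) * (c3 - c0) - (C - c0 * S) * (b3 - b0)) -
      (b1 - b0) * ((A - a0 * S) * (c3 - c0) - (C - c0 * S) * (a3 - a0)) +
      (c1 - c0) * ((A - a0 * S) * (b3 - b0) - (B - b0 * S) * (a3 - a0))"
    unfolding D S_def A_def B_def C_def by Groebner_Basis.algebra
  then have "q dvd D * k" using d by (simp add: dvd_add dvd_diff)
  moreover have "D * l = (a1 - a0) * ((b2 - b0) * (C - c0 * S) - (c2 - c0) * (B - b0 * S)) -
      (b1 - b0) * ((a2 - a0) * (C - c0 * S) - (c2 - c0) * (A - a0 * S)) +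
      (c1 - c0) * ((a2 - a0) * (B - b0 * S) - (b2 - b0) * (A - a0 * S))"
    unfolding D S_def A_def B_def C_def by Groebner_Basis.algebra
  then have "q dvd D * l" using d by (simp add: dvd_add dvd_diff)
  ultimately have jkl: "q dvd j" "q dvd k" "q dvd l"
    using q coprime_dvd_mult_right_iff unfolding D_def by blast+
  have "i = S - j - k - l" by (simp add: S_def)
  then show ?thesis using jkl d(4) by simp
qed

text \<open>Two or three vertices are handled as four, with multiplicity 0 at the missing
  ones.\<close>

lemma carry_simplex:
  assumes p: "prime p" and D: "\<not> int p dvd det4 e0 e1 e2 e3"
  shows "carry p [e0, e1, e2, e3]" and "carry p [e0, e1, e2]" and "carry p [e0, e1]"
proof -
  have q: "coprime (int p ^ s) (det4 e0 e1 e2 e3)" for s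
    using p D by (simp add: prime_imp_coprime)
  show "carry p [e0, e1, e2, e3]"
  proof (rule carryI)
    fix s "is" assume *: "length is = length [e0, e1, e2, e3]" "int p ^ s dvd int (sum_list is)"
      "expo_dvd (int p ^ s) (wt [e0, e1, e2, e3] is)"
    then obtain i j k l where "is = [i, j, k, l]" by (auto simp: length_Suc_conv)
    then show "\<forall>i\<in>set is. int p ^ s dvd int i"
      using simplex_dvd[OF q, of s "int i" "int j" "int k" "int l"] * by (simp add: add_ac)
  qed
  show "carry p [e0, e1, e2]"
  proof (rule carryI)
    fix s "is" assume *: "length is = length [e0, e1, e2]" "int p ^ s dvd int (sum_list is)"
      "expo_dvd (int p ^ s) (wt [e0, e1, e2] is)"
    then obtain i j k where "is = [i, j, k]" by (auto simp: length_Suc_conv)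
    then show "\<forall>i\<in>set is. int p ^ s dvd int i"
      using simplex_dvd[OF q, of s "int i" "int j" "int k" 0] * by (simp add: add_ac)
  qed
  show "carry p [e0, e1]"
  proof (rule carryI)
    fix s "is" assume *: "length is = length [e0, e1]" "int p ^ s dvd int (sum_list is)"
      "expo_dvd (int p ^ s) (wt [e0, e1] is)"
    then obtain i j where "is = [i, j]" by (auto simp: length_Suc_conv)
    then show "\<forall>i\<in>set is. int p ^ s dvd int i"
      using simplex_dvd[OF q, of s "int i" "int j" 0 0] * by (simp add: add_ac)
  qed
qed

section \<open>Divergences and recurrences\<close>

lemma cf_mult_single: "cf (f * Poly_Mapping.single m 1) (e + m) = cf (f::'a::comm_ring_1 laurent) e"
proof -
  have "cf (Poly_Mapping.single m 1 * f) (e + m) = (\<Sum>h\<in>{m}. cf (Poly_Mapping.single m 1) h * cf f (e + m - h))"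
    by (rule lookup_mult_sum) auto
  then show ?thesis by (simp add: mult.commute)
qed

lemma cf_of_int_mult: "cf (of_int k * f) e = of_int k * cf (f::'a::comm_ring_1 laurent) e"
proof -
  have "cf (Poly_Mapping.single 0 (of_int k) * f) e = (\<Sum>h\<in>{0}. cf (Poly_Mapping.single 0 (of_int k)) h * cf f (e - h))"
    by (rule lookup_mult_sum) (auto simp del: single_of_int)
  then show ?thesis by (simp add: lookup_of_int)
qed

text \<open>
  With \<open>\<Lambda> = N / x\<^bsup>\<mu>\<^esup>\<close>, the identity in the assumption says that \<open>\<Lambda>\<^bsup>n-1\<^esup>\<close> times the
  recurrence operator is the divergence of the field with components \<open>H\<^sub>i x\<^bsup>-2\<mu>\<^esup> \<Lambda>\<^bsup>n-1\<^esup>\<close>.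
\<close>
lemma constant_term_recurrence:
  fixes N H1 H2 H3 :: "'a::{idom, ring_char_0} laurent"
  defines "l1 \<equiv> (fst :: expo \<Rightarrow> int)" and "l2 \<equiv> (\<lambda>e :: expo. fst (snd e))" and "l3 \<equiv> (\<lambda>e :: expo. snd (snd e))"
  assumes N: "N \<noteq> 0" and n: "n \<ge> 1"
    and id: "N * (of_int c2 * N\<^sup>2 - of_int c1 * N * Poly_Mapping.single (m1, m2, m3) 1
        + of_int c0 * (Poly_Mapping.single (m1, m2, m3) 1)\<^sup>2) =
      (of_nat n - 1) * (H1 * (theta l1 N - of_int m1 * N) + H2 * (theta l2 N - of_int m2 * N)
        + H3 * (theta l3 N - of_int m3 * N)) +
      N * ((theta l1 H1 - 2 * of_int m1 * H1) + (theta l2 H2 - 2 * of_int m2 * H2)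
        + (theta l3 H3 - 2 * of_int m3 * H3))"
  shows "of_int c2 * cf (N ^ (n + 1)) (scale (int (n + 1)) (m1, m2, m3)) =
     of_int c1 * cf (N ^ n) (scale (int n) (m1, m2, m3)) -
     of_int c0 * cf (N ^ (n - 1)) (scale (int (n - 1)) (m1, m2, m3))"
proof -
  define M where "M = (Poly_Mapping.single (m1, m2, m3) 1 :: 'a laurent)"
  have l: "l1 (a + b) = l1 a + l1 b" "l2 (a + b) = l2 a + l2 b" "l3 (a + b) = l3 a + l3 b" for a b
    by (simp_all add: l1_def l2_def l3_def)
  \<comment> \<open>With E = (n + 1) (m1, m2, m3) this is x^E theta (x^(-E) H N^(n - 1)), so its
    coefficient at E vanishes (\<open>W0\<close>).\<close>
  define W where "W = (\<lambda>l m H. theta l (H * N ^ (n - 1)) - of_nat (n + 1) * of_int m * (H * N ^ (n - 1)))"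
  have key: "of_int c2 * N ^ (n + 1) - of_int c1 * (N ^ n * M) + of_int c0 * (N ^ (n - 1) * M * M) =
      W l1 m1 H1 + W l2 m2 H2 + W l3 m3 H3"
  \<comment> \<open>The general case splits off N^(n - 2). For n = 1 the extra factor N of the
    identity is cancelled instead, which uses that N is not 0.\<close>
  proof (cases "n = 1")
    case True
    have "N * (of_int c2 * N\<^sup>2 - of_int c1 * N * M + of_int c0 * M\<^sup>2) =
      N * ((theta l1 H1 - 2 * of_int m1 * H1) + (theta l2 H2 - 2 * of_int m2 * H2)
        + (theta l3 H3 - 2 * of_int m3 * H3))"
      using id by (simp add: M_def True)
    then have "of_int c2 * N\<^sup>2 - of_int c1 * N * M + of_int c0 * M\<^sup>2 =
        (theta l1 H1 - 2 * of_int m1 * H1) + (theta l2 H2 - 2 * of_int m2 * H2)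
        + (theta l3 H3 - 2 * of_int m3 * H3)"
      using N by (subst (asm) mult_cancel_left) simp
    then show ?thesis
      by (simp add: True W_def power2_eq_square mult.assoc)
  next
    case False
    then obtain k where k: "n = k + 2" using n False by (intro that[of "n - 2"]) auto
    have Wk: "W l m H = N ^ k * ((of_nat n - 1) * (H * (theta l N - of_int m * N)) +
        N * (theta l H - 2 * of_int m * H))" if "\<And>a b. l (a + b) = l a + l b" for l m H
    proof -
      have tp: "theta l (N ^ Suc k) = of_nat (Suc k) * N ^ k * theta l N"
        using theta_power[OF that, of N "Suc k"] by simp
      have n1: "n - 1 = Suc k" using k by simp
      show ?thesis
        unfolding W_def n1 theta_mult[OF that] tp unfolding k by (simp add: algebra_simps)
    qed
    have "of_int c2 * N ^ (n + 1) - of_int c1 * (N ^ n * M) + of_int c0 * (N ^ (n - 1) * M * M) =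
      N ^ k * (N * (of_int c2 * N\<^sup>2 - of_int c1 * N * M + of_int c0 * M\<^sup>2))"
      unfolding k by (simp add: power2_eq_square algebra_simps)
    also have "\<dots> = W l1 m1 H1 + W l2 m2 H2 + W l3 m3 H3"
      unfolding Wk[OF l(1)] Wk[OF l(2)] Wk[OF l(3)] M_def id by (simp add: algebra_simps)
    finally show ?thesis .
  qed
  define E where "E = scale (int (n + 1)) (m1, m2, m3)"
  have E1: "E = scale (int n) (m1, m2, m3) + (m1, m2, m3)"
    by (simp add: E_def scale_def algebra_simps)
  have E2: "E = scale (int (n - 1)) (m1, m2, m3) + (m1, m2, m3) + (m1, m2, m3)"
    using n by (cases n) (simp_all add: E_def scale_def algebra_simps)
  have W0: "cf (W l m H) E = 0" if "l E = int (n + 1) * m" for l m H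
  proof -
    have "W l m H = theta l (H * N ^ (n - 1)) - of_int (int (n + 1) * m) * (H * N ^ (n - 1))"
      by (simp add: W_def)
    then show ?thesis
      by (simp only: lookup_minus lookup_theta cf_of_int_mult that) simp
  qed
  have "cf (of_int c2 * N ^ (n + 1) - of_int c1 * (N ^ n * M) + of_int c0 * (N ^ (n - 1) * M * M)) E = 0"
  proof -
    have "l1 E = int (n + 1) * m1" "l2 E = int (n + 1) * m2" "l3 E = int (n + 1) * m3"
      by (simp_all add: l1_def l2_def l3_def E_def scale_def)
    then show ?thesis unfolding key lookup_add by (simp only: W0 add_0_right)
  qed
  moreover have "cf (N ^ n * M) E = cf (N ^ n) (scale (int n) (m1, m2, m3))"
    unfolding E1 M_def by (rule cf_mult_single)
  moreover have "cf (N ^ (n - 1) * M * M) E = cf (N ^ (n - 1)) (scale (int (n - 1)) (m1, m2, m3))"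
    unfolding E2 M_def by (simp only: cf_mult_single)
  ultimately show ?thesis
    by (simp only: lookup_add lookup_minus cf_of_int_mult E_def[symmetric]) (simp add: algebra_simps)
qed

lemma mnom_fact: "mnom is * (\<Prod>i\<leftarrow>is. fact i) = fact (sum_list is)"
proof (induction "is")
  case (Cons a "is")
  have "mnom (a # is) * (\<Prod>i\<leftarrow>a # is. fact i) =
      (a + sum_list is choose a) * fact a * (mnom is * (\<Prod>i\<leftarrow>is. fact i))"
    by (simp add: ac_simps)
  also have "\<dots> = fact (a + sum_list is)"
    unfolding Cons.IH using binomial_fact_lemma[of a "a + sum_list is"] by (simp add: ac_simps)
  finally show ?case by simp
qed simp

text \<open>The intended exponents satisfy - e1 - e2 + e3 + 2 e4 - e5 = 0, and modulo p^s the
  multi-index is i3 times (-1, -1, 1, 2, -1). The divisibility lost is regained by grouping the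
  parts as 1, 2, 4 and 3, 5: the part i1 yields r - t factors p, and the second group, of degree
  divisible by p^s, yields s - t more.\<close>

lemma carry_five:
  assumes p: "prime p"
    and e: "\<And>q i1 i2 i3 i4 i5. expo_dvd q (wt [e1, e2, e3, e4, e5] [i1, i2, i3, i4, i5]) \<Longrightarrow>
      q dvd int (i1 + i3) \<and> q dvd int (i2 + i3) \<and> q dvd int (i1 + i2 + i4)"
  shows "carry p [e1, e2, e3, e4, e5]"
  unfolding carry_def
proof (intro allI impI)
  fix r s t :: nat and "is" :: "nat list"
  assume *: "t < s" "s \<le> r" "length is = length [e1, e2, e3, e4, e5]" "p ^ r dvd sum_list is"
    "expo_dvd (int p ^ s) (wt [e1, e2, e3, e4, e5] is)" "\<exists>i\<in>set is. \<not> p ^ Suc t dvd i"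
  then obtain i1 i2 i3 i4 i5 where is5: "is = [i1, i2, i3, i4, i5]" by (auto simp: length_Suc_conv)
  have "int (p ^ s) dvd int (i1 + i3)" "int (p ^ s) dvd int (i2 + i3)" "int (p ^ s) dvd int (i1 + i2 + i4)"
    using e[of "int p ^ s" i1 i2 i3 i4 i5] *(5) unfolding is5 by simp_all
  then have d: "p ^ s dvd i1 + i3" "p ^ s dvd i2 + i3" "p ^ s dvd i1 + i2 + i4"
    by (simp_all only: of_nat_dvd_iff)
  have S: "p ^ r dvd (i1 + i2 + i4) + (i3 + i5)" using *(4) is5 by (simp add: ac_simps)
  have "p ^ s dvd (i1 + i2 + i4) + (i3 + i5)" using S *(2) by (meson dvd_trans le_imp_power_dvd)
  then have d5: "p ^ s dvd i3 + i5" using d(3) dvd_add_right_iff by blast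
  define q where "q = p ^ Suc t"
  have qs: "q dvd p ^ s" unfolding q_def using *(1) by (intro le_imp_power_dvd) simp
  have dq: "q dvd i1 + i3" "q dvd i2 + i3" "q dvd i1 + i2 + i4" "q dvd i3 + i5"
    using d d5 qs dvd_trans by blast+
  \<comment> \<open>Modulo p^s all parts are multiples of i3, so q cannot divide i3.\<close>
  have n3: "\<not> q dvd i3"
  proof
    assume "q dvd i3"
    then have "q dvd i1" "q dvd i2" "q dvd i5"
      using dq dvd_add_left_iff dvd_add_right_iff by blast+
    moreover from this have "q dvd i4" using dq(3) dvd_add_right_iff dvd_add by blast
    ultimately show False using *(6) \<open>q dvd i3\<close> unfolding is5 q_def by auto
  qed
  then have n1: "\<not> q dvd i1" using dq(1) dvd_add_right_iff by blast
  \<comment> \<open>The multinomial regrouped: \<open>B\<close> distributes the degree between the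
    two groups, \<open>m\<close> and \<open>mnom [i3, i5]\<close> act inside them.\<close>
  define B where "B = (i1 + i2 + i4) + (i3 + i5) choose (i1 + i2 + i4)"
  define m where "m = mnom [i1, i2, i4]"
  have "mnom is * (fact i1 * fact i2 * fact i3 * fact i4 * fact i5) =
      (B * m * mnom [i3, i5]) * (fact i1 * fact i2 * fact i3 * fact i4 * fact i5)"
    (is "_ * ?F = _")
  proof -
    have "mnom is * ?F = fact ((i1 + i2 + i4) + (i3 + i5))"
      using mnom_fact[of "is"] unfolding is5 by (simp add: ac_simps)
    also have "\<dots> = B * fact (i1 + i2 + i4) * fact (i3 + i5)"
      unfolding B_def using binomial_fact_lemma[of "i1 + i2 + i4" "(i1 + i2 + i4) + (i3 + i5)"]
      by (simp add: ac_simps)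
    also have "fact (i1 + i2 + i4) = m * (fact i1 * fact i2 * fact i4)"
      using mnom_fact[of "[i1, i2, i4]"] unfolding m_def by (simp add: ac_simps)
    also have "fact (i3 + i5) = mnom [i3, i5] * (fact i3 * fact i5)"
      using mnom_fact[of "[i3, i5]"] by (simp add: ac_simps)
    finally show ?thesis by (simp only: mult_ac)
  qed
  then have mn: "mnom is = B * m * mnom [i3, i5]" by (subst (asm) mult_cancel2) simp
  have "p ^ r dvd (i1 + i2 + i4) * B"
  proof -
    have "sum_list [i1 + i2 + i4, i3 + i5] dvd (i1 + i2 + i4) * mnom [i1 + i2 + i4, i3 + i5]"
      by (rule sum_list_dvd_mnom) simp
    then show ?thesis using S unfolding B_def by (simp add: dvd_trans)
  qed
  moreover have "i1 + i2 + i4 dvd i1 * m"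
    using sum_list_dvd_mnom[of i1 "[i1, i2, i4]"] unfolding m_def by (simp add: add.assoc)
  then obtain k where "i1 * m = (i1 + i2 + i4) * k" by (elim dvdE)
  ultimately have "p ^ r dvd i1 * m * B" by (metis dvd_mult2 mult.assoc mult.commute)
  then have "int (p ^ r) dvd int (i1 * (B * m))" by (simp only: of_nat_dvd_iff ac_simps)
  then have "int p ^ r dvd int i1 * int (B * m)" by simp
  moreover have "\<not> int p ^ Suc t dvd int i1"
    using n1 unfolding q_def by (metis of_nat_dvd_iff of_nat_power)
  ultimately have 1: "int p ^ (r - t) dvd int (B * m)"
    by (rule prime_power_dvd_cofactor[OF p])
  have 2: "int p ^ (s - t) dvd int (mnom [i3, i5])"
    by (rule mnom_dvd[OF p, of s "[i3, i5]" i3 t]) (use d5 n3 in \<open>simp_all add: q_def\<close>)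
  have "int p ^ ((r - t) + (s - t)) dvd int (B * m) * int (mnom [i3, i5])"
    unfolding power_add by (rule mult_dvd_mono[OF 1 2])
  moreover have "r + s - 2 * t = (r - t) + (s - t)" using *(1,2) by simp
  ultimately show "int p ^ (r + s - 2 * t) dvd int (mnom is)" by (simp add: mn)
qed

text \<open>The lists are cyclic images of one another, each ordered so that the coordinates of the
  weight are i1 + i2 + i4, i2 + i3 and i1 + i3 in some rotation.\<close>

lemma carry_eta:
  assumes p: "prime p"
  shows "carry p [(1, 0, 1), (1, 1, 0), (0, 1, 1), (1, 0, 0), (0, 0, 0)]"
    "carry p [(1, 1, 0), (0, 1, 1), (1, 0, 1), (0, 1, 0), (0, 0, 0)]"
    "carry p [(0, 1, 1), (1, 0, 1), (1, 1, 0), (0, 0, 1), (0, 0, 0)]"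
  by (rule carry_five[OF p], auto simp: expo_dvd_def scale_def zero_prod_def add_ac)+

section \<open>Certificates as coefficient tables\<close>

text \<open>
  A polynomial is a list of terms \<open>c x\<^sup>a y\<^sup>b z\<^sup>d\<close>. The certificates also depend on the index
  \<open>w\<close> of the sequence: there \<open>(a, b, d, rows)\<close> stands for
  \<open>x\<^sup>a y\<^sup>b z\<^sup>d \<Sum>\<^sub>i z\<^sup>i \<Sum>\<^sub>j rows\<^sub>i\<^sub>j w\<^sup>j\<close>.
\<close>
type_synonym poly = "(int \<times> nat \<times> nat \<times> nat) list"
type_synonym wpoly = "(nat \<times> nat \<times> nat \<times> int list list) list"

definition peval :: "'a::comm_ring_1 \<Rightarrow> 'a \<Rightarrow> 'a \<Rightarrow> poly \<Rightarrow> 'a" where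
  "peval x y z P = (\<Sum>(c, a, b, d)\<leftarrow>P. of_int c * (x ^ a * y ^ b * z ^ d))"

fun horner_row :: "'a::comm_ring_1 \<Rightarrow> int list \<Rightarrow> 'a" where
  "horner_row w [] = 0"
| "horner_row w (c # cs) = of_int c + w * horner_row w cs"

fun horner_rows :: "'a::comm_ring_1 \<Rightarrow> 'a \<Rightarrow> int list list \<Rightarrow> 'a" where
  "horner_rows w z [] = 0"
| "horner_rows w z (cs # rows) = horner_row w cs + z * horner_rows w z rows"

definition weval :: "'a::comm_ring_1 \<Rightarrow> 'a \<Rightarrow> 'a \<Rightarrow> 'a \<Rightarrow> wpoly \<Rightarrow> 'a" where
  "weval w x y z H = (\<Sum>(a, b, d, rows)\<leftarrow>H. x ^ a * y ^ b * z ^ d * horner_rows w z rows)"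

text \<open>Row i carries z^i, so z d/dz multiplies successive rows by successive integers.\<close>

fun scale_rows :: "int \<Rightarrow> int list list \<Rightarrow> int list list" where
  "scale_rows k [] = []"
| "scale_rows k (cs # rows) = map ((*) k) cs # scale_rows (k + 1) rows"

text \<open>The operators \<open>x\<partial>\<^sub>x - m\<close>, \<open>y\<partial>\<^sub>y - m\<close> and \<open>z\<partial>\<^sub>z - m\<close>.\<close>
definition pshift1 :: "int \<Rightarrow> poly \<Rightarrow> poly" where
  "pshift1 m = map (\<lambda>(c, a, b, d). (c * (int a - m), a, b, d))"
definition pshift2 :: "int \<Rightarrow> poly \<Rightarrow> poly" where
  "pshift2 m = map (\<lambda>(c, a, b, d). (c * (int b - m), a, b, d))"
definition pshift3 :: "int \<Rightarrow> poly \<Rightarrow> poly" where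
  "pshift3 m = map (\<lambda>(c, a, b, d). (c * (int d - m), a, b, d))"
definition wshift1 :: "int \<Rightarrow> wpoly \<Rightarrow> wpoly" where
  "wshift1 m = map (\<lambda>(a, b, d, rows). (a, b, d, map (map ((*) (int a - m))) rows))"
definition wshift2 :: "int \<Rightarrow> wpoly \<Rightarrow> wpoly" where
  "wshift2 m = map (\<lambda>(a, b, d, rows). (a, b, d, map (map ((*) (int b - m))) rows))"
definition wshift3 :: "int \<Rightarrow> wpoly \<Rightarrow> wpoly" where
  "wshift3 m = map (\<lambda>(a, b, d, rows). (a, b, d, scale_rows (int d - m) rows))"

text \<open>The identity assumed in \<open>constant_term_recurrence\<close>, with a ring element
  \<open>w\<close> in place of n: one polynomial identity in four variables, checked by
  \<open>algebra\<close>, serves every n.\<close>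

definition ct_cert :: "'a::comm_ring_1 \<Rightarrow> 'a \<Rightarrow> 'a \<Rightarrow> 'a \<Rightarrow> 'a \<Rightarrow> 'a \<Rightarrow> 'a \<Rightarrow> nat \<times> nat \<times> nat \<Rightarrow>
    poly \<Rightarrow> wpoly \<Rightarrow> wpoly \<Rightarrow> wpoly \<Rightarrow> bool" where
  "ct_cert w x y z c2 c1 c0 \<mu> N H1 H2 H3 \<longleftrightarrow> (case \<mu> of (m1, m2, m3) \<Rightarrow>
     peval x y z N * (c2 * (peval x y z N)\<^sup>2 - c1 * peval x y z N * (x ^ m1 * y ^ m2 * z ^ m3)
       + c0 * (x ^ m1 * y ^ m2 * z ^ m3)\<^sup>2) =
     (w - 1) * (weval w x y z H1 * peval x y z (pshift1 (int m1) N)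
       + weval w x y z H2 * peval x y z (pshift2 (int m2) N)
       + weval w x y z H3 * peval x y z (pshift3 (int m3) N)) +
     peval x y z N * (weval w x y z (wshift1 (2 * int m1) H1) + weval w x y z (wshift2 (2 * int m2) H2)
       + weval w x y z (wshift3 (2 * int m3) H3)))"

text \<open>Multiplying the recurrence by \<open>k\<close> allows a vector field with integer
  coefficients.\<close>

definition zagier_cert :: "int \<Rightarrow> int \<Rightarrow> int \<Rightarrow> int \<Rightarrow> 'a::comm_ring_1 \<Rightarrow> 'a \<Rightarrow> 'a \<Rightarrow> 'a \<Rightarrow> nat \<times> nat \<times> nat \<Rightarrow>
    poly \<Rightarrow> wpoly \<Rightarrow> wpoly \<Rightarrow> wpoly \<Rightarrow> bool" where
  "zagier_cert k a b c w x y z = ct_cert w x y z (of_int k * (w + 1)\<^sup>2)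
     (of_int k * (of_int a * w\<^sup>2 + of_int a * w + of_int b)) (of_int k * (of_int c * w\<^sup>2))"

definition cooper_cert :: "int \<Rightarrow> int \<Rightarrow> int \<Rightarrow> int \<Rightarrow> int \<Rightarrow> 'a::comm_ring_1 \<Rightarrow> 'a \<Rightarrow> 'a \<Rightarrow> 'a \<Rightarrow> nat \<times> nat \<times> nat \<Rightarrow>
    poly \<Rightarrow> wpoly \<Rightarrow> wpoly \<Rightarrow> wpoly \<Rightarrow> bool" where
  "cooper_cert k a b c d w x y z = ct_cert w x y z (of_int k * (w + 1) ^ 3)
     (of_int k * ((2 * w + 1) * (of_int a * w\<^sup>2 + of_int a * w + of_int b)))
     (of_int k * (w * (of_int c * w\<^sup>2 + of_int d)))"

lemmas cert_unfold = zagier_cert_def cooper_cert_def ct_cert_def pshift1_def pshift2_def pshift3_def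
  wshift1_def wshift2_def wshift3_def peval_def weval_def list.map prod.case sum_list.Cons sum_list.Nil
  horner_row.simps horner_rows.simps scale_rows.simps

lemmas cert_eval = of_int_numeral of_int_neg_numeral of_int_0 of_int_1 of_int_minus of_int_mult of_int_diff
  of_int_add of_int_of_nat_eq of_nat_numeral of_nat_0 of_nat_1 power_0 power_one_right mult_1_left mult_1_right
  mult_zero_left mult_zero_right add_0_left add_0_right

abbreviation "LX \<equiv> Poly_Mapping.single (1, 0, 0) 1 :: 'a::comm_ring_1 laurent"
abbreviation "LY \<equiv> Poly_Mapping.single (0, 1, 0) 1 :: 'a::comm_ring_1 laurent"
abbreviation "LZ \<equiv> Poly_Mapping.single (0, 0, 1) 1 :: 'a::comm_ring_1 laurent"

abbreviation "lpoly \<equiv> peval LX LY LZ"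

lemma laurent_monomial:
  "LX ^ a * LY ^ b * LZ ^ d = Poly_Mapping.single (int a, int b, int d) (1 :: 'a::comm_ring_1)"
  by (simp add: single_power mult_single scale_def)

lemma of_int_mult_single:
  "of_int c * Poly_Mapping.single e k = Poly_Mapping.single (e :: expo) (of_int c * (k :: 'a::comm_ring_1))"
  by (simp add: mult_single flip: single_of_int)

lemma lpoly_Cons: "lpoly ((c, a, b, d) # P) =
    Poly_Mapping.single (int a, int b, int d) (of_int c :: 'a::comm_ring_1) + lpoly P"
  by (simp add: peval_def laurent_monomial of_int_mult_single)

lemma lpoly_Nil: "lpoly [] = (0 :: 'a::comm_ring_1 laurent)"
  by (simp add: peval_def)

lemma lpoly_eq_terms:
  "lpoly P = (terms (map (\<lambda>(c, a, b, d). ((int a, int b, int d), of_int c)) P) :: 'a::comm_ring_1 laurent)"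
  by (induction P) (auto simp: lpoly_Nil lpoly_Cons terms_def)

fun coeff_at :: "nat \<times> nat \<times> nat \<Rightarrow> poly \<Rightarrow> int" where
  "coeff_at \<mu> [] = 0"
| "coeff_at \<mu> ((c, e) # P) = (if e = \<mu> then c else 0) + coeff_at \<mu> P"

lemma cf_lpoly:
  "cf (lpoly P) (int m1, int m2, int m3) = (of_int (coeff_at (m1, m2, m3) P) :: 'a::comm_ring_1)"
  by (induction P) (auto simp: lpoly_Nil lpoly_Cons lookup_add lookup_single when_def)

lemma theta_minus_single: "theta l (Poly_Mapping.single e (of_int c)) - of_int m * Poly_Mapping.single e (of_int c) =
    Poly_Mapping.single e (of_int (c * (l e - m)) :: 'a::comm_ring_1)"
  by (simp add: theta_single of_int_mult_single algebra_simps flip: single_diff)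

lemma theta_minus_add: "theta l (f + g) - of_int m * (f + g) =
    (theta l f - of_int m * f) + (theta l g - of_int m * (g :: 'a::comm_ring_1 laurent))"
  by (simp add: theta_add algebra_simps)

lemma theta_lpoly:
  "theta fst (lpoly P) - of_int m * lpoly P = (lpoly (pshift1 m P) :: 'a::comm_ring_1 laurent)"
  "theta (\<lambda>e. fst (snd e)) (lpoly P) - of_int m * lpoly P = (lpoly (pshift2 m P) :: 'a::comm_ring_1 laurent)"
  "theta (\<lambda>e. snd (snd e)) (lpoly P) - of_int m * lpoly P = (lpoly (pshift3 m P) :: 'a::comm_ring_1 laurent)"
proof -
  show "theta fst (lpoly P) - of_int m * lpoly P = (lpoly (pshift1 m P) :: 'a laurent)"
    by (induction P) (auto simp: lpoly_Nil lpoly_Cons theta_minus_add theta_minus_single pshift1_def)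
  show "theta (\<lambda>e. fst (snd e)) (lpoly P) - of_int m * lpoly P = (lpoly (pshift2 m P) :: 'a laurent)"
    by (induction P) (auto simp: lpoly_Nil lpoly_Cons theta_minus_add theta_minus_single pshift2_def)
  show "theta (\<lambda>e. snd (snd e)) (lpoly P) - of_int m * lpoly P = (lpoly (pshift3 m P) :: 'a laurent)"
    by (induction P) (auto simp: lpoly_Nil lpoly_Cons theta_minus_add theta_minus_single pshift3_def)
qed

abbreviation "lwpoly n \<equiv> weval (of_nat n) LX LY LZ"

lemma horner_row_map: "horner_row w (map ((*) k) cs) = of_int k * horner_row w cs"
  by (induction cs) (simp_all add: algebra_simps)

text \<open>At a natural number \<open>w\<close> a row is a constant, which the derivations do not
  see.\<close>

lemma horner_row_of_nat: "\<exists>k. horner_row (of_nat n) cs = (Poly_Mapping.single 0 (of_int k) :: 'a::comm_ring_1 laurent)"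
proof -
  have "horner_row (of_nat n) cs = (of_int (horner_row (int n) cs) :: 'a laurent)"
    by (induction cs) simp_all
  then show ?thesis by (metis single_of_int)
qed

lemma theta_monomial_rows:
  defines "m a b d \<equiv> Poly_Mapping.single (int a, int b, int d) (1 :: 'a::comm_ring_1)"
  shows "theta fst (m a b d * horner_rows (of_nat n) LZ rows) - of_int k * (m a b d * horner_rows (of_nat n) LZ rows)
      = m a b d * horner_rows (of_nat n) LZ (map (map ((*) (int a - k))) rows)" (is ?th1)
    and "theta (\<lambda>e. fst (snd e)) (m a b d * horner_rows (of_nat n) LZ rows) - of_int k * (m a b d * horner_rows (of_nat n) LZ rows)
      = m a b d * horner_rows (of_nat n) LZ (map (map ((*) (int b - k))) rows)" (is ?th2)
    and "theta (\<lambda>e. snd (snd e)) (m a b d * horner_rows (of_nat n) LZ rows) - of_int k * (m a b d * horner_rows (of_nat n) LZ rows)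
      = m a b d * horner_rows (of_nat n) LZ (scale_rows (int d - k) rows)" (is ?th3)
proof -
  have m: "m a b d * LZ = m a b (Suc d)" for d
    by (simp add: m_def mult_single add.commute)
  have row: "m a b d * horner_row (of_nat n) cs = Poly_Mapping.single (int a, int b, int d) (of_int j :: 'a)"
    if "horner_row (of_nat n) cs = (Poly_Mapping.single 0 (of_int j) :: 'a laurent)" for d cs j
    unfolding that m_def by (simp add: mult_single del: single_of_int)
  have step: "m a b d * horner_rows (of_nat n) LZ (cs # rows) =
      m a b d * horner_row (of_nat n) cs + m a b (Suc d) * horner_rows (of_nat n) LZ rows" for d cs rows
    by (simp add: distrib_left m flip: mult.assoc)
  have single: "theta l (m a b d * horner_row (of_nat n) cs) - of_int k * (m a b d * horner_row (of_nat n) cs) =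
      m a b d * horner_row (of_nat n) (map ((*) (l (int a, int b, int d) - k)) cs)" for l d cs
  proof -
    obtain j where j: "horner_row (of_nat n) cs = (Poly_Mapping.single 0 (of_int j) :: 'a laurent)"
      using horner_row_of_nat by blast
    show ?thesis
      unfolding row[OF j] theta_minus_single horner_row_map mult.left_commute[of "m a b d"]
      unfolding row[OF j] of_int_mult_single
      by (simp only: of_int_mult mult.commute)
  qed
  show ?th1
  proof (induction rows arbitrary: d)
    case (Cons cs rows)
    show ?case unfolding list.map step theta_minus_add Cons.IH single by simp
  qed simp
  show ?th2
  proof (induction rows arbitrary: d)
    case (Cons cs rows)
    show ?case unfolding list.map step theta_minus_add Cons.IH single by simp
  qed simp
  show ?th3
  proof (induction rows arbitrary: d)
    case (Cons cs rows)
    have "int d - k + 1 = int (Suc d) - k" by simp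
    then show ?case unfolding scale_rows.simps step theta_minus_add Cons.IH single by (simp only: snd_conv)
  qed simp
qed

lemma lwpoly_Cons: "lwpoly n ((a, b, d, rows) # H) =
    Poly_Mapping.single (int a, int b, int d) (1 :: 'a::comm_ring_1) * horner_rows (of_nat n) LZ rows + lwpoly n H"
  by (simp add: weval_def laurent_monomial)

lemma lwpoly_Nil: "lwpoly n [] = (0 :: 'a::comm_ring_1 laurent)"
  by (simp add: weval_def)

lemma theta_lwpoly:
  "theta fst (lwpoly n H) - of_int m * lwpoly n H = (lwpoly n (wshift1 m H) :: 'a::comm_ring_1 laurent)"
  "theta (\<lambda>e. fst (snd e)) (lwpoly n H) - of_int m * lwpoly n H = (lwpoly n (wshift2 m H) :: 'a::comm_ring_1 laurent)"
  "theta (\<lambda>e. snd (snd e)) (lwpoly n H) - of_int m * lwpoly n H = (lwpoly n (wshift3 m H) :: 'a::comm_ring_1 laurent)"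
proof -
  show "theta fst (lwpoly n H) - of_int m * lwpoly n H = (lwpoly n (wshift1 m H) :: 'a laurent)"
    by (induction H) (auto simp: lwpoly_Nil lwpoly_Cons theta_minus_add theta_monomial_rows wshift1_def)
  show "theta (\<lambda>e. fst (snd e)) (lwpoly n H) - of_int m * lwpoly n H = (lwpoly n (wshift2 m H) :: 'a laurent)"
    by (induction H) (auto simp: lwpoly_Nil lwpoly_Cons theta_minus_add theta_monomial_rows wshift2_def)
  show "theta (\<lambda>e. snd (snd e)) (lwpoly n H) - of_int m * lwpoly n H = (lwpoly n (wshift3 m H) :: 'a laurent)"
    by (induction H) (auto simp: lwpoly_Nil lwpoly_Cons theta_minus_add theta_monomial_rows wshift3_def)
qed

lemma ct_cert_recurrence:
  assumes n: "n \<ge> 1" and N: "coeff_at (m1, m2, m3) N \<noteq> 0"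
    and cert: "ct_cert (of_nat n :: 'a::{idom, ring_char_0} laurent) LX LY LZ (of_int c2) (of_int c1) (of_int c0)
      (m1, m2, m3) N H1 H2 H3"
  shows "of_int c2 * cf (lpoly N ^ (n + 1)) (scale (int (n + 1)) (int m1, int m2, int m3)) =
     of_int c1 * cf (lpoly N ^ n) (scale (int n) (int m1, int m2, int m3)) -
     (of_int c0 * cf (lpoly N ^ (n - 1)) (scale (int (n - 1)) (int m1, int m2, int m3)) :: 'a)"
proof (rule constant_term_recurrence[OF _ n, where ?H1.0 = "lwpoly n H1" and ?H2.0 = "lwpoly n H2" and ?H3.0 = "lwpoly n H3"])
  show "lpoly N \<noteq> (0 :: 'a laurent)"
  proof
    assume "lpoly N = (0 :: 'a laurent)"
    then have "cf (lpoly N) (int m1, int m2, int m3) = (0 :: 'a)" by (simp only: lookup_zero)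
    then show False using N by (simp add: cf_lpoly)
  qed
  have 2: "2 * of_int m * H = of_int (2 * m) * (H :: 'a laurent)" for m H by simp
  show "lpoly N * (of_int c2 * (lpoly N)\<^sup>2 - of_int c1 * lpoly N * Poly_Mapping.single (int m1, int m2, int m3) 1
        + of_int c0 * (Poly_Mapping.single (int m1, int m2, int m3) 1)\<^sup>2) =
      (of_nat n - 1) * (lwpoly n H1 * (theta fst (lpoly N) - of_int (int m1) * lpoly N)
        + lwpoly n H2 * (theta (\<lambda>e. fst (snd e)) (lpoly N) - of_int (int m2) * lpoly N)
        + lwpoly n H3 * (theta (\<lambda>e. snd (snd e)) (lpoly N) - of_int (int m3) * lpoly N)) +
      lpoly N * ((theta fst (lwpoly n H1) - 2 * of_int (int m1) * lwpoly n H1)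
        + (theta (\<lambda>e. fst (snd e)) (lwpoly n H2) - 2 * of_int (int m2) * lwpoly n H2)
        + (theta (\<lambda>e. snd (snd e)) (lwpoly n H3) - 2 * of_int (int m3) * (lwpoly n H3 :: 'a laurent)))"
    unfolding 2 theta_lpoly theta_lwpoly
    using cert unfolding ct_cert_def prod.case laurent_monomial .
qed

section \<open>Sequences determined by their recurrence\<close>

definition rec_seq :: "(nat \<Rightarrow> int) \<Rightarrow> (nat \<Rightarrow> int) \<Rightarrow> (nat \<Rightarrow> int) \<Rightarrow> (nat \<Rightarrow> int) \<Rightarrow> bool" where
  "rec_seq c2 c1 c0 A \<longleftrightarrow> A 0 = 1 \<and> (\<forall>n. c2 n \<noteq> 0) \<and>
     (\<forall>n. c2 n * A (n + 1) = c1 n * A n - c0 n * prev_term A n)"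

lemma zagier_rec_seq:
  "zagier_sequence a b c A \<Longrightarrow>
   rec_seq (\<lambda>n. (int n + 1)\<^sup>2) (\<lambda>n. a * (int n)\<^sup>2 + a * int n + b) (\<lambda>n. c * (int n)\<^sup>2) A"
  by (auto simp: zagier_sequence_def rec_seq_def add_eq_0_iff)

lemma cooper_rec_seq:
  "cooper_sequence a b c d A \<Longrightarrow>
   rec_seq (\<lambda>n. (int n + 1) ^ 3) (\<lambda>n. (2 * int n + 1) * (a * (int n)\<^sup>2 + a * int n + b))
     (\<lambda>n. int n * (c * (int n)\<^sup>2 + d)) A"
  by (auto simp: cooper_sequence_def rec_seq_def add_eq_0_iff)

text \<open>The step from 0 to 1 is a premise of its own: the convention A(-1) = 0 has no
  counterpart for \<open>f\<close>, where 0 - 1 is 0 on natural numbers.\<close>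

lemma rec_seq_unique:
  fixes f :: "nat \<Rightarrow> 'a :: {idom, ring_char_0}"
  assumes A: "rec_seq c2 c1 c0 A" and f0: "f 0 = 1" and f1: "of_int (c2 0) * f 1 = of_int (c1 0)"
    and f: "\<And>n. n \<ge> 1 \<Longrightarrow> of_int (c2 n) * f (n + 1) = of_int (c1 n) * f n - of_int (c0 n) * f (n - 1)"
  shows "of_int (A n) = f n"
proof (induction n rule: less_induct)
  case (less n)
  consider "n = 0" | "n = 1" | k where "k \<ge> 1" "n = k + 1"
    by (cases n; cases "n - 1") auto
  then show ?case
  proof cases
    case 1
    then show ?thesis using A f0 by (simp add: rec_seq_def)
  next
    case 2
    have "c2 0 * A 1 = c1 0" "c2 0 \<noteq> 0"
      using A unfolding rec_seq_def by (auto simp: prev_term_def dest: spec[of _ 0])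
    then have "of_int (c2 0) * of_int (A 1) = of_int (c2 0) * f 1"
      using f1 by (metis of_int_mult)
    then show ?thesis using 2 \<open>c2 0 \<noteq> 0\<close> by simp
  next
    case 3
    have "c2 k * A (k + 1) = c1 k * A k - c0 k * A (k - 1)" "c2 k \<noteq> 0"
      using A 3(1) unfolding rec_seq_def by (auto simp: prev_term_def dest: spec[of _ k])
    then have "of_int (c2 k) * of_int (A (k + 1)) = of_int (c2 k) * f (k + 1)"
    proof -
      have "of_int (A k) = f k" "of_int (A (k - 1)) = f (k - 1)" using less 3 by auto
      moreover have "(of_int (c2 k * A (k + 1)) :: 'a) = of_int (c1 k * A k - c0 k * A (k - 1))"
        using \<open>c2 k * A (k + 1) = c1 k * A k - c0 k * A (k - 1)\<close> by (rule arg_cong)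
      ultimately show ?thesis using f[OF 3(1)] by simp
    qed
    then show ?thesis using 3 \<open>c2 k \<noteq> 0\<close> by simp
  qed
qed

text \<open>\<open>init\<close> settles n = 0, which the divergence argument does not cover: it
  makes the constant term of the Laurent polynomial the value at 1.\<close>

lemma rec_seq_eq_ct:
  fixes k :: int
  assumes A: "rec_seq c2 c1 c0 A" and N: "coeff_at (m1, m2, m3) N \<noteq> 0"
    and init: "c2 0 * coeff_at (m1, m2, m3) N = c1 0" and k: "k \<noteq> 0"
    and cert: "\<And>n. ct_cert (of_nat n :: 'a::{idom, ring_char_0} laurent) LX LY LZ
      (of_int (k * c2 n)) (of_int (k * c1 n)) (of_int (k * c0 n)) (m1, m2, m3) N H1 H2 H3"
  shows "of_int (A n) = (cf (lpoly N ^ n) (scale (int n) (int m1, int m2, int m3)) :: 'a)"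
proof (rule rec_seq_unique[OF A])
  show "cf (lpoly N ^ 0) (scale (int 0) (int m1, int m2, int m3)) = (1 :: 'a)"
    by (simp add: lookup_one)
  show "of_int (c2 0) * cf (lpoly N ^ 1) (scale (int 1) (int m1, int m2, int m3)) = (of_int (c1 0) :: 'a)"
  proof -
    have "scale (int 1) (int m1, int m2, int m3) = (int m1, int m2, int m3)" by (simp add: scale_def)
    then show ?thesis
      unfolding power_one_right init[symmetric] of_int_mult by (simp only: cf_lpoly)
  qed
next
  fix n :: nat assume n: "n \<ge> 1"
  let ?f = "\<lambda>n. cf (lpoly N ^ n) (scale (int n) (int m1, int m2, int m3)) :: 'a"
  have "of_int k * (of_int (c2 n) * ?f (n + 1)) = of_int k * (of_int (c1 n) * ?f n - of_int (c0 n) * ?f (n - 1))"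
    using ct_cert_recurrence[OF n N cert[of n]] by (simp add: mult.assoc right_diff_distrib)
  then show "of_int (c2 n) * ?f (n + 1) = of_int (c1 n) * ?f n - of_int (c0 n) * ?f (n - 1)"
    using k by (subst (asm) mult_cancel_left) simp
qed

lemma zagier_eq_ct:
  assumes A: "zagier_sequence a b c A"
    and cert: "\<And>w :: 'a::{idom, ring_char_0} laurent. zagier_cert k a b c w LX LY LZ (m1, m2, m3) N H1 H2 H3"
    and N: "coeff_at (m1, m2, m3) N = b" "b \<noteq> 0" "k \<noteq> 0"
  shows "of_int (A n) = (cf (lpoly N ^ n) (scale (int n) (int m1, int m2, int m3)) :: 'a)"
  by (rule rec_seq_eq_ct[OF zagier_rec_seq[OF A], where k = k and ?H1.0 = H1 and ?H2.0 = H2 and ?H3.0 = H3])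
    (use cert N in \<open>simp_all add: zagier_cert_def\<close>)

lemma cooper_eq_ct:
  assumes A: "cooper_sequence a b c d A"
    and cert: "\<And>w :: 'a::{idom, ring_char_0} laurent. cooper_cert k a b c d w LX LY LZ (m1, m2, m3) N H1 H2 H3"
    and N: "coeff_at (m1, m2, m3) N = b" "b \<noteq> 0" "k \<noteq> 0"
  shows "of_int (A n) = (cf (lpoly N ^ n) (scale (int n) (int m1, int m2, int m3)) :: 'a)"
  by (rule rec_seq_eq_ct[OF cooper_rec_seq[OF A], where k = k and ?H1.0 = H1 and ?H2.0 = H2 and ?H3.0 = H3])
    (use cert N in \<open>simp_all add: cooper_cert_def\<close>)

section \<open>Products of factors supported on simplices\<close>

definition exps :: "poly \<Rightarrow> expo list" where
  "exps = map (\<lambda>(c, a, b, d). (int a, int b, int d))"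

lemma good_lpoly:
  assumes "prime p" "odd p" "carry p (exps P)" "fst ` set P \<subseteq> {1, -1}"
  shows "good p (lpoly P)"
  unfolding lpoly_eq_terms
proof (rule good_terms[OF assms(1,2)])
  show "carry p (map fst (map (\<lambda>(c, a, b, d). ((int a, int b, int d), of_int c)) P))"
    using assms(3) by (simp add: exps_def case_prod_unfold comp_def)
  show "set (map snd (map (\<lambda>(c, a, b, d). ((int a, int b, int d), of_int c :: int)) P)) \<subseteq> {1, -1}"
    using assms(4) by (force simp: case_prod_unfold)
qed

fun simplex_det :: "expo list \<Rightarrow> int" where
  "simplex_det [e0, e1, e2, e3] = det4 e0 e1 e2 e3"
| "simplex_det _ = 0"

text \<open>The points \<open>es\<close> complete the exponents of \<open>P\<close> to a simplex whose
  normalized volume 1, 2 or 4 is prime to \<open>p\<close>.\<close>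
definition sparse :: "poly \<times> expo list \<Rightarrow> bool" where
  "sparse = (\<lambda>(P, es). fst ` set P \<subseteq> {1, -1} \<and> length P \<in> {2, 3, 4} \<and>
     \<bar>simplex_det (exps P @ es)\<bar> \<in> {1, 2, 4})"

lemma sparse_good:
  assumes p: "prime p" "odd p" and P: "sparse (P, es)"
  shows "good p (lpoly P)"
proof (rule good_lpoly[OF p])
  show "fst ` set P \<subseteq> {1, -1}" using P by (simp add: sparse_def)
  have D: "\<bar>simplex_det (exps P @ es)\<bar> \<in> {1, 2, 4}" and len: "length (exps P) \<in> {2, 3, 4}"
    using P by (simp_all add: sparse_def exps_def)
  from D have "simplex_det (exps P @ es) \<noteq> 0" by auto
  then obtain e0 e1 e2 e3 where e: "exps P @ es = [e0, e1, e2, e3]"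
    by (cases "exps P @ es" rule: simplex_det.cases) auto
  have p2: "\<not> int p dvd 2"
  proof
    assume "int p dvd 2"
    then have "p dvd 2" by (metis int_dvd_int_iff of_nat_numeral)
    then have "p = 2" using p primes_dvd_imp_eq two_is_prime_nat by blast
    then show False using p by simp
  qed
  moreover from p2 have "\<not> int p dvd 1" using dvd_trans by fastforce
  moreover have "\<not> int p dvd 4"
    using p2 p prime_dvd_mult_iff[of "int p" 2 2] by simp
  moreover have "\<bar>det4 e0 e1 e2 e3\<bar> = 1 \<or> \<bar>det4 e0 e1 e2 e3\<bar> = 2 \<or> \<bar>det4 e0 e1 e2 e3\<bar> = 4"
    using D e by simp
  ultimately have "\<not> int p dvd \<bar>det4 e0 e1 e2 e3\<bar>" by metis
  then have "\<not> int p dvd det4 e0 e1 e2 e3" by simp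
  note c = carry_simplex[OF p(1) this]
  have "exps P = take (length (exps P)) [e0, e1, e2, e3]" using e by (metis append_eq_conv_conj)
  then have "exps P = [e0, e1] \<or> exps P = [e0, e1, e2] \<or> exps P = [e0, e1, e2, e3]"
    using len by (auto simp: numeral_eq_Suc)
  then show "carry p (exps P)" using c by metis
qed

lemma good_prod_list: "prime p \<Longrightarrow> (\<And>P. P \<in> set Ps \<Longrightarrow> good p P) \<Longrightarrow> Ps \<noteq> [] \<Longrightarrow> good p (prod_list Ps)"
proof (induction Ps)
  case (Cons P Ps)
  then show ?case by (cases "Ps = []") (auto intro: good_mult)
qed simp

lemma sparse_product_good:
  assumes "prime p" "odd p" and "lpoly N = (\<Prod>(P, es)\<leftarrow>F. lpoly P :: int laurent)" "list_all sparse F" "F \<noteq> []"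
  shows "good p (lpoly N)"
  unfolding assms(3)
  by (rule good_prod_list[OF assms(1)]) (use assms(2,4,5) in \<open>auto simp: list_all_iff intro: sparse_good[OF assms(1)]\<close>)

lemma supercongruence_of_ct:
  assumes "\<And>n. A n = cf (lpoly N ^ n) (scale (int n) (int m1, int m2, int m3))"
    and "good p (lpoly N)" "r \<ge> 1"
  shows "[A (p ^ r * n) = A (p ^ (r - 1) * n)] (mod int p ^ (2 * r))"
  unfolding assms(1) by (rule good_supercongruence[OF assms(2,3)])

lemma zagier_supercongruence:
  assumes A: "zagier_sequence a b c A" and p: "prime p" "odd p" and r: "r \<ge> 1"
    and cert: "\<And>w :: int laurent. zagier_cert k a b c w LX LY LZ (m1, m2, m3) N H1 H2 H3"
    and F: "lpoly N = (\<Prod>(P, es)\<leftarrow>F. lpoly P :: int laurent)" "list_all sparse F" "F \<noteq> []"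
    and N: "coeff_at (m1, m2, m3) N = b" "b \<noteq> 0" "k \<noteq> 0"
  shows "[A (p ^ r * n) = A (p ^ (r - 1) * n)] (mod int p ^ (2 * r))"
  using zagier_eq_ct[OF A cert N] sparse_product_good[OF p F] r by (intro supercongruence_of_ct) simp_all

lemma cooper_supercongruence:
  assumes A: "cooper_sequence a b c d A" and p: "prime p" "odd p" and r: "r \<ge> 1"
    and cert: "\<And>w :: int laurent. cooper_cert k a b c d w LX LY LZ (m1, m2, m3) N H1 H2 H3"
    and F: "lpoly N = (\<Prod>(P, es)\<leftarrow>F. lpoly P :: int laurent)" "list_all sparse F" "F \<noteq> []"
    and N: "coeff_at (m1, m2, m3) N = b" "b \<noteq> 0" "k \<noteq> 0"
  shows "[A (p ^ r * n) = A (p ^ (r - 1) * n)] (mod int p ^ (2 * r))"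
  using cooper_eq_ct[OF A cert N] sparse_product_good[OF p F] r by (intro supercongruence_of_ct) simp_all

lemmas sparse_simps = sparse_def exps_def det4_def zero_prod_def

section \<open>Products of sparse Laurent polynomials\<close>

text \<open>The vector fields were found by solving a linear system for their coefficients.\<close>

definition poly_A :: poly where "poly_A = [(1, 0, 1, 0), (1, 0, 2, 0), (1, 1, 0, 0), (2, 1, 1, 0), (1, 1, 2, 0), (1, 2, 0, 0),
   (1, 2, 1, 0)]"

definition field_A1 :: wpoly where "field_A1 =
  [(0,2,0,[[-1,-1]]), (0,3,0,[[-2,-2]]), (0,4,0,[[-1,-1]]), (1,1,0,[[-2,-3]]), (1,2,0,[[-4,-4]]),
   (1,3,0,[[-3,-5]]), (2,0,0,[[-1,-1]]), (2,1,0,[[-1]]), (2,3,0,[[1]]), (2,4,0,[[1,1]]), (3,1,0,[[3,5]]),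
   (3,2,0,[[4,4]]), (3,3,0,[[2,3]]), (4,0,0,[[1,1]]), (4,1,0,[[2,2]]), (4,2,0,[[1,1]])]"

definition field_A2 :: wpoly where "field_A2 =
  [(1,1,0,[[-1,-2]]), (1,2,0,[[-2,-5]]), (1,4,0,[[1,3]]), (2,0,0,[[-1,-1]]), (2,1,0,[[-2,-6]]),
   (2,3,0,[[2,6]]), (2,4,0,[[1,1]]), (3,0,0,[[-1,-3]]), (3,2,0,[[2,5]]), (3,3,0,[[1,2]])]"

lemma cert_A: "zagier_cert 1 7 2 (-8) (w :: 'a::idom) x y z (1, 1, 0) poly_A field_A1 field_A2 []"
  unfolding poly_A_def field_A1_def field_A2_def cert_unfold
  by (simp only: cert_eval) Groebner_Basis.algebra

definition factors_A :: "(poly \<times> expo list) list" where "factors_A =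
  [([(1, 0, 0, 0), (1, 1, 0, 0)], [(0, 0, 1), (0, 1, 0)]),
   ([(1, 0, 0, 0), (1, 0, 1, 0)], [(0, 0, 1), (1, 0, 0)]),
   ([(1, 1, 0, 0), (1, 0, 1, 0)], [(0, 0, 0), (0, 0, 1)])]"

lemma factor_A: "peval x y z poly_A = (\<Prod>(P, es)\<leftarrow>factors_A. peval x y (z :: 'a::idom) P)"
  unfolding poly_A_def factors_A_def cert_unfold prod_list.Cons prod_list.Nil
  by (simp only: cert_eval) Groebner_Basis.algebra

lemma supercongruence_A:
  assumes "zagier_sequence 7 2 (-8) A" "prime p" "odd p" "r \<ge> 1"
  shows "[A (p ^ r * n) = A (p ^ (r - 1) * n)] (mod int p ^ (2 * r))"
  by (rule zagier_supercongruence[OF assms cert_A factor_A])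
    (simp_all add: poly_A_def factors_A_def sparse_simps)

text \<open>With P = 1 + x + y this is x y P(x, y) P(1/x, 1/y), so the constant terms are sums of
  squares of trinomial coefficients.\<close>

definition poly_C :: poly where "poly_C = [(1, 0, 1, 0), (1, 0, 2, 0), (1, 1, 0, 0), (3, 1, 1, 0), (1, 1, 2, 0), (1, 2, 0, 0),
   (1, 2, 1, 0)]"

definition field_C1 :: wpoly where "field_C1 =
  [(0,2,0,[[-1,-1]]), (0,3,0,[[-2,-2]]), (0,4,0,[[-1,-1]]), (1,1,0,[[-2,-3]]), (1,2,0,[[-5,-4]]),
   (1,3,0,[[-4,-5]]), (2,0,0,[[-1,-1]]), (2,1,0,[[-2]]), (2,3,0,[[2]]), (2,4,0,[[1,1]]), (3,1,0,[[4,5]]),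
   (3,2,0,[[5,4]]), (3,3,0,[[2,3]]), (4,0,0,[[1,1]]), (4,1,0,[[2,2]]), (4,2,0,[[1,1]])]"

definition field_C2 :: wpoly where "field_C2 =
  [(1,1,0,[[-1,-2]]), (1,2,0,[[-2,-5]]), (1,4,0,[[1,3]]), (2,0,0,[[-1,-1]]), (2,1,0,[[-3,-6]]),
   (2,3,0,[[3,6]]), (2,4,0,[[1,1]]), (3,0,0,[[-1,-3]]), (3,2,0,[[2,5]]), (3,3,0,[[1,2]])]"

lemma cert_C: "zagier_cert 1 10 3 9 (w :: 'a::idom) x y z (1, 1, 0) poly_C field_C1 field_C2 []"
  unfolding poly_C_def field_C1_def field_C2_def cert_unfold
  by (simp only: cert_eval) Groebner_Basis.algebra

definition factors_C :: "(poly \<times> expo list) list" where "factors_C =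
  [([(1, 0, 0, 0), (1, 1, 0, 0), (1, 0, 1, 0)], [(0, 0, 1)]),
   ([(1, 1, 1, 0), (1, 1, 0, 0), (1, 0, 1, 0)], [(0, 0, 1)])]"

lemma factor_C: "peval x y z poly_C = (\<Prod>(P, es)\<leftarrow>factors_C. peval x y (z :: 'a::idom) P)"
  unfolding poly_C_def factors_C_def cert_unfold prod_list.Cons prod_list.Nil
  by (simp only: cert_eval) Groebner_Basis.algebra

lemma supercongruence_C:
  assumes "zagier_sequence 10 3 9 A" "prime p" "odd p" "r \<ge> 1"
  shows "[A (p ^ r * n) = A (p ^ (r - 1) * n)] (mod int p ^ (2 * r))"
  by (rule zagier_supercongruence[OF assms cert_C factor_C])
    (simp_all add: poly_C_def factors_C_def sparse_simps)

text \<open>(1 + x) (1 + y) (1 + x + y), belonging to the Apery numbers for zeta(2).\<close>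

definition poly_D :: poly where "poly_D = [(1, 0, 0, 0), (2, 0, 1, 0), (1, 0, 2, 0), (2, 1, 0, 0), (3, 1, 1, 0), (1, 1, 2, 0),
   (1, 2, 0, 0), (1, 2, 1, 0)]"

definition field_D1 :: wpoly where "field_D1 =
  [(0,1,0,[[-2,-2]]), (0,2,0,[[-4,-8]]), (0,3,0,[[-2,-6]]), (1,1,0,[[-6,-10]]), (1,2,0,[[-8,-14]]),
   (1,3,0,[[-2,-2]]), (2,1,0,[[-5,-11]]), (2,2,0,[[-3,-2]]), (2,3,0,[[1,6]]), (3,2,0,[[2,5]]),
   (3,3,0,[[1,2]]), (4,1,0,[[1,3]]), (4,2,0,[[1,1]])]"

definition field_D2 :: wpoly where "field_D2 =
  [(0,0,0,[[-1,-1]]), (0,1,0,[[-4,-4]]), (0,2,0,[[-4,-4]]), (0,4,0,[[1,1]]), (1,0,0,[[-4,-4]]),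
   (1,1,0,[[-11,-4]]), (1,2,0,[[-6,6]]), (1,3,0,[[3,8]]), (1,4,0,[[2,2]]), (2,0,0,[[-6,-6]]),
   (2,1,0,[[-12,-10]]), (2,2,0,[[-3,-2]]), (2,3,0,[[4,3]]), (2,4,0,[[1,1]]), (3,0,0,[[-4,-4]]),
   (3,1,0,[[-5,-10]]), (3,2,0,[[1,-3]]), (3,3,0,[[2,3]]), (4,0,0,[[-1,-1]]), (4,2,0,[[1,1]])]"

lemma cert_D: "zagier_cert 1 11 3 (-1) (w :: 'a::idom) x y z (1, 1, 0) poly_D field_D1 field_D2 []"
  unfolding poly_D_def field_D1_def field_D2_def cert_unfold
  by (simp only: cert_eval) Groebner_Basis.algebra

definition factors_D :: "(poly \<times> expo list) list" where "factors_D =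
  [([(1, 0, 0, 0), (1, 1, 0, 0)], [(0, 0, 1), (0, 1, 0)]),
   ([(1, 0, 0, 0), (1, 0, 1, 0)], [(0, 0, 1), (1, 0, 0)]),
   ([(1, 0, 0, 0), (1, 1, 0, 0), (1, 0, 1, 0)], [(0, 0, 1)])]"

lemma factor_D: "peval x y z poly_D = (\<Prod>(P, es)\<leftarrow>factors_D. peval x y (z :: 'a::idom) P)"
  unfolding poly_D_def factors_D_def cert_unfold prod_list.Cons prod_list.Nil
  by (simp only: cert_eval) Groebner_Basis.algebra

lemma supercongruence_D:
  assumes "zagier_sequence 11 3 (-1) A" "prime p" "odd p" "r \<ge> 1"
  shows "[A (p ^ r * n) = A (p ^ (r - 1) * n)] (mod int p ^ (2 * r))"
  by (rule zagier_supercongruence[OF assms cert_D factor_D])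
    (simp_all add: poly_D_def factors_D_def sparse_simps)

text \<open>In X = x^2 and Y = y^2 this is (X + Y + 1) (2 X Y + 2 X + 2 Y - X^2 - Y^2 - 1). The
  second factor has coefficients 2; in x and y it splits as in Heron's formula, at the price of
  volume 4 for the first.\<close>

definition poly_F :: poly where "poly_F = [(-1, 0, 0, 0), (1, 0, 2, 0), (1, 0, 4, 0), (-1, 0, 6, 0), (1, 2, 0, 0),
   (6, 2, 2, 0), (1, 2, 4, 0), (1, 4, 0, 0), (1, 4, 2, 0), (-1, 6, 0, 0)]"

definition field_F1 :: wpoly where "field_F1 =
  [(0,2,0,[[2,5]]), (0,4,0,[[-2,6]]), (0,6,0,[[-2,-12]]), (0,8,0,[[2,2]]), (0,10,0,[[0,-1]]),
   (2,2,0,[[-4,-9]]), (2,4,0,[[-12,-4]]), (2,6,0,[[-4,4]]), (2,8,0,[[4,8]]), (2,10,0,[[0,1]]),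
   (4,2,0,[[-2,-5]]), (4,6,0,[[0,-11]]), (4,8,0,[[-2,-4]]), (6,2,0,[[6,13]]), (6,4,0,[[12,4]]),
   (6,6,0,[[2,13]]), (8,4,0,[[2,-6]]), (10,2,0,[[-2,-4]])]"

definition field_F2 :: wpoly where "field_F2 =
  [(0,0,0,[[-2,-2]]), (0,2,0,[[1,1]]), (0,4,0,[[1,1]]), (0,6,0,[[2,2]]), (0,10,0,[[-3,-3]]), (0,12,0,[[1,1]]),
   (2,0,0,[[4,4]]), (2,2,0,[[13]]), (2,4,0,[[4,-10]]), (2,6,0,[[14,2]]), (2,8,0,[[0,6]]),
   (2,10,0,[[-3,-2]]), (4,0,0,[[2,2]]), (4,2,0,[[-13,-3]]), (4,4,0,[[3,-3]]), (4,6,0,[[17,-1]]),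
   (4,8,0,[[-1,-3]]), (6,0,0,[[-8,-8]]), (6,2,0,[[-9,12]]), (6,4,0,[[14,2]]), (6,6,0,[[3,14]]),
   (8,0,0,[[2,2]]), (8,2,0,[[8,-8]]), (8,4,0,[[2,-6]]), (10,0,0,[[4,4]]), (10,2,0,[[0,-2]]),
   (12,0,0,[[-2,-2]])]"

lemma cert_F: "zagier_cert 4 17 6 72 (w :: 'a::idom) x y z (2, 2, 0) poly_F field_F1 field_F2 []"
  unfolding poly_F_def field_F1_def field_F2_def cert_unfold
  by (simp only: cert_eval) Groebner_Basis.algebra

definition factors_F :: "(poly \<times> expo list) list" where "factors_F =
  [([(1, 2, 0, 0), (1, 0, 2, 0), (1, 0, 0, 0)], [(0, 0, 1)]),
   ([(1, 1, 0, 0), (1, 0, 1, 0), (1, 0, 0, 0)], [(0, 0, 1)]),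
   ([(1, 1, 0, 0), (1, 0, 1, 0), (-1, 0, 0, 0)], [(0, 0, 1)]),
   ([(1, 1, 0, 0), (-1, 0, 1, 0), (1, 0, 0, 0)], [(0, 0, 1)]),
   ([(-1, 1, 0, 0), (1, 0, 1, 0), (1, 0, 0, 0)], [(0, 0, 1)])]"

lemma factor_F: "peval x y z poly_F = (\<Prod>(P, es)\<leftarrow>factors_F. peval x y (z :: 'a::idom) P)"
  unfolding poly_F_def factors_F_def cert_unfold prod_list.Cons prod_list.Nil
  by (simp only: cert_eval) Groebner_Basis.algebra

lemma supercongruence_F:
  assumes "zagier_sequence 17 6 72 A" "prime p" "odd p" "r \<ge> 1"
  shows "[A (p ^ r * n) = A (p ^ (r - 1) * n)] (mod int p ^ (2 * r))"
  by (rule zagier_supercongruence[OF assms cert_F factor_F])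
    (simp_all add: poly_F_def factors_F_def sparse_simps)

text \<open>x y z (1 + x + y + z) (1 + 1/x + 1/y + 1/z): the constant terms are the Domb numbers,
  sums of squares of multinomial coefficients with four parts.\<close>

definition poly_alpha :: poly where "poly_alpha = [(1, 0, 1, 1), (1, 0, 1, 2), (1, 0, 2, 1), (1, 1, 0, 1), (1, 1, 0, 2), (1, 1, 1, 0),
   (4, 1, 1, 1), (1, 1, 1, 2), (1, 1, 2, 0), (1, 1, 2, 1), (1, 2, 0, 1),
   (1, 2, 1, 0), (1, 2, 1, 1)]"

definition field_alpha1 :: wpoly where "field_alpha1 =
  [(0,2,2,[[-1,-2,-1],[-2,-4,-2],[-1,-2,-1]]), (0,3,2,[[-2,-4,-2],[-2,-4,-2]]), (0,4,2,[[-1,-2,-1]]),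
   (1,1,2,[[2,-2,-3],[7,1,-16],[3,5,2]]), (1,2,1,[[2,-2,-3],[0,-16,-8],[0,-2,2],[3,5,2]]),
   (1,3,1,[[4,-4,-6],[-7,-14,-3],[-5,1,4]]), (1,4,1,[[2,-2,-3],[-4,-7,-3]]),
   (2,0,2,[[3,5,2],[9,15,6],[4,7,3]]), (2,1,1,[[9,10,4],[25,11,-8],[24,22,-5],[8,14,6]]),
   (2,2,0,[[3,5,2],[23,6,-10],[14,-4,-10],[11,19],[4,7,3]]),
   (2,3,0,[[6,10,4],[22,13,-5],[-1,5,-2],[-3,5,6]]), (2,4,0,[[3,5,2],[9,10,4],[-3,-5,-2]]),
   (3,0,2,[[4,7,3],[5,7,3]]), (3,1,1,[[11,14,6],[14,12,-2],[10,14,6]]),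
   (3,2,0,[[4,7,3],[14,12,-2],[7,14,3],[5,7,3]]), (3,3,0,[[4,7,3],[11,14,6],[-2,2,3]]), (4,0,2,[[1,2,1]]),
   (4,1,1,[[2,4,2],[2,4,2]]), (4,2,0,[[1,2,1],[2,4,2],[1,2,1]])]"

definition field_alpha2 :: wpoly where "field_alpha2 =
  [(1,1,2,[[-1,-7,-5],[-1,-10,-20]]), (1,2,2,[[-2,-7,-5]]), (1,3,3,[[1,10,20]]), (1,4,2,[[1]]),
   (2,0,2,[[-1,-2,-1],[-1]]), (2,1,1,[[-1,-7,-5],[-4,-14,-6]]), (2,2,1,[[-2,-7,-5],[],[2,7,5]]),
   (2,3,2,[[4,14,6],[1,7,5]]), (2,4,1,[[1],[1,2,1]]), (3,0,2,[[-1]]), (3,1,1,[[-1]]), (3,2,2,[[2,7,5]]),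
   (3,3,1,[[1],[1,7,5]])]"

definition field_alpha3 :: wpoly where "field_alpha3 =
  [(1,1,2,[[0,-10,-10],[1,-3,-5],[1,7,5]]), (1,2,1,[[-1,-7,-5],[-3,-14],[0,14,10],[1,7,5]]),
   (1,3,1,[[-2,-14,-10],[-16,-17,5],[-11,-3,15]]), (1,4,1,[[-1,-7,-5],[-12,-20,-10]]),
   (2,0,2,[[3,5,2],[4,7,3],[1,2,1]]), (2,1,1,[[2,-2,-3],[8,-7,-3],[9,13,2],[2,4,2]]),
   (2,2,0,[[-1,-2,-1],[-2,-15,-7],[],[2,15,7],[1,2,1]]),
   (2,3,0,[[-2,-4,-2],[-9,-13,-2],[-18,-13,3],[-2,2,3]]), (2,4,0,[[-1,-2,-1],[-4,-7,-3],[-3,-5,-2]]),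
   (3,0,2,[[1],[1]]), (3,1,2,[[5],[2]]), (3,2,0,[[-1],[],[4,7,5],[1]]), (3,3,0,[[-1],[],[1]])]"

lemma cert_alpha: "cooper_cert 1 10 4 64 0 (w :: 'a::idom) x y z (1, 1, 1) poly_alpha field_alpha1 field_alpha2 field_alpha3"
  unfolding poly_alpha_def field_alpha1_def field_alpha2_def field_alpha3_def cert_unfold
  by (simp only: cert_eval) Groebner_Basis.algebra

definition factors_alpha :: "(poly \<times> expo list) list" where "factors_alpha =
  [([(1, 0, 0, 0), (1, 1, 0, 0), (1, 0, 1, 0), (1, 0, 0, 1)], []),
   ([(1, 1, 1, 1), (1, 0, 1, 1), (1, 1, 0, 1), (1, 1, 1, 0)], [])]"

lemma factor_alpha: "peval x y z poly_alpha = (\<Prod>(P, es)\<leftarrow>factors_alpha. peval x y (z :: 'a::idom) P)"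
  unfolding poly_alpha_def factors_alpha_def cert_unfold prod_list.Cons prod_list.Nil
  by (simp only: cert_eval) Groebner_Basis.algebra

lemma supercongruence_alpha:
  assumes "cooper_sequence 10 4 64 0 A" "prime p" "odd p" "r \<ge> 1"
  shows "[A (p ^ r * n) = A (p ^ (r - 1) * n)] (mod int p ^ (2 * r))"
  by (rule cooper_supercongruence[OF assms cert_alpha factor_alpha])
    (simp_all add: poly_alpha_def factors_alpha_def sparse_simps)

text \<open>(x + y) (1 + z) (x + y + z) (1 + y + z), belonging to the Apery numbers for
  zeta(3).\<close>

definition poly_gamma :: poly where "poly_gamma = [(1, 0, 1, 1), (2, 0, 1, 2), (1, 0, 1, 3), (1, 0, 2, 0), (3, 0, 2, 1), (2, 0, 2, 2),
   (1, 0, 3, 0), (1, 0, 3, 1), (1, 1, 0, 1), (2, 1, 0, 2), (1, 1, 0, 3),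
   (2, 1, 1, 0), (5, 1, 1, 1), (3, 1, 1, 2), (2, 1, 2, 0), (2, 1, 2, 1),
   (1, 2, 0, 0), (2, 2, 0, 1), (1, 2, 0, 2), (1, 2, 1, 0), (1, 2, 1, 1)]"

definition field_gamma1 :: wpoly where "field_gamma1 =
  [(0,2,2,[[-1,-2,-1],[-4,-8,-4],[-6,-12,-6],[-4,-8,-4],[-1,-2,-1]]),
   (0,3,1,[[-2,-4,-2],[-10,-20,-10],[-18,-36,-18],[-14,-28,-14],[-4,-8,-4]]),
   (0,4,0,[[-1,-2,-1],[-8,-16,-8],[-19,-38,-19],[-18,-36,-18],[-6,-12,-6]]),
   (0,5,0,[[-2,-4,-2],[-8,-16,-8],[-10,-20,-10],[-4,-8,-4]]), (0,6,0,[[-1,-2,-1],[-2,-4,-2],[-1,-2,-1]]),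
   (1,1,2,[[2,-2,-3],[8,-8,-12],[12,-12,-18],[8,-8,-12],[2,-2,-3]]),
   (1,2,1,[[-14,-22,-14],[-27,-45,-35],[-43,-73,-51],[-37,-89,-55],[-7,-39,-25]]),
   (1,3,0,[[-10,-14,-6],[-63,-45,-20],[-157,-91,-3],[-233,-205,-37],[-86,-196,-99]]),
   (1,4,0,[[-20,-28,-12],[-58,-54,-11],[-170,-97,20],[-83,-173,-83]]),
   (1,5,0,[[-6,-14,-6],[-12,-28,-12],[-6,-14,-6]]),
   (2,0,2,[[3,5,2],[12,20,8],[18,30,12],[12,20,8],[3,5,2]]),
   (2,1,1,[[18,4,-16],[77,-17,-76],[101,-13,-77],[62,31,-10],[20,23,7]]),
   (2,2,0,[[28,28,8],[63,30,-33],[-15,15],[-119,13,94],[-44,-33,19]]),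
   (2,3,0,[[12,8],[-13,5,18],[-198,23,139],[-99,-114,-12]]), (2,4,0,[[-8,-8],[-16,-16],[-8,-8]]),
   (3,0,1,[[4,7,3],[16,28,12],[24,42,18],[16,28,12],[4,7,3]]),
   (3,1,0,[[14,38,22],[63,57,8],[83,38,-18],[52,47,8],[18,28,12]]),
   (3,2,0,[[8,32,20],[34,52,29],[-17,58,66],[-18,5,23]]), (3,3,0,[[-2,6,6],[-4,12,12],[-2,6,6]]),
   (4,0,0,[[1,2,1],[4,8,4],[6,12,6],[4,8,4],[1,2,1]]), (4,1,0,[[2,4,2],[6,12,6],[6,12,6],[2,4,2]]),
   (4,2,0,[[1,2,1],[2,4,2],[1,2,1]])]"

definition field_gamma2 :: wpoly where "field_gamma2 =
  [(1,1,2,[[-1,-7,-5],[-4,-28,-20],[-6,-42,-30],[-4,-28,-20],[-1,-7,-5]]),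
   (1,2,1,[[-3,-2,-6],[-34,-20,-28],[-106,-64,-27],[-103,-122,-46],[-28,-76,-41]]),
   (1,3,0,[[-2],[-11,-2,-6],[-83,-27,4],[-150,-105,-6],[-51,-131,-67]]),
   (1,4,2,[[-47,-11,20],[-22,-62,-31]]), (1,5,0,[[2],[4],[2]]),
   (2,0,2,[[-1,-2,-1],[-4,-8,-4],[-6,-12,-6],[-4,-8,-4],[-1,-2,-1]]),
   (2,1,1,[[22,13,-13],[40,-40,-91],[-10,-82,-89],[-38,-58,-27],[-10,-29,-16]]),
   (2,2,0,[[28,28,8],[93,46,-19],[2,29,8],[-102,38,103],[-32,-6,34]]),
   (2,3,0,[[32,40,16],[55,53,18],[-22,79,93],[-19,33,57]]), (2,4,0,[[4,12,8],[8,24,16],[4,12,8]]),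
   (3,0,1,[[-1],[-4],[-6],[-4],[-1]]), (3,1,0,[[6,24,16],[45,38,12],[39,14,-4]]),
   (3,2,0,[[8,36,24],[46,50,20],[40,36,24],[3,45,42]]), (3,3,0,[[2,12,8],[4,24,16],[2,12,8]])]"

definition field_gamma3 :: wpoly where "field_gamma3 =
  [(1,2,1,[[-2,5,-1],[-15,10,-2],[-21,5,-1],[-5],[3]]), (1,3,0,[[-2],[2],[-2],[],[6]]),
   (1,4,0,[[-2],[],[5],[3]]), (2,1,1,[[-2,-33,-35],[-10,-66,-70],[-11,-33,-35],[],[3]]),
   (2,2,0,[[8,-16,-16],[1,-28,-27],[-35,26,48],[-41,72,114],[-13,34,55]]),
   (2,3,0,[[8,-4,-8],[21,1,2],[-3,39,65],[-16,34,55]]), (3,1,0,[[-2],[-10],[-11],[],[3]]),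
   (3,2,0,[[-2],[24],[29,33,34],[3,33,34]])]"

lemma cert_gamma: "cooper_cert 1 17 5 1 0 (w :: 'a::idom) x y z (1, 1, 1) poly_gamma field_gamma1 field_gamma2 field_gamma3"
  unfolding poly_gamma_def field_gamma1_def field_gamma2_def field_gamma3_def cert_unfold
  by (simp only: cert_eval) Groebner_Basis.algebra

definition factors_gamma :: "(poly \<times> expo list) list" where "factors_gamma =
  [([(1, 1, 0, 0), (1, 0, 1, 0)], [(0, 0, 0), (0, 0, 1)]),
   ([(1, 0, 0, 0), (1, 0, 0, 1)], [(0, 1, 0), (1, 0, 0)]),
   ([(1, 1, 0, 0), (1, 0, 1, 0), (1, 0, 0, 1)], [(0, 0, 0)]),
   ([(1, 0, 0, 0), (1, 0, 1, 0), (1, 0, 0, 1)], [(1, 0, 0)])]"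

lemma factor_gamma: "peval x y z poly_gamma = (\<Prod>(P, es)\<leftarrow>factors_gamma. peval x y (z :: 'a::idom) P)"
  unfolding poly_gamma_def factors_gamma_def cert_unfold prod_list.Cons prod_list.Nil
  by (simp only: cert_eval) Groebner_Basis.algebra

lemma supercongruence_gamma:
  assumes "cooper_sequence 17 5 1 0 A" "prime p" "odd p" "r \<ge> 1"
  shows "[A (p ^ r * n) = A (p ^ (r - 1) * n)] (mod int p ^ (2 * r))"
  by (rule cooper_supercongruence[OF assms cert_gamma factor_gamma])
    (simp_all add: poly_gamma_def factors_gamma_def sparse_simps)

text \<open>A product of four trinomials, each omitting one of the monomials 1, x, y, z; the omitted
  one is the completing vertex in \<open>factors_delta\<close>.\<close>

definition poly_delta :: poly where "poly_delta = [(-1, 0, 0, 1), (1, 0, 0, 3), (-1, 0, 1, 0), (-1, 0, 1, 3), (1, 0, 3, 0),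
   (1, 0, 3, 1), (1, 1, 0, 0), (-1, 1, 0, 3), (3, 1, 1, 1), (1, 1, 3, 0),
   (-1, 3, 0, 0), (1, 3, 0, 1), (-1, 3, 1, 0)]"

definition field_delta1 :: wpoly where "field_delta1 =
  [(0,1,1,[[-4,-10,-6],[],[4,10,6],[-4,-16,-12],[],[4,16,12]]), (0,2,0,[[-4,-8,-4]]),
   (0,2,3,[[-8,-6,-18],[0,-10,10],[],[-4,-8,-4]]), (0,3,1,[[0,18,18],[0,28,18],[0,-28,-18],[0,-8,-18]]),
   (0,4,0,[[4,16,12],[4,16,12],[],[4,4],[4,4]]), (0,5,2,[[0,-10,-20]]),
   (1,1,0,[[4,12,8],[2,4,2],[0,-22,10],[-2,-18,-38]]), (1,1,6,[[-4,-16,-12]]),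
   (1,2,0,[[4,8,4],[8,22,19],[-2,-14,16],[6,48,42],[12,24,84]]),
   (1,3,0,[[-4,-20,-16],[0,-34,21],[6,-32,-40],[2,-88,-140],[0,0,-34]]),
   (1,4,1,[[-4,-16,150],[-4,-12,68],[0,0,12]]), (1,5,2,[[0,-10,-20]]), (2,0,3,[[0,-10,-10],[0,-10,-10]]),
   (2,1,0,[[-2,-8,-6],[0,10,-59],[0,20,48],[2,20,24],[0,18,48]]),
   (2,2,0,[[4,10,6],[-8,6,-33],[2,0,-2],[-4,-12,-76],[0,-14,-26]]),
   (2,3,0,[[-4,-6,-2],[4,-24,-90],[0,-6,-78],[-2,-12,-62]]), (2,4,0,[[-4,-18,-14],[0,-22,132],[-4,0,4]]),
   (3,0,2,[[0,10,10],[0,10,10],[0,10,10]]), (3,1,0,[[-4,-12,-8],[6,20],[0,2,44],[-6,-18],[4,8,-36]]),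
   (3,2,0,[[-2,-2],[0,-12,-63],[-2,40,-38],[0,-24,28]]), (3,3,1,[[0,-2,-81],[-2,34,4]]),
   (3,4,0,[[-2,-6,-4],[-2,-6,-2]]), (4,1,1,[[-2,-16,69],[0,-20,-92],[2,16,8]]),
   (4,2,1,[[-6,-16,-11],[2,-6,4]]), (4,3,0,[[0,-14,-14],[0,14,12]]), (4,4,0,[[-2,-4,-2]]),
   (5,0,2,[[0,-10,-10]]), (5,1,2,[[0,0,-10]]), (6,1,0,[[2,8,6],[-2,-8,-6]]), (6,2,0,[[2,4,2]])]"

definition field_delta2 :: wpoly where "field_delta2 =
  [(0,0,2,[[-4,-8,-4],[],[8,16,8],[],[-4,-8,-4]]), (0,1,1,[[-6,-12,-6],[],[6,12,6]]), (0,2,0,[[-2,-4,-2]]),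
   (0,2,3,[[2,14,12],[0,-10,-10],[],[4,8,4]]), (0,3,1,[[2,4,2],[2,14,12],[-2,-14,-12],[-2,6,8]]),
   (0,4,3,[[-6,-12,-6],[-6,-12,-6]]), (0,5,2,[[0,-10,-10]]), (0,6,0,[[2,4,2],[4,8,4],[2,4,2]]),
   (1,0,1,[[8,16,8],[],[-8,-16,-8],[-8,-16,-8],[],[8,16,8]]),
   (1,1,0,[[6,16,10],[0,-2,-2],[12,22,-34],[-6,20,48],[-12,0,24],[],[0,-8,-8]]),
   (1,2,0,[[0,-4,-4],[6,14,-65],[0,22,50],[0,16,38],[-12,-6,18]]),
   (1,3,0,[[-2,-12,-10],[0,-12,2],[0,-34,-32],[0,-32,-78],[2,2,-34]]),
   (1,4,1,[[6,0,53],[6,-12,26],[-6,-18]]), (1,5,2,[[0,0,-10]]), (1,6,0,[[4,8,4],[4,8,4]]),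
   (2,0,0,[[-4,-8,-4]]), (2,0,3,[[8,6,18],[0,-10,10],[],[-4,-8,-4]]),
   (2,1,0,[[2,4,2],[-6,-6,61],[-4,-14,18],[-4,-18,32],[12,50,-74]]),
   (2,2,0,[[6,14,8],[0,20,-51],[4,-6,2],[4,-20,-2],[0,-20,-32]]),
   (2,3,0,[[-2,-2],[0,8,-99],[-2,40,-38],[0,24,-28]]), (2,4,0,[[-4,-8,-4],[6,-8,13],[2,0,-2]]),
   (2,6,0,[[2,4,2]]), (3,0,1,[[-8,-16,-8],[8,26,8],[8,26,8],[-8,-6,-8]]),
   (3,1,0,[[-12,-24,-12],[6,8,65],[8,10,28],[-2,0,-22],[0,0,-40]]),
   (3,2,0,[[-4,-6,-2],[-6,-14,14],[0,38,-6],[10,16,58]]), (3,3,0,[[2,4,2],[0,-2,-81],[-4,30,2]]),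
   (3,4,0,[[-6,-14,-8],[-6,-14,-6]]), (4,0,0,[[8,16,8],[-8,-16,-8],[],[-8,-16,-8],[8,16,8]]),
   (4,1,1,[[12,-16,94],[-16,-34,-162],[4,2,-8]]), (4,2,0,[[0,-10,-10],[-12,-34,108],[-4,-6,10]]),
   (4,3,0,[[2,-6,-8],[-2,6,6]]), (4,4,0,[[-6,-12,-6]]), (5,0,2,[[0,-10,-20]]), (5,1,2,[[0,-10,-20]]),
   (6,0,0,[[-4,-8,-4],[8,16,8],[-4,-8,-4]]), (6,2,0,[[4,8,4]])]"

definition field_delta3 :: wpoly where "field_delta3 =
  [(1,1,0,[[0,2,2],[0,-2,-2],[0,-4,-4],[0,2,2]]), (1,1,6,[[0,2,2]]),
   (1,2,0,[[0,-4,-4],[0,-10,-51],[0,24,-47],[0,40,56],[0,-10,76]]),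
   (1,3,0,[[0,-6,-18],[0,20,-17],[0,18,-43],[0,-38,-78],[0,0,-34]]),
   (1,4,0,[[0,8,24],[],[0,-16,-20],[0,-8,4]]), (1,5,2,[[0,-10,-20]]),
   (2,1,0,[[0,-2,-2],[0,-6,-31],[0,-8,39],[0,-4,14]]), (2,2,0,[[0,14,-14],[],[0,-20,20],[],[0,6,-6]]),
   (2,3,0,[[0,-6,-28],[0,8,-99],[0,10,-127],[0,-4,-56]]), (2,4,0,[[0,-10,-6],[0,-12,46],[0,-2,-2]]),
   (3,1,0,[[0,-4,-16],[0,14,-67],[0,20,123],[],[0,0,-40]]),
   (3,2,0,[[0,-6,-28],[0,-12,-63],[0,14,35],[0,4,56]]), (3,3,0,[[0,4,32],[0,-4,-162],[0,28,-4]]),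
   (3,4,0,[[0,0,-2],[0,0,2]]), (4,1,0,[[0,8,24],[],[0,-16,-26],[0,8,2]]),
   (4,2,0,[[0,-2,2],[0,-36,-42],[0,-2,10]]), (4,3,0,[[0,0,-2],[0,0,-2]]), (5,1,2,[[0,-10,-20]])]"

lemma cert_delta: "cooper_cert 4 7 3 81 0 (w :: 'a::idom) x y z (1, 1, 1) poly_delta field_delta1 field_delta2 field_delta3"
  unfolding poly_delta_def field_delta1_def field_delta2_def field_delta3_def cert_unfold
  by (simp only: cert_eval) Groebner_Basis.algebra

definition factors_delta :: "(poly \<times> expo list) list" where "factors_delta =
  [([(1, 1, 0, 0), (1, 0, 1, 0), (-1, 0, 0, 0)], [(0, 0, 1)]),
   ([(1, 1, 0, 0), (1, 0, 0, 1), (1, 0, 0, 0)], [(0, 1, 0)]),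
   ([(-1, 1, 0, 0), (1, 0, 1, 0), (1, 0, 0, 1)], [(0, 0, 0)]),
   ([(1, 0, 1, 0), (-1, 0, 0, 1), (1, 0, 0, 0)], [(1, 0, 0)])]"

lemma factor_delta: "peval x y z poly_delta = (\<Prod>(P, es)\<leftarrow>factors_delta. peval x y (z :: 'a::idom) P)"
  unfolding poly_delta_def factors_delta_def cert_unfold prod_list.Cons prod_list.Nil
  by (simp only: cert_eval) Groebner_Basis.algebra

lemma supercongruence_delta:
  assumes "cooper_sequence 7 3 81 0 A" "prime p" "odd p" "r \<ge> 1"
  shows "[A (p ^ r * n) = A (p ^ (r - 1) * n)] (mod int p ^ (2 * r))"
  by (rule cooper_supercongruence[OF assms cert_delta factor_delta])
    (simp_all add: poly_delta_def factors_delta_def sparse_simps)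

definition poly_zeta :: poly where "poly_zeta = [(1, 0, 0, 0), (2, 0, 0, 1), (1, 0, 0, 2), (2, 0, 1, 0), (3, 0, 1, 1), (1, 0, 1, 2),
   (1, 0, 2, 0), (1, 0, 2, 1), (1, 1, 0, 0), (3, 1, 0, 1), (2, 1, 0, 2),
   (1, 1, 1, 0), (3, 1, 1, 1), (1, 1, 1, 2), (1, 1, 2, 1), (1, 2, 0, 1),
   (1, 2, 0, 2), (1, 2, 1, 1)]"

definition field_zeta1 :: wpoly where "field_zeta1 =
  [(0,1,1,[[-3],[-6],[-3]]), (0,2,1,[[-6],[-9,-33,-34],[-3,-55,-55]]), (0,3,1,[[-3],[-3]]),
   (1,1,2,[[-8,-22,-21],[-8]]), (1,2,1,[[0,-33,-34],[-15,-52,-48],[-13,-70,-55]]), (1,3,2,[[-4,-15,-20]]),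
   (2,1,1,[[4],[-3,-22,-21],[-6]]), (2,2,1,[[-1,13,32],[-6,-19,-17],[-9,-15]]),
   (2,3,1,[[1,16,26],[0,-8,-15]]), (3,1,1,[[1]]), (3,2,1,[[1,4,3],[1,2,-2],[1]]), (3,3,2,[[1,7,5]]),
   (4,1,2,[[1],[1]]), (4,2,2,[[1,2,1]])]"

definition field_zeta2 :: wpoly where "field_zeta2 =
  [(0,0,0,[[-1,-2,-1],[-4,-8,-4],[-6,-12,-6],[-4,-8,-4],[-1,-2,-1]]),
   (0,1,0,[[4,6,2],[18,15,3],[-30,-67,-35],[-48,-83,-39],[-4,-7,-3]]),
   (0,2,0,[[12,20,8],[44,54,20],[-14,-27,-13],[-46,-73,-32],[-3,-5,-2]]),
   (0,3,0,[[8,14,6],[24,35,15],[11,30,17],[-2,2,3]]), (0,4,0,[[1,2,1],[2,4,2],[1,2,1]]),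
   (1,0,0,[[-2,-4,-2],[-10,-20,-10],[-18,-36,-18],[-14,-28,-14],[-4,-8,-4]]),
   (1,1,0,[[6,9,3],[31,-33,-63],[-36,-89,-50],[-120,-103,12],[-12,-21,-9]]),
   (1,2,0,[[12,20,8],[56,-11,-73],[20,-12,-42],[-72,-57,11],[-6,-10,-4]]),
   (1,3,0,[[4,7,3],[23,10,-18],[13,9,-12],[-4,4,6]]), (1,4,1,[[2,4,2],[2,4,2]]),
   (2,0,0,[[-1,-2,-1],[-8,-16,-8],[-19,-38,-19],[-18,-36,-18],[-6,-12,-6]]),
   (2,1,0,[[2,3,1],[6,-16,-9],[-14,-61,-40],[-86,-28,54],[-12,-21,-9]]),
   (2,2,0,[[3,5,2],[10,7,20],[-7,-19,-16],[-26,-13,14],[-3,-5,-2]]), (2,3,1,[[0,10,21],[-1,3,-1],[-2,2,3]]),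
   (2,4,2,[[1,2,1]]), (3,0,1,[[-2,-4,-2],[-8,-16,-8],[-10,-20,-10],[-4,-8,-4]]),
   (3,1,1,[[-4,-10,-6],[-18,-24,-7],[-18,-15],[-4,-7,-3]]), (3,2,1,[[-2,-6,-4],[-12,-2,7],[-6,-5]]),
   (3,3,2,[[-2,2,3]]), (4,0,2,[[-1,-2,-1],[-2,-4,-2],[-1,-2,-1]]), (4,1,2,[[-4,-7,-3],[-4,-7,-3]]),
   (4,2,2,[[-3,-5,-2]])]"

definition field_zeta3 :: wpoly where "field_zeta3 =
  [(0,1,0,[[-2,-12,-8],[-30,-72,-40],[-53,-108,-56],[-24,-48,-24],[1]]),
   (0,2,0,[[-4,-12,-8],[-30,-66,-36],[-69,-137,-68],[-42,-81,-39],[1,2,1]]),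
   (0,3,0,[[-2],[],[3,7,5],[1,7,5]]), (1,1,0,[[-3,-18,-12],[-49,-54,7],[-111,-68,55],[-62,-32,36],[3]]),
   (1,2,0,[[-4,-12,-8],[5,-15,-21],[-18,-17,6],[-47,-31,21],[2,4,2]]),
   (1,3,0,[[-1],[5,-5,-18],[11,2,-13],[2,14,10]]),
   (2,1,0,[[-1,-6,-4],[-12,-30,-20],[-52,-8,44],[-38,16,60],[3]]),
   (2,2,0,[[-1,-2,-1],[0,-14,-35],[31,10,-41],[9,25,15],[1,2,1]]), (2,3,1,[[4,6,-11],[14,16,-9],[1,7,5]]),
   (3,1,1,[[-1,-6,-4],[-2,-6,-4],[],[1]]), (3,2,1,[[-1,-4,-3],[4,11,7],[6,15,10]]), (3,3,2,[[5,15,10]])]"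

lemma cert_zeta: "cooper_cert 1 9 3 (-27) 0 (w :: 'a::idom) x y z (1, 1, 1) poly_zeta field_zeta1 field_zeta2 field_zeta3"
  unfolding poly_zeta_def field_zeta1_def field_zeta2_def field_zeta3_def cert_unfold
  by (simp only: cert_eval) Groebner_Basis.algebra

definition factors_zeta :: "(poly \<times> expo list) list" where "factors_zeta =
  [([(1, 1, 0, 0), (1, 0, 1, 0), (1, 0, 0, 0)], [(0, 0, 1)]),
   ([(1, 0, 0, 0), (1, 0, 0, 1), (1, 1, 0, 1)], [(0, 1, 0)]),
   ([(1, 0, 1, 0), (1, 0, 0, 1), (1, 0, 0, 0)], [(1, 0, 0)])]"

lemma factor_zeta: "peval x y z poly_zeta = (\<Prod>(P, es)\<leftarrow>factors_zeta. peval x y (z :: 'a::idom) P)"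
  unfolding poly_zeta_def factors_zeta_def cert_unfold prod_list.Cons prod_list.Nil
  by (simp only: cert_eval) Groebner_Basis.algebra

lemma supercongruence_zeta:
  assumes "cooper_sequence 9 3 (-27) 0 A" "prime p" "odd p" "r \<ge> 1"
  shows "[A (p ^ r * n) = A (p ^ (r - 1) * n)] (mod int p ^ (2 * r))"
  by (rule cooper_supercongruence[OF assms cert_zeta factor_zeta])
    (simp_all add: poly_zeta_def factors_zeta_def sparse_simps)

text \<open>The cyclic product (1 - x) (x - y) (y - z) (z - 1). At the constant term the four
  factors share one binomial index, which gives sums of fourth powers of binomial
  coefficients.\<close>

definition poly_s10 :: poly where "poly_s10 = [(-1, 0, 1, 1), (1, 0, 1, 2), (1, 0, 2, 0), (-1, 0, 2, 1), (1, 1, 0, 1),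
   (-1, 1, 0, 2), (-1, 1, 1, 0), (2, 1, 1, 1), (-1, 1, 1, 2), (-1, 1, 2, 0),
   (1, 1, 2, 1), (-1, 2, 0, 1), (1, 2, 0, 2), (1, 2, 1, 0), (-1, 2, 1, 1)]"

definition field_s101 :: wpoly where "field_s101 =
  [(0,2,2,[[-1,-2,-1],[1,0,-13]]), (0,3,1,[[1,4,3],[-1,-5,-10]]), (1,1,2,[[1,6,17],[-1,-7,-15]]),
   (1,2,1,[[-1,-2,4],[2,10,26],[-1,1,18]]), (1,3,2,[[-1,0,8]]), (2,1,2,[[-2,-11,-27],[2,11,18]]),
   (2,2,1,[[2,3,-7],[],[-1,-4,-10]]), (2,3,1,[[-2,-10,-9],[3,10,9]]), (3,2,2,[[-2,-10,-26],[1,3,5]]),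
   (3,3,1,[[1,6,6],[-1,-5,-7]]), (4,1,2,[[1,5,10],[-1,-4,-3]]), (4,2,1,[[-1,-1,3],[1,2,1]])]"

definition field_s102 :: wpoly where "field_s102 =
  [(0,2,2,[[2,16,14],[-1,-11,-10]]), (0,3,3,[[-1,-3,-2]]), (0,4,1,[[-1,-4,-3],[1,2,1]]),
   (1,1,2,[[-1,-10,3],[0,0,-21]]), (1,2,1,[[-1,-1,5],[-2,-10,8],[6,25,10]]), (1,3,2,[[-4,-14,-13],[2,6,4]]),
   (1,4,1,[[2,8,6],[-2,-4,-2]]), (2,0,2,[[-1,-2,-1],[1,4,3]]), (2,1,1,[[1,3,2],[-1,0,-21],[-2,-2,34]]),
   (2,2,1,[[5,13],[],[-4,-14,-17]]), (2,3,1,[[0,-6,-7],[2,9,11],[-1,-3,-2]]), (2,4,1,[[-1,-4,-3],[1,2,1]]),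
   (3,0,2,[[2,4,2],[-2,-8,-6]]), (3,1,1,[[-2,-6,-4],[3,14,21]]), (3,2,1,[[-5,-15,-10],[2,0,-16],[1,2,4]]),
   (3,3,1,[[1,9,12],[0,0,-3]]), (4,0,2,[[-1,-2,-1],[1,4,3]]), (4,1,1,[[1,3,2]]), (4,2,2,[[-1,-5,-4]])]"

definition field_s103 :: wpoly where "field_s103 =
  [(0,2,2,[[3,18,15],[-4,-20,-16],[1,2,1]]), (0,3,2,[[2,5,3],[-2,-5,-3]]), (0,4,0,[[-1,-2,-1],[],[1,2,1]]),
   (1,1,2,[[2,4,14],[0,0,-12],[-2,-4,-2]]), (1,2,1,[[-6,-19,-8],[0,-2,3],[8,25,7],[-2,-4,-2]]),
   (1,3,0,[[2,4,2],[-4,-12,-6],[-2,-2,-2],[4,10,6]]), (1,4,0,[[2,4,2],[],[-2,-4,-2]]),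
   (2,0,2,[[-1,-2,-1],[],[1,2,1]]), (2,1,1,[[2,5,3],[-1,0,-17],[-5,-13,10],[4,8,4]]),
   (2,2,0,[[-1,-2,-1],[10,25,3],[-1,-8,9],[-9,-17,-12],[1,2,1]]),
   (2,3,0,[[-4,-8,-4],[4,13,8],[2,0,-1],[-2,-5,-3]]), (2,4,0,[[-1,-2,-1],[],[1,2,1]]),
   (3,0,2,[[2,4,2],[],[-2,-4,-2]]), (3,1,1,[[-4,-10,-6],[2,2,2],[4,12,6],[-2,-4,-2]]),
   (3,2,0,[[2,4,2],[-8,-15,1],[1,1,-11],[5,10,8]]), (3,3,0,[[2,4,2],[0,0,3],[-2,-4,-5]]),
   (4,0,2,[[-1,-2,-1],[],[1,2,1]]), (4,1,1,[[2,5,3],[-2,-5,-3]]), (4,2,0,[[-1,-2,-1],[3,9,6],[-2,-7,-5]])]"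

lemma cert_s10: "cooper_cert 1 6 2 (-64) 4 (w :: 'a::idom) x y z (1, 1, 1) poly_s10 field_s101 field_s102 field_s103"
  unfolding poly_s10_def field_s101_def field_s102_def field_s103_def cert_unfold
  by (simp only: cert_eval) Groebner_Basis.algebra

definition factors_s10 :: "(poly \<times> expo list) list" where "factors_s10 =
  [([(-1, 0, 1, 0), (1, 0, 0, 1)], [(0, 0, 0), (1, 0, 0)]),
   ([(1, 1, 0, 0), (-1, 0, 1, 0)], [(0, 0, 0), (0, 0, 1)]),
   ([(1, 0, 0, 0), (-1, 1, 0, 0)], [(0, 0, 1), (0, 1, 0)]),
   ([(1, 0, 0, 0), (-1, 0, 0, 1)], [(0, 1, 0), (1, 0, 0)])]"

lemma factor_s10: "peval x y z poly_s10 = (\<Prod>(P, es)\<leftarrow>factors_s10. peval x y (z :: 'a::idom) P)"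
  unfolding poly_s10_def factors_s10_def cert_unfold prod_list.Cons prod_list.Nil
  by (simp only: cert_eval) Groebner_Basis.algebra

lemma supercongruence_s10:
  assumes "cooper_sequence 6 2 (-64) 4 A" "prime p" "odd p" "r \<ge> 1"
  shows "[A (p ^ r * n) = A (p ^ (r - 1) * n)] (mod int p ^ (2 * r))"
  by (rule cooper_supercongruence[OF assms cert_s10 factor_s10])
    (simp_all add: poly_s10_def factors_s10_def sparse_simps)

text \<open>The product for s10 with the factor 1 - z replaced by 1 - x + y - z.\<close>

definition poly_s7 :: poly where "poly_s7 = [(-1, 0, 1, 1), (1, 0, 1, 2), (1, 0, 2, 0), (-2, 0, 2, 1), (1, 0, 3, 0),
   (1, 1, 0, 1), (-1, 1, 0, 2), (-1, 1, 1, 0), (4, 1, 1, 1), (-1, 1, 1, 2),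
   (-3, 1, 2, 0), (2, 1, 2, 1), (-1, 1, 3, 0), (-2, 2, 0, 1), (1, 2, 0, 2),
   (2, 2, 1, 0), (-3, 2, 1, 1), (2, 2, 2, 0), (1, 3, 0, 1), (-1, 3, 1, 0)]"

definition field_s71 :: wpoly where "field_s71 =
  [(0,2,2,[[-1,-2,-1],[1]]), (0,3,1,[[1],[-2]]), (0,4,1,[[1]]), (1,1,2,[[1,10,7],[-1]]),
   (1,2,1,[[-1,-12,-19],[2,12,24],[17,17,9]]), (1,3,1,[[-9],[-7,-19,-20],[6]]), (1,4,2,[[-6]]),
   (2,1,2,[[-8,-32,-33],[1],[-3]]), (2,2,1,[[8,12,19],[-5,23,18],[-21,-50,-43]]),
   (2,3,1,[[10],[-1,53,75],[-6]]), (2,4,1,[[-4],[6]]), (3,1,2,[[10,22,26],[],[3]]),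
   (3,2,1,[[-10],[17,-67,-96],[3,33,34]]), (3,3,1,[[4],[10,-34,-55]]), (3,4,1,[[3]]), (4,2,2,[[-13,34,55]]),
   (4,3,1,[[-6]]), (5,1,2,[[-3]]), (5,2,1,[[3]])]"

definition field_s72 :: wpoly where "field_s72 =
  [(0,2,2,[[6,10,4],[-10,-16,-8]]), (0,3,1,[[2],[10,22,12],[-2,-12,-8]]), (0,4,2,[[4,12,8]]), (0,5,1,[[-2]]),
   (1,1,2,[[-5,0,3],[9,9,3]]), (1,2,1,[[-3,-12,-19],[-30,-33,-12],[40,44,16],[-3]]),
   (1,3,1,[[-11,-12,-19],[-40,-49,-17],[10,24,16]]), (1,4,2,[[-11,-24,-16]]), (1,5,1,[[4]]),
   (2,0,2,[[-1,-2,-1],[1,7,5]]), (2,1,1,[[1],[8,-17,-13],[-17,6,16]]),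
   (2,2,1,[[15,24,38],[27,27,-18],[29,-45,-64]]), (2,3,1,[[8],[2,77,77],[-2,-12,-8]]),
   (2,4,1,[[-22],[4,12,8]]), (2,5,1,[[-2]]), (3,0,2,[[4,8,4],[-3,-21,-15]]),
   (3,1,1,[[-4],[13,48,57],[-57,-50,-10],[3]]), (3,2,1,[[-12],[53,-20,-61],[-34,-17,11]]),
   (3,3,1,[[22],[25,-33,-57]]), (3,4,1,[[6]]), (4,0,2,[[-6,-12,-6],[3,21,15]]),
   (4,1,1,[[6],[-38,-55,-25],[34,69,36]]), (4,2,2,[[-38,-6,34]]), (4,3,1,[[-5]]),
   (5,0,2,[[4,8,4],[-1,-7,-5]]), (5,1,1,[[-4],[10,29,16]]), (6,0,2,[[-1,-2,-1]]), (6,1,1,[[1]])]"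

definition field_s73 :: wpoly where "field_s73 =
  [(0,2,2,[[3,5,2],[-4,-7,-3],[1,2,1]]), (0,3,1,[[6,7,3],[-10,-4],[2,-6,-6]]),
   (0,4,0,[[-1,-2,-1],[16,21,9],[-8,-8]]), (0,5,0,[[-2,-4,-2],[6,14,6]]), (0,6,0,[[-1,-2,-1]]),
   (1,1,2,[[-11,-21,-12],[13,25,14],[-2,-4,-2]]), (1,2,1,[[1,5,-6],[-28,-41,-8],[22,31,12],[-2,-4,-2]]),
   (1,3,0,[[2,4,2],[-25,-36,-42],[25,4,-6],[-4,12,12]]), (1,4,0,[[8,16,8],[-53,-52,-13],[16,16]]),
   (1,5,0,[[8,16,8],[-12,-28,-12]]), (1,6,0,[[2,4,2]]), (2,0,2,[[-4,-7,-3],[3,5,2],[1,2,1]]),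
   (2,1,1,[[5,7,3],[14,5,-7],[-19,-17,3],[4,8,4]]),
   (2,2,0,[[-1,-2,-1],[17,24,45],[-34,21,13],[16,-45,-57],[1,2,1]]),
   (2,3,0,[[-10,-20,-10],[89,65],[-34,9,51],[2,-6,-6]]), (2,4,0,[[-19,-38,-19],[33,80,25],[-8,-8]]),
   (2,5,0,[[-10,-20,-10],[6,14,6]]), (2,6,0,[[-1,-2,-1]]), (3,0,2,[[16,28,12],[-9,-15,-6],[-2,-4,-2]]),
   (3,1,1,[[-20,-28,-12],[75,75,41],[-43,-13,9],[-2,-4,-2]]),
   (3,2,0,[[4,8,4],[-86,-69,-11],[125,15,-70],[-18,5,23]]),
   (3,3,0,[[18,36,18],[-80,-104,-26],[43,-10,-50]]), (3,4,0,[[18,36,18],[-27,-49,-21]]), (3,5,0,[[4,8,4]]),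
   (4,0,2,[[-24,-42,-18],[9,15,6],[1,2,1]]), (4,1,1,[[30,42,18],[-107,-101,-27],[17,39,19]]),
   (4,2,0,[[-6,-12,-6],[77,80,25],[-58,-29,29]]), (4,3,0,[[-14,-28,-14],[37,63,27]]), (4,4,0,[[-6,-12,-6]]),
   (5,0,2,[[16,28,12],[-3,-5,-2]]), (5,1,1,[[-20,-28,-12],[29,54,24]]), (5,2,0,[[4,8,4],[-21,-35,-15]]),
   (5,3,0,[[4,8,4]]), (6,0,2,[[-4,-7,-3]]), (6,1,1,[[5,7,3]]), (6,2,0,[[-1,-2,-1]])]"

lemma cert_s7: "cooper_cert 1 13 4 (-27) 3 (w :: 'a::idom) x y z (1, 1, 1) poly_s7 field_s71 field_s72 field_s73"
  unfolding poly_s7_def field_s71_def field_s72_def field_s73_def cert_unfold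
  by (simp only: cert_eval) Groebner_Basis.algebra

definition factors_s7 :: "(poly \<times> expo list) list" where "factors_s7 =
  [([(-1, 0, 1, 0), (1, 0, 0, 1)], [(0, 0, 0), (1, 0, 0)]),
   ([(1, 1, 0, 0), (-1, 0, 1, 0)], [(0, 0, 0), (0, 0, 1)]),
   ([(1, 0, 0, 0), (-1, 1, 0, 0)], [(0, 0, 1), (0, 1, 0)]),
   ([(1, 0, 0, 0), (-1, 1, 0, 0), (1, 0, 1, 0), (-1, 0, 0, 1)], [])]"

lemma factor_s7: "peval x y z poly_s7 = (\<Prod>(P, es)\<leftarrow>factors_s7. peval x y (z :: 'a::idom) P)"
  unfolding poly_s7_def factors_s7_def cert_unfold prod_list.Cons prod_list.Nil
  by (simp only: cert_eval) Groebner_Basis.algebra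

lemma supercongruence_s7:
  assumes "cooper_sequence 13 4 (-27) 3 A" "prime p" "odd p" "r \<ge> 1"
  shows "[A (p ^ r * n) = A (p ^ (r - 1) * n)] (mod int p ^ (2 * r))"
  by (rule cooper_supercongruence[OF assms cert_s7 factor_s7])
    (simp_all add: poly_s7_def factors_s7_def sparse_simps)

text \<open>((x - y)^2 - z^2) ((1 - z)^2 - y^2), which differences of squares split into trinomials
  with coefficients 1 and -1.\<close>

definition poly_eps :: poly where "poly_eps = [(-1, 0, 0, 2), (2, 0, 0, 3), (-1, 0, 0, 4), (1, 0, 2, 0), (-2, 0, 2, 1),
   (2, 0, 2, 2), (-1, 0, 4, 0), (-2, 1, 1, 0), (4, 1, 1, 1), (-2, 1, 1, 2),
   (2, 1, 3, 0), (1, 2, 0, 0), (-2, 2, 0, 1), (1, 2, 0, 2), (-1, 2, 2, 0)]"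

definition field_eps1 :: wpoly where "field_eps1 =
  [(0,0,4,[[-1,-2,-1],[4,8,4],[-6,-12,-6],[4,8,4],[-1,-2,-1]]),
   (0,2,2,[[2,4,2],[-8,-16,-4],[14,28,14],[-12,-24,-12],[4,8,4]]),
   (0,4,0,[[-1,-2,-1],[4,8],[-10,-20,-10],[12,24,12],[-6,-12,-6]]), (0,6,0,[[2,4,2],[-4,-8,-4],[4,8,4]]),
   (0,8,0,[[-1,-2,-1]]), (1,1,2,[[-4,-22,-12],[8,36,-8],[],[-8,-24,34]]),
   (1,3,0,[[4,8,4],[-16,-32,-4],[16,66,-40],[0,-36,-46]]), (1,5,1,[[8,24,12]]),
   (2,0,2,[[0,18,18],[0,-28,-28],[],[0,12,12],[0,-2,-2]]),
   (2,2,0,[[-4,-8,-4],[16,40,20],[-8,-54,62],[-16,-8,-36],[4,-6,34]]),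
   (2,4,0,[[-8,-16,-8],[0,-16,-16],[-8,-36,-36]]), (2,6,0,[[4,8,4]]),
   (3,1,1,[[0,-8,-12],[-8,-4,-4],[16,28,6],[-4,-6,-4]]), (3,3,0,[[8,16,8],[-8,-8,4],[8,32,16]]),
   (3,5,0,[[-4,-8,-4]]), (4,0,0,[[1,2,1],[-4,-8,-4],[6,12,6],[-4,-8,-4],[1,2,1]]),
   (4,2,0,[[-2,-4,-2],[4,8,4],[-2,-4,-2]]), (4,4,0,[[1,2,1]])]"

definition field_eps2 :: wpoly where "field_eps2 =
  [(0,2,2,[[0,-4,-4],[0,8,8]]), (1,1,2,[[0,0,6],[0,4,8]]),
   (1,3,1,[[0,4,4],[0,-16,-30],[0,16,-20],[0,-16,-16]]), (1,5,2,[[0,16,16]]),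
   (2,0,2,[[0,4,4],[0,-8,-52],[0,4,44],[0,0,4]]), (2,2,1,[[0,0,8],[0,16,32],[0,-32,-72],[0,8,52]]),
   (2,4,1,[[0,0,-8],[0,-24,-32]]), (3,1,1,[[0,-4,-12],[0,0,8],[0,8,20],[0,0,-2]]), (3,3,1,[[0,0,8],[0,8]])]"

definition field_eps3 :: wpoly where "field_eps3 =
  [(0,2,2,[[0,-4,-4],[0,4,4]]), (0,4,1,[[0,4,4]]), (1,1,2,[[-2,-8],[0,4],[8,16,-12],[-8,-16,10],[2,4,2]]),
   (1,3,0,[[2,4,2],[0,4,12],[-4,-16,-6],[8,32,-30],[-2,-16,-14]]), (1,5,0,[[-4,-16,-12],[],[-2,4,6]]),
   (1,7,0,[[2,8,6]]), (2,0,2,[[0,18,18],[0,-28,-28],[],[0,12,12],[0,-2,-2]]),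
   (2,2,0,[[-4,-12,-8],[8,20,-4],[0,-22,70],[-8,-8,-72],[4,-2,38]]),
   (2,4,0,[[8,24,16],[-8,-16,-16],[0,0,-8]]), (2,6,0,[[-4,-12,-8]]),
   (3,1,0,[[2,8,6],[-8,-28,-12],[8,24,-12],[0,0,22],[-2,-4,-4]]), (3,3,0,[[-4,-8,-4],[8,16,16],[0,8]]),
   (3,5,0,[[2,4,2]])]"

lemma cert_eps: "cooper_cert 1 12 4 16 0 (w :: 'a::idom) x y z (1, 1, 1) poly_eps field_eps1 field_eps2 field_eps3"
  unfolding poly_eps_def field_eps1_def field_eps2_def field_eps3_def cert_unfold
  by (simp only: cert_eval) Groebner_Basis.algebra

definition factors_eps :: "(poly \<times> expo list) list" where "factors_eps =
  [([(1, 1, 0, 0), (-1, 0, 1, 0), (-1, 0, 0, 1)], [(0, 0, 0)]),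
   ([(1, 1, 0, 0), (-1, 0, 1, 0), (1, 0, 0, 1)], [(0, 0, 0)]),
   ([(1, 0, 0, 0), (-1, 0, 1, 0), (-1, 0, 0, 1)], [(1, 0, 0)]),
   ([(1, 0, 0, 0), (1, 0, 1, 0), (-1, 0, 0, 1)], [(1, 0, 0)])]"

lemma factor_eps: "peval x y z poly_eps = (\<Prod>(P, es)\<leftarrow>factors_eps. peval x y (z :: 'a::idom) P)"
  unfolding poly_eps_def factors_eps_def cert_unfold prod_list.Cons prod_list.Nil
  by (simp only: cert_eval) Groebner_Basis.algebra

lemma supercongruence_eps:
  assumes "cooper_sequence 12 4 16 0 A" "prime p" "odd p" "r \<ge> 1"
  shows "[A (p ^ r * n) = A (p ^ (r - 1) * n)] (mod int p ^ (2 * r))"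
  by (rule cooper_supercongruence[OF assms cert_eps factor_eps])
    (simp_all add: poly_eps_def factors_eps_def sparse_simps)

text \<open>A product of three five-term factors permuted by the cyclic exchange of x, y, z
  (\<open>factor_eta\<close>). They are too long to be \<open>sparse\<close>;
  \<open>carry_five\<close> takes the place of the simplex condition.\<close>

definition poly_eta :: poly where "poly_eta = [(-1, 0, 0, 0), (-1, 0, 0, 1), (-1, 0, 1, 0), (1, 0, 2, 3), (1, 0, 3, 2),
   (-1, 0, 3, 3), (-1, 1, 0, 0), (5, 1, 1, 1), (-2, 1, 1, 3), (-1, 1, 2, 2),
   (1, 1, 2, 3), (-2, 1, 3, 1), (1, 1, 3, 2), (1, 2, 0, 3), (-1, 2, 1, 2),
   (1, 2, 1, 3), (-1, 2, 2, 1), (-2, 2, 2, 2), (1, 2, 3, 0), (1, 2, 3, 1),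
   (1, 3, 0, 2), (-1, 3, 0, 3), (-2, 3, 1, 1), (1, 3, 1, 2), (1, 3, 2, 0),
   (1, 3, 2, 1), (-1, 3, 3, 0)]"

definition field_eta1 :: wpoly where "field_eta1 =
  [(0,0,0,[[-16,-32,-16],[-32,-64,82],[-16,-161,-145]]), (0,1,0,[[-32,-64,-32],[-32,-64,82],[0,0,129]]),
   (0,2,0,[[-16,-32,-16],[0,0,129],[0,129,-129],[32,-65,176],[32,193,-97]]),
   (0,3,2,[[32,64,275],[32,193,-241],[-32,-193,226]]), (0,4,2,[[32,64,260],[-32,-64,-2]]),
   (0,4,6,[[-16,-32,-16]]), (0,5,5,[[-32,-64,-32],[32,64,32]]),
   (0,6,4,[[-16,-32,-16],[32,64,32],[-16,-32,-16]]), (1,0,1,[[0,50,164],[0,279,279],[0,100,100]]),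
   (1,1,0,[[-16,-16,-4],[64,134,-78],[64,472,-172],[0,51,191],[16,-266,-24]]),
   (1,2,0,[[-16,60,68],[80,154,10],[-14,-372,130],[-126,-287,-74],[-96,-239,249],[-56,4,166]]),
   (1,3,0,[[0,4],[-64,-144,-681],[-64,37,190],[-98,-426,740],[-56,204,-400],[128,240,16],[0,80,64]]),
   (1,4,1,[[-80,-208,-568],[32,40,114],[-144,136,-216],[80,88,96],[0,0,-48],[0,0,32]]),
   (1,5,2,[[0,-4,-8],[0,-36,-72],[80,160,144],[0,0,-24],[0,0,16]]), (1,6,3,[[80,144,64],[-80,-144,-64]]),
   (2,0,0,[[16,32,16],[0,50,50],[0,308,308],[0,-42,-384],[0,137,137]]),
   (2,1,0,[[-16,16,30],[-80,-60,-330],[16,-512,-759],[112,-552,231],[0,217,-304],[0,-72,-166]]),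
   (2,2,0,[[-16,56,56],[48,-358,-716],[146,-186,40],[40,773,-1149],[-280,-372,16],[-88,-372,-392],[80,24,-40]]),
   (2,3,0,[[-16,108,450],[-16,-430,-61],[106,245,-1549],[30,117,619],[208,136,-446],[8,-188,-234],[-80,-216,-216]]),
   (2,4,0,[[0,88,308],[0,96,216],[288,116,48],[96,-160,-1034],[0,-92,336],[-112,-20,-88],[16,-64,-64]]),
   (2,5,1,[[0,8,16],[0,72,144],[-16,-48,-84],[-16,-80,-44],[32,60,-16]]),
   (2,6,2,[[-96,-168,-72],[16,16],[16,40,24]]), (3,0,2,[[8,-138,-374],[-32,177,209],[-8,-145,-137]]),
   (3,1,0,[[0,0,2],[-16,48,-92],[48,-185,-284],[-32,72,368],[80,16,418],[16,200,376],[-80,-96,-16]]),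
   (3,2,0,[[8,-50,162],[48,-250,-77],[118,750,-868],[-60,-370,-783],[56,632,360],[280,672,532],[-24,56,128]]),
   (3,3,0,[[-32,90,224],[-32,62,1015],[-142,-639,463],[-374,-359,642],[64,-248,12],[96,72,222],[24,152,136]]),
   (3,4,0,[[-8,-100,-328],[80,56,156],[-48,260,838],[-56,-40,30],[-64,-56,116],[-24,16,44]]),
   (3,5,0,[[0,-4,-8],[0,-36,-72],[-56,-88,-88],[-56,-40,32],[-24,-64,-28]]),
   (3,6,1,[[16,32,16],[56,104,48],[24,40,16]]), (4,0,2,[[-24,-48,-252],[24,-106,212]]), (4,0,6,[[16,24,8]]),
   (4,1,1,[[48,96,48],[-8,140,148],[8,224,-232],[-24,16,-10],[-112,-256,-234],[96,136,40]]),
   (4,2,0,[[-24,-48,204],[-56,68,424],[-64,-608,688],[58,-163,796],[40,-28,-474],[-184,-340,-190],[-8,-32,-56]]),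
   (4,3,0,[[40,-38,-424],[40,304,-732],[22,315,-234],[176,400,-18],[-56,72,6],[-64,-164,-56]]),
   (4,4,0,[[0,0,12],[-40,-56,104],[-88,-116,-246],[128,68,-44],[144,240,56]]),
   (4,5,1,[[0,0,36],[-16,-32,-36],[-64,-84,-24]]), (4,6,0,[[16,24,8],[],[-8,-24,-16]]),
   (5,0,5,[[24,40,16],[-24,-40,-16]]), (5,1,2,[[0,0,-2],[0,0,2],[-72,-120,-56],[72,120,64],[-24,-40,-24]]),
   (5,2,3,[[48,80,48],[-72,-120,-48],[72,120,44]]),
   (5,3,0,[[0,0,2],[0,0,2],[48,80,32],[48,80,24],[-48,-80,-44]]),
   (5,4,0,[[0,0,-4],[-72,-120,-64],[-72,-120,-64],[-48,-80,-28]]),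
   (5,5,0,[[24,40,24],[72,120,56],[72,120,68]]), (5,6,0,[[-24,-40,-16],[-24,-40,-16]]),
   (6,0,4,[[8,16,8],[-16,-32,-16],[8,16,8]]), (6,1,3,[[-32,-64,-32],[48,96,48],[-16,-32,-16]]),
   (6,2,2,[[48,96,48],[-32,-64,-32],[-8,-16,-8]]), (6,3,1,[[-32,-64,-32],[-32,-64,-32],[32,64,32]]),
   (6,4,0,[[8,16,8],[48,96,48],[-8,-16,-8]]), (6,5,0,[[-16,-32,-16],[-16,-32,-16]]), (6,6,0,[[8,16,8]])]"

definition field_eta2 :: wpoly where "field_eta2 =
  [(0,0,1,[[0,0,-114],[0,129,129]]), (0,1,1,[[0,0,-114],[0,-129,-129]]),
   (0,2,2,[[0,-258,-258],[0,0,342],[0,-129,-129]]), (0,3,2,[[0,129,357],[0,-258,-258],[0,129,129]]),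
   (0,4,2,[[0,0,228],[0,129,-213]]), (1,0,0,[[-16,-64,-48],[-16,-64,-212],[0,-100,-179],[0,-100,-100]]),
   (1,1,0,[[0,0,4],[16,4,-201],[0,-468,88],[-16,-223,-367],[-16,202,-72]]),
   (1,2,0,[[16,64,56],[0,4,147],[48,348,-340],[32,624,-632],[-16,-73,736],[0,128,234]]),
   (1,3,0,[[0,0,4],[16,72,193],[56,403,-40],[-72,-31,517],[0,-40,-750],[0,-152,-322],[16,48,16]]),
   (1,4,1,[[16,40],[-24,-185,174],[0,-240,278],[0,24,116]]),
   (1,5,2,[[0,0,-4],[0,0,-36],[-32,-88,-8],[40,136,72],[-16,-48,-16]]),
   (1,6,3,[[-16,-24,-16],[24,56,40],[-8,-32,-24]]),
   (2,0,0,[[-16,-32,-16],[0,0,-104],[0,-179,179],[0,251,-38],[0,-57,185]]),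
   (2,1,0,[[0,78,74],[64,-48,55],[58,13,-327],[10,128,865],[-80,-329,-501],[-56,-196,-234]]),
   (2,2,0,[[0,74,78],[-48,-26,980],[-70,392,-322],[-88,-632,542],[-24,332,168],[56,220,216],[-16,-40,-8]]),
   (2,3,0,[[16,-64,-292],[0,126,-110],[-138,-440,578],[-76,78,-683],[312,424,428],[32,-24,-84],[-32,-80,-80]]),
   (2,4,0,[[0,-84,-304],[16,120,-315],[-96,58,54],[18,285,248],[96,-64,18],[-104,-168,-190],[16,-56,-56]]),
   (2,5,2,[[0,4,-4],[48,76,36],[-72,-132,-52],[24,156,116]]),
   (2,6,2,[[32,100,60],[-32,-64,-32],[8,-20,-20]]), (3,0,2,[[0,72,-196],[16,-39,214],[0,57,-330]]),
   (3,1,0,[[0,0,-2],[0,-170,444],[0,-7,-670],[102,183,-501],[40,-140,616],[0,0,106]]),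
   (3,2,0,[[0,98,-240],[0,104,386],[-46,324,755],[-122,-99,-127],[-128,280,-384],[136,228,72],[32,80,104]]),
   (3,3,0,[[0,0,-110],[0,-318,-506],[154,451,-271],[114,-23,378],[-152,-416,-24],[-64,-144,30],[16,160,152]]),
   (3,4,0,[[0,0,346],[0,122,-276],[38,-185,-386],[0,0,36],[0,0,-34],[-24,-136,-144]]),
   (3,5,0,[[0,0,4],[0,-8,44],[0,128,120],[24,128,48],[0,-96,-60]]),
   (3,6,1,[[-16,-80,-48],[-8,-96,-76],[8,56,44]]), (4,0,2,[[16,16,-228],[-16,-16,-80]]),
   (4,0,6,[[0,-8,-8]]),
   (4,1,1,[[-32,-48,440],[48,236,532],[-64,-360,1112],[0,-48,-160],[0,0,20],[0,0,-32]]),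
   (4,2,0,[[16,32,-212],[16,0,-664],[48,188,-1832],[16,184,-454],[0,240,112],[16,40,88],[-16,-56,-72]]),
   (4,3,0,[[-16,-40,212],[0,40,720],[-128,-712,618],[0,-260,-378],[-8,52],[8,12,36]]),
   (4,4,2,[[32,340,398],[0,-16,-52],[24,92,68]]),
   (4,5,0,[[0,4,-4],[-16,-116,-148],[8,-132,-76],[-8,-12,-36]]), (4,6,0,[[0,4,4],[16,104,72],[-8,-4,4]]),
   (5,0,5,[[0,0,-8],[0,0,8]]), (5,1,2,[[0,0,-6],[0,0,12],[0,0,16],[],[0,0,-8]]),
   (5,2,1,[[0,0,8],[0,0,6],[0,0,-40],[0,0,-36],[0,0,16]]),
   (5,3,0,[[0,0,-2],[0,0,-24],[0,0,32],[0,0,24],[0,0,12]]), (5,4,0,[[0,0,6]]), (5,4,3,[[0,0,-12]]),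
   (5,5,1,[[0,0,8],[0,0,-4]]), (5,6,0,[[0,0,-4],[0,0,-4]])]"

definition field_eta3 :: wpoly where "field_eta3 =
  [(0,1,1,[[0,0,-114],[0,129,129]]), (0,2,1,[[0,-129,-129],[],[0,129,-99]]),
   (0,3,2,[[0,-129,-471],[0,0,228]]), (0,4,2,[[0,0,-228],[0,0,228]]),
   (1,0,1,[[0,0,114],[0,-229,-229],[0,-100,-100]]),
   (1,1,0,[[0,-16,-96],[0,24,21],[0,-60,89],[16,80,52],[16,80,80]]),
   (1,2,0,[[0,16,-72],[16,43,-319],[-16,-87,122],[-16,-435,220],[0,148,-319],[0,72,-34]]),
   (1,3,1,[[0,73,585],[-16,88,-304],[32,-41,-445],[0,0,261],[0,0,286],[-16,-72,-24]]),
   (1,4,1,[[0,-16,472],[0,-64,-26],[0,96,-412],[],[-16,-96,-160],[16,88,96]]),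
   (2,0,1,[[0,104,104],[0,-25,-25],[0,-29,199]]),
   (2,1,0,[[0,0,-76],[16,-76,-27],[-16,115,613],[-16,799,476],[0,-360,-223],[0,-128,-34]]),
   (2,2,0,[[0,72,-72],[-32,-67,-157],[-48,-126,174],[16,-128,112],[-64,-208,288],[],[32,96,64]]),
   (2,3,0,[[0,40,-82],[32,-174,-98],[24,-54,381],[-72,-194,963],[-8,276,-858],[16,112,68],[-16,-56,-8]]),
   (2,4,0,[[0,-16,-244],[32,68,-202],[-16,100,392],[0,-196,-922],[32,-80,318],[0,56,-4],[0,8,8]]),
   (2,5,3,[[0,0,32],[],[0,0,-40]]), (3,0,2,[[0,154,496],[0,0,-228]]),
   (3,1,0,[[0,0,2],[0,-194,-652],[-16,-15,474],[32,-183,-729],[0,28,-35],[0,56,-218],[-16,-24,-40]]),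
   (3,2,0,[[0,40,148],[32,81,-648],[24,440,21],[-72,66,1235],[-8,-420,-104],[16,-144,-196],[-16,-40,-112]]),
   (3,3,0,[[0,-8,222],[0,-11,488],[144,240,-1274],[144,260,-750],[-32,28,386],[0,8,92],[0,-16,-16]]),
   (3,4,2,[[-112,168,922],[0,0,-6],[0,0,36],[0,0,20]]), (3,5,2,[[0,0,-36],[0,0,-24],[0,0,36]]),
   (4,0,2,[[0,0,228],[0,0,-228]]),
   (4,1,1,[[0,-16,-472],[0,0,-216],[0,-24,696],[0,24,-102],[-16,16,152],[16,8,24]]),
   (4,2,0,[[0,16,244],[32,180,916],[-16,-100,-716],[0,-180,-1218],[32,272,478],[0,104,116],[0,8,8]]),
   (4,3,0,[[0,0,-472],[],[-112,-416,1320],[0,0,-478],[0,0,-44]]),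
   (4,4,0,[[0,-8,20],[],[0,-88,-152],[16,-64,-120],[0,24,-8]]), (4,5,2,[[0,0,24]]),
   (5,1,2,[[0,0,-2],[0,0,6],[0,0,-4]]), (5,2,2,[[0,0,12],[0,0,-16],[0,0,-24],[0,0,20]]),
   (5,3,0,[[0,0,2],[0,0,-18],[0,0,16],[0,0,32],[0,0,-4]]), (5,4,2,[[0,0,-8],[0,0,-20]]),
   (5,5,0,[[0,0,4],[],[0,0,4]])]"

lemma cert_eta: "cooper_cert 16 11 5 125 0 (w :: 'a::idom) x y z (1, 1, 1) poly_eta field_eta1 field_eta2 field_eta3"
  unfolding poly_eta_def field_eta1_def field_eta2_def field_eta3_def cert_unfold
  by (simp only: cert_eval) Groebner_Basis.algebra

lemma factor_eta: "peval x y z poly_eta =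
    peval x y (z :: 'a::idom) [(1, 1, 0, 1), (1, 1, 1, 0), (-1, 0, 1, 1), (-1, 1, 0, 0), (-1, 0, 0, 0)] *
    peval x y (z :: 'a::idom) [(1, 1, 1, 0), (1, 0, 1, 1), (-1, 1, 0, 1), (-1, 0, 1, 0), (-1, 0, 0, 0)] *
    peval x y (z :: 'a::idom) [(1, 0, 1, 1), (1, 1, 0, 1), (-1, 1, 1, 0), (-1, 0, 0, 1), (-1, 0, 0, 0)]"
  unfolding poly_eta_def cert_unfold
  by (simp only: cert_eval) Groebner_Basis.algebra

lemma supercongruence_eta:
  assumes A: "cooper_sequence 11 5 125 0 A" and p: "prime p" "odd p" and r: "r \<ge> 1"
  shows "[A (p ^ r * n) = A (p ^ (r - 1) * n)] (mod int p ^ (2 * r))"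
proof (rule supercongruence_of_ct[OF _ _ r])
  show "A n = cf (lpoly poly_eta ^ n) (scale (int n) (int 1, int 1, int 1))" for n
    using cooper_eq_ct[OF A cert_eta, where ?'a = int] by (simp add: poly_eta_def)
  show "good p (lpoly poly_eta)"
    unfolding factor_eta
    by (intro good_mult good_lpoly p) (simp_all add: exps_def carry_eta[OF p(1)])
qed

section \<open>Single sums: \<open>E\<close> and \<open>s\<^sub>1\<^sub>8\<close>\<close>

lemma binomial_power_dvd:
  assumes p: "prime p" and N: "p ^ r dvd N" and k: "\<not> p ^ Suc t dvd k" "k \<le> N"
  shows "int p ^ (r - t) dvd int (N choose k)"
  using mnom_dvd[OF p, of r "[k, N - k]" k t] N k by simp

text \<open>The square of the binomial coefficient compensates for indices with few factors \<open>p\<close>.\<close>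
lemma sum_supercongruence:
  fixes f :: "nat \<Rightarrow> nat \<Rightarrow> int"
  assumes p: "prime p" "odd p" and r: "r \<ge> 1"
    and sq: "\<And>n k. k \<le> n \<Longrightarrow> (int (n choose k))\<^sup>2 dvd f n k"
    and uc: "\<And>n k t. k \<le> n \<Longrightarrow> p ^ t dvd p * n \<Longrightarrow> p ^ t dvd p * k \<Longrightarrow> ucong p (2 * t) (f (p * n) (p * k)) (f n k)"
  shows "[(\<Sum>k\<le>p ^ r * n. f (p ^ r * n) k) = (\<Sum>k\<le>p ^ (r - 1) * n. f (p ^ (r - 1) * n) k)] (mod int p ^ (2 * r))"
proof -
  define N M where "N = p ^ r * n" and "M = p ^ (r - 1) * n"
  have NM: "N = p * M" using r by (cases r) (auto simp: N_def M_def)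
  have p0: "p > 0" using p prime_gt_0_nat by blast
  have prN: "p ^ r dvd N" by (simp add: N_def)
  have fdvd: "int p ^ (2 * (r - t)) dvd f N k" if "\<not> p ^ Suc t dvd k" "k \<le> N" for k t
  proof -
    have "(int p ^ (r - t))\<^sup>2 dvd (int (N choose k))\<^sup>2"
      using binomial_power_dvd[OF p(1) prN that] by (simp add: dvd_power_same)
    then show ?thesis using sq[OF that(2)] dvd_trans by (metis power_mult mult.commute)
  qed
  have d1: "int p ^ (2 * r) dvd f N k" if k: "k \<in> {..N} - (*) p ` {..M}" for k
  proof -
    have "\<not> p dvd k"
    proof
      assume "p dvd k"
      then obtain j where "k = p * j" by blast
      then show False using k p0 by (auto simp: NM)
    qed
    then show ?thesis using fdvd[of 0 k] k by simp
  qed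
  have d2: "int p ^ (2 * r) dvd f N (p * k) - f M k" if k: "k \<le> M" for k
    unfolding NM
  \<comment> \<open>A level counts the powers of p dividing both p M and p k. Below r it can only
    end because of k, and then the square of (N choose p k) supplies the missing factors.\<close>
  proof (rule ucong_diff_dvd_levels[OF p(1), where D = "\<lambda>t. p ^ t dvd p * M \<and> p ^ t dvd p * k"])
    show "ucong p (2 * t) (f (p * M) (p * k)) (f M k)" if "p ^ t dvd p * M \<and> p ^ t dvd p * k" for t
      using uc[OF k] that by blast
    fix t assume "t < r" "\<not> (p ^ Suc t dvd p * M \<and> p ^ Suc t dvd p * k)"
    moreover from this have "p ^ Suc t dvd p * M" using prN NM by (metis Suc_leI dvd_trans le_imp_power_dvd)
    ultimately show "int p ^ (2 * (r - t)) dvd f (p * M) (p * k)"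
      using fdvd[of t "p * k"] k by (auto simp: NM)
  qed simp
  have "int p ^ (2 * r) dvd (\<Sum>k\<le>N. f N k) - (\<Sum>k\<le>M. f M k)"
    by (rule sum_diff_dvd[where \<phi> = "(*) p"]) (use d1 d2 p0 in \<open>auto simp: inj_on_def NM\<close>)
  then show ?thesis unfolding N_def M_def by (simp add: cong_iff_dvd_diff)
qed

text \<open>The super Catalan numbers S(k, m) = (2k)! (2m)! / (k! m! (k + m)!), see
  \<open>super_catalan_fact\<close>; the recursion 4 S(k, m) = S(k, m + 1) + S(k + 1, m) makes their
  integrality evident.\<close>

fun super_catalan :: "nat \<Rightarrow> nat \<Rightarrow> int" where
  "super_catalan k 0 = int (2 * k choose k)"
| "super_catalan k (Suc m) = 4 * super_catalan k m - super_catalan (Suc k) m"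

lemma fact_double_Suc: "(fact (2 * Suc k) :: int) = 2 * (int k + 1) * (2 * int k + 1) * fact (2 * k)"
  by (simp add: algebra_simps)

lemma super_catalan_fact:
  "super_catalan k m * (fact k * fact m * fact (k + m)) = fact (2 * k) * fact (2 * m)"
proof (induction m arbitrary: k)
  case 0
  then show ?case
    using arg_cong[OF binomial_fact_lemma[of k "2 * k"], of int] by (simp add: mult_ac mult_2)
next
  case (Suc m)
  let ?S = "super_catalan k m" and ?T = "super_catalan (Suc k) m"
  have 1: "?S * (fact k * fact m * fact (k + m)) = fact (2 * k) * fact (2 * m)"
    by (rule Suc.IH)
  have 2: "?T * (fact (Suc k) * fact m * fact (Suc k + m)) = fact (2 * Suc k) * fact (2 * m)"
    by (rule Suc.IH)
  have "super_catalan k (Suc m) * (fact k * fact (Suc m) * fact (k + Suc m)) * (int k + 1) =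
     4 * (int k + 1) * (int m + 1) * (int k + int m + 1) * (?S * (fact k * fact m * fact (k + m))) -
     (int m + 1) * (?T * (fact (Suc k) * fact m * fact (Suc k + m)))"
    by (simp add: algebra_simps)
  also have "\<dots> = (fact (2 * k) * fact (2 * Suc m)) * (int k + 1)"
    unfolding 1 2 fact_double_Suc by Groebner_Basis.algebra
  finally show ?case by (subst (asm) mult_cancel_right) auto
qed

section \<open>The sum for E\<close>

definition term_E :: "nat \<Rightarrow> nat \<Rightarrow> int" where
  "term_E n k = int (n choose k) * int (2 * k choose k) * int (2 * (n - k) choose (n - k))"

text \<open>Since n! = (n choose k) k! (n - k)!, the two central binomials together contain a second
  factor (n choose k), with a super Catalan number as cofactor.\<close>

lemma term_E_square:
  assumes "k \<le> n"
  shows "term_E n k = (int (n choose k))\<^sup>2 * super_catalan k (n - k)"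
proof -
  have a: "int (n choose k) * (fact k * fact (n - k)) = fact n"
    using arg_cong[OF binomial_fact_lemma[of k n], of int] assms by (simp add: mult_ac)
  have b: "int (2 * j choose j) * (fact j * fact j) = fact (2 * j)" for j
    using arg_cong[OF binomial_fact_lemma[of j "2 * j"], of int] by (simp add: mult_ac mult_2)
  have c: "super_catalan k (n - k) * (fact k * fact (n - k) * fact n) = fact (2 * k) * fact (2 * (n - k))"
    using super_catalan_fact[of k "n - k"] assms by simp
  define P where "P = (fact k * fact (n - k) :: int)"
  have P0: "P * P \<noteq> 0" by (simp add: P_def)
  have "term_E n k * (P * P) = int (n choose k) * (int (2 * k choose k) * (fact k * fact k)) *
      (int (2 * (n - k) choose (n - k)) * (fact (n - k) * fact (n - k)))"
    by (simp add: term_E_def P_def mult_ac)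
  also have "\<dots> = int (n choose k) * (super_catalan k (n - k) * (P * fact n))"
    unfolding b by (simp only: mult.assoc c[symmetric] P_def)
  also have "\<dots> = (int (n choose k))\<^sup>2 * super_catalan k (n - k) * (P * P)"
    unfolding a[symmetric] P_def by (simp add: power2_eq_square mult_ac)
  finally show ?thesis using P0 by (subst (asm) mult_cancel_right) auto
qed

lemma ucong_term_E:
  assumes p: "prime p" "odd p" and k: "k \<le> n" and t: "p ^ t dvd p * n" "p ^ t dvd p * k"
  shows "ucong p (2 * t) (term_E (p * n) (p * k)) (term_E n k)"
proof -
  have t': "p ^ t dvd p * (n - k)" using t by (simp add: right_diff_distrib' dvd_diff_nat)
  have e: "p * n - p * k = p * (n - k)" "2 * (p * j) = p * (j + j)" "2 * j = j + j" for j
    by (simp_all add: right_diff_distrib' algebra_simps)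
  have "ucong p (2 * t) (int (p * n choose (p * k))) (int (n choose k))"
    using ucong_binomial[OF p t(2) t'] k by simp
  moreover have "ucong p (2 * t) (int (2 * (p * k) choose (p * k))) (int (2 * k choose k))"
    using ucong_binomial[OF p t(2) t(2)] unfolding e(2) e(3)[of k] .
  moreover have "ucong p (2 * t) (int (2 * (p * n - p * k) choose (p * n - p * k))) (int (2 * (n - k) choose (n - k)))"
    using ucong_binomial[OF p t' t'] unfolding e(1) e(2) e(3)[of "n - k"] .
  ultimately show ?thesis unfolding term_E_def by (intro ucong_mult p)
qed

text \<open>Dividing by j! turns the summand into n! times a convolution of \<open>bc\<close> with
  itself (\<open>term_E_bc\<close>), so that k and n - k can be shifted separately.\<close>

definition bc :: "nat \<Rightarrow> real" where
  "bc j = real (2 * j choose j) / fact j"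

lemma bc_Suc: "(real j + 1)\<^sup>2 * bc (Suc j) = 2 * (2 * real j + 1) * bc j"
proof -
  have b: "real (2 * j choose j) * (fact j * fact j) = fact (2 * j)" for j
    using arg_cong[OF binomial_fact_lemma[of j "2 * j"], of real] by (simp add: mult_ac mult_2)
  have c: "bc j * (fact j * fact j * fact j) = fact (2 * j)" for j
    using b[of j] by (simp add: bc_def field_simps)
  have f: "(fact (2 * Suc j) :: real) = 2 * (real j + 1) * (2 * real j + 1) * fact (2 * j)"
    by (simp add: algebra_simps)
  have "(real j + 1) ^ 3 * bc (Suc j) * (fact j * fact j * fact j) = bc (Suc j) * (fact (Suc j) * fact (Suc j) * fact (Suc j))"
    by (simp add: power3_eq_cube algebra_simps)
  also have "\<dots> = 2 * (real j + 1) * (2 * real j + 1) * (bc j * (fact j * fact j * fact j))"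
    unfolding c f ..
  finally have "((real j + 1) * (fact j * fact j * fact j)) * ((real j + 1)\<^sup>2 * bc (Suc j)) =
      ((real j + 1) * (fact j * fact j * fact j)) * (2 * (2 * real j + 1) * bc j)"
    by (simp only: power3_eq_cube power2_eq_square mult_ac)
  then show ?thesis by (subst (asm) mult_cancel_left) (auto simp: add_eq_0_iff)
qed

lemma term_E_bc: "k \<le> n \<Longrightarrow> real_of_int (term_E n k) = fact n * bc k * bc (n - k)"
  by (simp add: term_E_def bc_def binomial_fact field_simps)

text \<open>Shifted values, 0 at negative arguments, so that the sums for n + 1, n and n - 1 share
  the range up to n + 1.\<close>

definition bc' :: "nat \<Rightarrow> real" where "bc' u = (if u = 0 then 0 else bc (u - 1))"
definition bc'' :: "nat \<Rightarrow> real" where "bc'' u = (if u \<le> 1 then 0 else bc (u - 2))"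

lemma bc'_eq: "2 * (2 * real u - 1) * bc' u = (real u)\<^sup>2 * bc u"
  using bc_Suc[of "u - 1"] by (cases u) (simp_all add: bc'_def algebra_simps)

lemma bc''_eq: "2 * (2 * real u - 3) * bc'' u = (real u - 1)\<^sup>2 * bc' u"
proof -
  consider "u = 0" | "u = 1" | j where "u = Suc (Suc j)" by (metis One_nat_def not0_implies_Suc)
  then show ?thesis
    by cases (use bc_Suc in \<open>auto simp: bc'_def bc''_def algebra_simps\<close>)
qed

lemma odd_ne_0: "2 * real u - 1 \<noteq> 0" "2 * real u - 3 \<noteq> 0"
proof -
  have "2 * int u - 1 \<noteq> 0" "2 * int u - 3 \<noteq> 0" by presburger+
  then have "real_of_int (2 * int u - 1) \<noteq> 0" "real_of_int (2 * int u - 3) \<noteq> 0"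
    by (simp_all only: of_int_eq_0_iff not_False_eq_True)
  then show "2 * real u - 1 \<noteq> 0" "2 * real u - 3 \<noteq> 0" by simp_all
qed

text \<open>\<open>d\<close> and \<open>e\<close> will be the denominators 2 u - 1 and 2 u - 3
  brought in by \<open>bc'\<close> and \<open>bc''\<close>; clearing them leaves a polynomial
  identity as premise.\<close>

lemma telescoping_combination:
  fixes c d e :: real
  assumes "d \<noteq> 0" "e \<noteq> 0" and "a2 * p2 * (4 * d * e) - a1 * p1 * (2 * e) + a0 * p0 = k * (H - G * e)"
  shows "a2 * (c * p2) - a1 * (c * (p1 / (2 * d))) + a0 * (c * (p0 / (2 * e * (2 * d)))) =
    k / 4 * (c * (2 * H / (2 * d * e)) - c * (G / d))"
proof -
  have "a2 * (c * p2) - a1 * (c * (p1 / (2 * d))) + a0 * (c * (p0 / (2 * e * (2 * d)))) =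
      c * (a2 * p2 * (4 * d * e) - a1 * p1 * (2 * e) + a0 * p0) / (4 * d * e)"
    using assms(1,2) by (simp add: field_simps)
  also have "\<dots> = k / 4 * (c * (2 * H / (2 * d * e)) - c * (G / d))"
    unfolding assms(3) using assms(1,2) by (simp add: field_simps)
  finally show ?thesis .
qed

text \<open>Zeilberger's method: \<open>q\<close> is the numerator of the rational certificate.\<close>
lemma sum_E_recurrence:
  assumes n: "n \<ge> 1"
  defines "f \<equiv> \<lambda>n. \<Sum>k\<le>n. term_E n k"
  shows "(int n + 1)\<^sup>2 * f (n + 1) = (12 * (int n)\<^sup>2 + 12 * int n + 4) * f n - 32 * (int n)\<^sup>2 * f (n - 1)"
proof -
  define y where "y = real n"
  define u where "u = (\<lambda>k. n + 1 - k)"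
  define q where "q = (\<lambda>k :: real. 2 * y * k - 2 * y\<^sup>2 - y + 1)"
  define g where "g = (\<lambda>k. (real k)\<^sup>2 * q k * bc k * bc (u k) / (2 * real (u k) - 1))"
  \<comment> \<open>This is g (k + 1) rewritten by \<open>bc_Suc\<close> in terms of
    \<open>bc k\<close> and \<open>bc' (u k)\<close>, so that everything is expressed at the same k.
    It vanishes at the end k = n + 1, where \<open>bc'\<close> is 0.\<close>
  define h where "h = (\<lambda>k. 2 * (2 * real k + 1) * bc k * q (real k + 1) * bc' (u k) / (2 * real (u k) - 3))"
  define R where "R = (fact (n - 1) :: real)"
  have Rn: "fact n = y * R" "fact (n + 1) = (y + 1) * y * R"
    using n unfolding R_def y_def by (cases n, simp_all add: algebra_simps)+
  have f1: "real_of_int (f (n + 1)) = (\<Sum>k\<le>n + 1. (y + 1) * y * R * (bc k * bc (u k)))"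
    unfolding f_def Rn(2)[symmetric] by (simp add: term_E_bc u_def mult.assoc)
  have f0: "real_of_int (f n) = (\<Sum>k\<le>n + 1. y * R * (bc k * bc' (u k)))"
    unfolding f_def Rn(1)[symmetric]
    by (simp add: term_E_bc u_def bc'_def mult.assoc Suc_diff_le cong: sum.cong_simp)
  have fm: "real_of_int (f (n - 1)) = (\<Sum>k\<le>n + 1. R * (bc k * bc'' (u k)))"
  proof -
    obtain j where j: "n = Suc j" using n by (cases n) auto
    show ?thesis
      unfolding f_def R_def j by (simp add: term_E_bc u_def bc''_def mult.assoc j Suc_diff_le cong: sum.cong_simp)
  qed
  have tele: "(\<Sum>k\<le>n + 1. h k - g k) = 0"
  proof -
    have "h k = g (k + 1)" if "k \<le> n" for k
    proof -
      have uk: "u k = Suc (u (k + 1))" using that by (simp add: u_def Suc_diff_le)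
      have "(real k + 1)\<^sup>2 * bc (Suc k) = 2 * (2 * real k + 1) * bc k" by (rule bc_Suc)
      from this[symmetric] show ?thesis unfolding h_def g_def uk bc'_def by (simp only:) (simp add: algebra_simps)
    qed
    moreover have "h (n + 1) = 0" by (simp add: h_def u_def bc'_def)
    ultimately have "(\<Sum>k\<le>n + 1. h k) = (\<Sum>k\<le>n. g (Suc k))" by simp
    moreover have "(\<Sum>k\<le>n + 1. g k) = g 0 + (\<Sum>k\<le>n. g (Suc k))"
      by (simp only: Suc_eq_plus1[symmetric] sum.atMost_Suc_shift)
    moreover have "g 0 = 0" by (simp add: g_def)
    ultimately show ?thesis by (simp add: sum_subtractf)
  qed
  have key: "(y + 1)\<^sup>2 * ((y + 1) * y * R * (bc k * bc (u k))) - (12 * y\<^sup>2 + 12 * y + 4) * (y * R * (bc k * bc' (u k)))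
      + 32 * y\<^sup>2 * (R * (bc k * bc'' (u k))) = y * R * (h k - g k)" if k: "k \<le> n + 1" for k
  proof -
    define x where "x = real k"
    define b where "b = bc k * bc (u k)"
    have ru: "real (u k) = y + 1 - x" using k by (simp add: u_def y_def x_def of_nat_diff)
    have ne: "2 * (y + 1 - x) - 1 \<noteq> 0" "2 * (y + 1 - x) - 3 \<noteq> 0" using odd_ne_0[of "u k"] unfolding ru by auto
    have b': "bc' (u k) = (y + 1 - x)\<^sup>2 * bc (u k) / (2 * (2 * (y + 1 - x) - 1))"
      using bc'_eq[of "u k"] ne unfolding ru by (simp add: field_simps)
    have b'': "bc'' (u k) = (y - x)\<^sup>2 * bc' (u k) / (2 * (2 * (y + 1 - x) - 3))"
      using bc''_eq[of "u k"] ne unfolding ru by (simp add: field_simps)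
    define c where "c = R * bc k * bc (u k)"
    define d e where "d = 2 * (y + 1 - x) - 1" and "e = 2 * (y + 1 - x) - 3"
    have ne': "d \<noteq> 0" "e \<noteq> 0" using ne unfolding d_def e_def by auto
    have t1: "(y + 1) * y * R * (bc k * bc (u k)) = c * ((y + 1) * y)" by (simp only: c_def mult_ac)
    have t0: "y * R * (bc k * bc' (u k)) = c * (y * (y + 1 - x)\<^sup>2 / (2 * d))"
      unfolding b' c_def d_def by (simp only: divide_inverse inverse_mult_distrib mult_ac)
    have tm: "R * (bc k * bc'' (u k)) = c * ((y - x)\<^sup>2 * (y + 1 - x)\<^sup>2 / (2 * e * (2 * d)))"
      unfolding b'' b' c_def d_def e_def by (simp only: divide_inverse inverse_mult_distrib mult_ac)
    have hk: "y * R * h k = c * (2 * (y * (2 * x + 1) * q (x + 1) * (y + 1 - x)\<^sup>2) / (2 * d * e))"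
      unfolding h_def b' ru c_def x_def[symmetric] e_def d_def
      by (simp only: divide_inverse inverse_mult_distrib mult_ac)
    have gk: "y * R * g k = c * (y * x\<^sup>2 * q x / d)"
      unfolding g_def ru c_def x_def[symmetric] d_def by (simp only: divide_inverse inverse_mult_distrib mult_ac)
    have "(y + 1)\<^sup>2 * ((y + 1) * y) * (4 * d * e) - (12 * y\<^sup>2 + 12 * y + 4) * (y * (y + 1 - x)\<^sup>2) * (2 * e)
        + 32 * y\<^sup>2 * ((y - x)\<^sup>2 * (y + 1 - x)\<^sup>2) =
        4 * (y * (2 * x + 1) * q (x + 1) * (y + 1 - x)\<^sup>2 - y * x\<^sup>2 * q x * e)"
      unfolding d_def e_def q_def by Groebner_Basis.algebra
    from telescoping_combination[OF ne' this, of c] show ?thesis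
      unfolding right_diff_distrib hk gk t1 t0 tm by simp
  qed
  have "(y + 1)\<^sup>2 * real_of_int (f (n + 1)) - (12 * y\<^sup>2 + 12 * y + 4) * real_of_int (f n) + 32 * y\<^sup>2 * real_of_int (f (n - 1)) =
      (\<Sum>k\<le>n + 1. y * R * (h k - g k))"
    unfolding f1 f0 fm sum_distrib_left sum_subtractf[symmetric] sum.distrib[symmetric]
    by (rule sum.cong[OF refl]) (use key in auto)
  also have "\<dots> = 0" using tele by (simp flip: sum_distrib_left)
  finally have "real_of_int ((int n + 1)\<^sup>2 * f (n + 1)) =
      real_of_int ((12 * (int n)\<^sup>2 + 12 * int n + 4) * f n - 32 * (int n)\<^sup>2 * f (n - 1))"
    by (simp add: y_def)
  then show ?thesis by (simp only: of_int_eq_iff)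
qed

lemma supercongruence_E:
  assumes A: "zagier_sequence 12 4 32 A" and p: "prime p" "odd p" and r: "r \<ge> 1"
  shows "[A (p ^ r * n) = A (p ^ (r - 1) * n)] (mod int p ^ (2 * r))"
proof -
  have "of_int (A n) = (\<Sum>k\<le>n. term_E n k)" for n
  proof (rule rec_seq_unique[OF zagier_rec_seq[OF A]])
    show "of_int ((int 0 + 1)\<^sup>2) * (\<Sum>k\<le>1. term_E 1 k) = of_int (12 * (int 0)\<^sup>2 + 12 * int 0 + 4)"
      by (simp add: term_E_def)
  qed (use sum_E_recurrence in \<open>simp_all add: term_E_def\<close>)
  then show ?thesis
    using sum_supercongruence[OF p r, of term_E n] ucong_term_E[OF p] by (simp add: term_E_square)
qed

section \<open>The sum for s18\<close>

definition bracket_s18 :: "nat \<Rightarrow> nat \<Rightarrow> int" where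
  "bracket_s18 n k = int ((2 * n - 3 * k - 1) choose n) + int ((2 * n - 3 * k) choose n)"

text \<open>At n = 0 the bracket is 2 while the sequence starts with 1, so that value is excluded
  here and set separately. The range 3 k <= n keeps 2 n - 3 k at least n.\<close>

definition term_s18 :: "nat \<Rightarrow> nat \<Rightarrow> int" where
  "term_s18 n k = (if 3 * k \<le> n \<and> n \<ge> 1 then (-1) ^ k * term_E n k * bracket_s18 n k else 0)"

text \<open>With N = 2 n - 3 k, absorption gives N (N - 1 choose n) = (N - n) (N choose n), and 2 N
  - n = 3 (n - 2 k). A single binomial is left to be scaled by p.\<close>

lemma bracket_s18_eq:
  assumes "3 * k \<le> n" "n \<ge> 1"
  shows "int (2 * n - 3 * k) * bracket_s18 n k = 3 * (int n - 2 * int k) * int ((2 * n - 3 * k) choose n)"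
proof -
  obtain N where N: "2 * n - 3 * k = Suc N" using assms by (cases "2 * n - 3 * k") auto
  have le: "n \<le> Suc N" using assms N by simp
  have "Suc N * (N choose n) = (Suc N - n) * (Suc N choose n)"
    using binomial_absorb_comp[of "Suc N" n] by simp
  then have "int (Suc N) * int (N choose n) = (int (Suc N) - int n) * int (Suc N choose n)"
    using le by (metis of_nat_diff of_nat_mult)
  moreover have "int (Suc N) = 2 * int n - 3 * int k"
    using N assms by linarith
  moreover have "bracket_s18 n k = int (N choose n) + int (Suc N choose n)"
    using N by (simp add: bracket_s18_def)
  ultimately show ?thesis unfolding N by Groebner_Basis.algebra
qed

text \<open>The prefactor 3 (n - 2 k) / (2 n - 3 k) of the bracket is homogeneous of degree 0, hence
  the same at (p n, p k); the rest consists of binomials and a sign that odd p preserves.\<close>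

lemma ucong_term_s18:
  assumes p: "prime p" "odd p" and k: "k \<le> n" and t: "p ^ t dvd p * n" "p ^ t dvd p * k"
  shows "ucong p (2 * t) (term_s18 (p * n) (p * k)) (term_s18 n k)"
proof (cases "3 * k \<le> n \<and> n \<ge> 1")
  case True
  have p0: "p > 0" using p prime_gt_0_nat by blast
  have 3: "3 * (p * k) \<le> p * n" "p * n \<ge> 1" using True p0 by (simp_all add: mult.left_commute)
  define N where "N = 2 * n - 3 * k"
  have N: "2 * (p * n) - 3 * (p * k) = p * N" by (simp add: N_def right_diff_distrib' algebra_simps)
  have N0: "N > 0" using True by (simp add: N_def)
  have sign: "(-1) ^ (p * k) = ((-1) ^ k :: int)" using p(2) by (simp add: power_mult)
  have "ucong p (2 * t) (bracket_s18 (p * n) (p * k)) (bracket_s18 n k)"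
  proof -
    have nN: "n \<le> N" using True unfolding N_def by linarith
    have "p ^ t dvd p * (N - n)"
      using t unfolding N_def right_diff_distrib' by (intro dvd_diff_nat) (auto simp: mult.left_commute[of p])
    from ucong_binomial[OF p t(1) this] nN
    have "ucong p (2 * t) (int (p * N choose (p * n))) (int (N choose n))" by simp
    then obtain a b where ab: "\<not> int p dvd a" "\<not> int p dvd b" "[a = b] (mod int p ^ (2 * t))"
      "a * int (p * N choose (p * n)) = b * int (N choose n)"
      unfolding ucong_def by blast
    have 1: "int N * bracket_s18 n k = 3 * (int n - 2 * int k) * int (N choose n)"
      using bracket_s18_eq True unfolding N_def by blast
    have "int (p * N) * bracket_s18 (p * n) (p * k) = 3 * (int (p * n) - 2 * int (p * k)) * int (p * N choose (p * n))"
      using bracket_s18_eq[OF 3] unfolding N .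
    then have 2: "int N * bracket_s18 (p * n) (p * k) = 3 * (int n - 2 * int k) * int (p * N choose (p * n))"
    proof -
      assume *: "int (p * N) * bracket_s18 (p * n) (p * k) = 3 * (int (p * n) - 2 * int (p * k)) * int (p * N choose (p * n))"
      have "int p * (int N * bracket_s18 (p * n) (p * k)) = int p * (3 * (int n - 2 * int k) * int (p * N choose (p * n)))"
        using * by (simp add: algebra_simps)
      then show ?thesis using p0 by simp
    qed
    have "int N * (a * bracket_s18 (p * n) (p * k)) = 3 * (int n - 2 * int k) * (a * int (p * N choose (p * n)))"
      using 2 by (simp add: mult.left_commute)
    also have "\<dots> = int N * (b * bracket_s18 n k)"
      unfolding ab(4) using 1 by (simp add: mult.left_commute)
    finally have "a * bracket_s18 (p * n) (p * k) = b * bracket_s18 n k" using N0 by simp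
    then show ?thesis unfolding ucong_def using ab by blast
  qed
  then show ?thesis
    using True 3 ucong_term_E[OF p k t] unfolding term_s18_def sign
    by (simp add: ucong_mult p ucong_refl)
next
  case False
  have p0: "p > 0" using p prime_gt_0_nat by blast
  have "3 * (p * k) \<le> p * n \<longleftrightarrow> 3 * k \<le> n" "p * n \<ge> 1 \<longleftrightarrow> n \<ge> 1"
    using p0 by (auto simp: mult.left_commute[of 3] Suc_le_eq)
  then have "\<not> (3 * (p * k) \<le> p * n \<and> p * n \<ge> 1)" using False by blast
  then have "term_s18 (p * n) (p * k) = 0" "term_s18 n k = 0"
    using False by (simp_all only: term_s18_def if_False)
  then show ?thesis by (simp add: ucong_refl p)
qed

lemma term_s18_real:
  assumes "3 * k \<le> n" "n \<ge> 1"
  shows "real_of_int (term_s18 n k) = (-1) ^ k * (bc k * bc (n - k)) * (3 * (real n - 2 * real k) *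
    fact (2 * n - 3 * k - 1) / fact (n - 3 * k))"
proof -
  obtain N where N: "2 * n - 3 * k = Suc N" using assms by (cases "2 * n - 3 * k") auto
  have le: "n \<le> Suc N" "Suc N - n = n - 3 * k" using assms N by simp_all
  have "real_of_int (int (Suc N) * bracket_s18 n k) = real_of_int (3 * (int n - 2 * int k) * int (Suc N choose n))"
    using bracket_s18_eq[OF assms] unfolding N by simp
  then have "real (Suc N) * real_of_int (bracket_s18 n k) =
      3 * (real n - 2 * real k) * (fact (Suc N) / (fact n * fact (n - 3 * k)))"
    using binomial_fact[OF le(1), where 'a = real] unfolding le(2) by simp
  then have "real (Suc N) * (real_of_int (bracket_s18 n k) * fact n) =
      real (Suc N) * (3 * (real n - 2 * real k) * (fact N / fact (n - 3 * k)))"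
    by (simp add: field_simps del: of_nat_Suc)
  then have b: "real_of_int (bracket_s18 n k) * fact n = 3 * (real n - 2 * real k) * fact N / fact (n - 3 * k)"
    by (subst (asm) mult_cancel_left) (auto simp del: of_nat_Suc)
  have "real_of_int (term_s18 n k) = (-1) ^ k * (bc k * bc (n - k)) * (real_of_int (bracket_s18 n k) * fact n)"
    using assms by (simp add: term_s18_def term_E_bc)
  then show ?thesis using b N by simp
qed

lemma sum_term_s18: "n \<ge> 1 \<Longrightarrow> (\<Sum>k\<le>n. term_s18 n k) = (\<Sum>k | 3 * k \<le> n. term_s18 n k)"
  by (rule sum.mono_neutral_right) (auto simp: term_s18_def)

lemma fact_real_add:
  "(fact (x + 1) :: real) = (real x + 1) * fact x"
  "(fact (x + 2) :: real) = (real x + 2) * ((real x + 1) * fact x)"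
  "(fact (x + 3) :: real) = (real x + 3) * ((real x + 2) * ((real x + 1) * fact x))"
  "(fact (x + 4) :: real) = (real x + 4) * ((real x + 3) * ((real x + 2) * ((real x + 1) * fact x)))"
  by (simp_all add: eval_nat_numeral algebra_simps)

text \<open>Writes 1 / (v - 2)! and 1 / (v - 3)! over v!. The numerators vanish for smaller v, which
  is how terms outside the summation range become 0.\<close>

lemma falling_div_fact:
  "real (j + 2) * (real (j + 2) - 1) / fact (j + 2) = 1 / (fact j :: real)"
  "real (j + 3) * (real (j + 3) - 1) * (real (j + 3) - 2) / fact (j + 3) = 1 / (fact j :: real)"
proof -
  have ne: "real j + 1 \<noteq> 0" "real j + 2 \<noteq> 0" "real j + 3 \<noteq> 0" by linarith+
  have 1: "real (j + 2) = real j + 2" "real j + 2 - 1 = real j + 1" "real (j + 3) = real j + 3"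
    "real j + 3 - 1 = real j + 2" "real j + 3 - 2 = real j + 1" by simp_all
  have c: "a * b / (a * (b * t)) = 1 / t" "a * b * d / (a * (b * (d * t))) = 1 / t"
    if "a \<noteq> 0" "b \<noteq> 0" "d \<noteq> 0" for a b d t :: real
    using that by (simp_all add: field_simps)
  show "real (j + 2) * (real (j + 2) - 1) / fact (j + 2) = 1 / (fact j :: real)"
    unfolding 1 fact_real_add by (rule c(1)[OF ne(2,1,1)])
  show "real (j + 3) * (real (j + 3) - 1) * (real (j + 3) - 2) / fact (j + 3) = 1 / (fact j :: real)"
    unfolding 1 fact_real_add by (rule c(2)[OF ne(3,2,1)])
qed

text \<open>For 3 k <= n + 1 the bound n >= 4 gives 2 n - 3 k - 3 >= n - 4 >= 0, so the subtraction
  defining \<open>x\<close> is never truncated.\<close>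

lemma sum_s18_recurrence_large:
  assumes n: "n \<ge> 4"
  defines "f \<equiv> \<lambda>n. \<Sum>k\<le>n. term_s18 n k"
  shows "(int n + 1) ^ 3 * f (n + 1) = (2 * int n + 1) * (14 * (int n)\<^sup>2 + 14 * int n + 6) * f n
     - int n * (192 * (int n)\<^sup>2 - 12) * f (n - 1)"
proof -
  define y where "y = real n"
  define K where "K = (n + 1) div 3"
  have K: "{k. 3 * k \<le> n + 1} = {..K}" unfolding K_def by auto
  define u where "u = (\<lambda>k. n + 1 - k)"
  define v where "v = (\<lambda>k. n + 1 - 3 * k)"
  define x where "x = (\<lambda>k. 2 * n - 3 * k - 3)"
  \<comment> \<open>The summands for n + 1, n and n - 1 over the common denominator
    \<open>fact (v k)\<close>, all with the range up to K.\<close>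
  define F1 where "F1 = (\<lambda>k. (-1) ^ k * (bc k * bc (u k)) * (3 * (y + 1 - 2 * real k) * fact (x k + 4) / fact (v k)))"
  define F0 where "F0 = (\<lambda>k. (-1) ^ k * (bc k * bc' (u k)) * (3 * (y - 2 * real k) * fact (x k + 2) * real (v k) / fact (v k)))"
  define Fm where "Fm = (\<lambda>k. (-1) ^ k * (bc k * bc'' (u k)) *
     (3 * (y - 1 - 2 * real k) * fact (x k) * (real (v k) * (real (v k) - 1)) / fact (v k)))"
  \<comment> \<open>The numerator of the rational certificate, as in
    \<open>sum_E_recurrence\<close>; here \<open>g\<close> also carries the factorials of
    \<open>x k + 3\<close> and \<open>v k\<close>.\<close>
  define q where "q = (\<lambda>k :: real. 12 * (- 6 * y\<^sup>2 * k\<^sup>2 + 9 * y * k\<^sup>2 + 6 * k\<^sup>2 + 14 * y ^ 3 * k + 5 * y\<^sup>2 * k - 14 * y * k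
     - 5 * k - 8 * y ^ 4 - 15 * y ^ 3 - 5 * y\<^sup>2 + 3 * y + 1))"
  define g where "g = (\<lambda>k. (-1) ^ k * (real k)\<^sup>2 * q k * bc k * bc (u k) / (2 * real (u k) - 1) * fact (x k + 3) / fact (v k))"
  define h where "h = (\<lambda>k. - ((-1) ^ k) * (2 * (2 * real k + 1) * bc k) * q (real k + 1) * bc' (u k) / (2 * real (u k) - 3)
     * fact (x k) * (real (v k) * (real (v k) - 1) * (real (v k) - 2)) / fact (v k))"
  have n1: "2 * n - 3 * k - 3 + 4 = 2 * (n + 1) - 3 * k - 1" "2 * n - 3 * k - 3 + 2 = 2 * n - 3 * k - 1"
    "2 * n - 3 * k - 3 = 2 * (n - 1) - 3 * k - 1" if "k \<le> K" for k
    using that n unfolding K_def by auto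
  have f1: "real_of_int (f (n + 1)) = (\<Sum>k\<le>K. F1 k)"
  proof -
    have "real_of_int (f (n + 1)) = (\<Sum>k\<le>K. real_of_int (term_s18 (n + 1) k))"
      unfolding f_def using sum_term_s18[of "n + 1"] K by simp
    also have "\<dots> = (\<Sum>k\<le>K. F1 k)"
    proof (rule sum.cong[OF refl])
      fix k assume k: "k \<in> {..K}"
      then have "3 * k \<le> n + 1" using K by blast
      from term_s18_real[OF this] show "real_of_int (term_s18 (n + 1) k) =
          F1 k"
        using n1(1)[of k] k unfolding F1_def u_def v_def x_def y_def by (simp add: add.commute)
    qed
    finally show ?thesis .
  qed
  have f0: "real_of_int (f n) = (\<Sum>k\<le>K. F0 k)"
  proof -
    have "f n = (\<Sum>k\<le>K. term_s18 n k)"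
      unfolding f_def using n by (intro sum.mono_neutral_right) (auto simp: term_s18_def K_def)
    then have "real_of_int (f n) = (\<Sum>k\<le>K. real_of_int (term_s18 n k))" by simp
    also have "\<dots> = (\<Sum>k\<le>K. F0 k)"
    proof (rule sum.cong[OF refl])
      fix k assume k: "k \<in> {..K}"
      show "real_of_int (term_s18 n k) = F0 k"
      proof (cases "3 * k \<le> n")
        case True
        have v: "v k = Suc (n - 3 * k)" using True by (simp add: v_def)
        have uk: "bc' (u k) = bc (n - k)" using True by (simp add: u_def bc'_def)
        have vq: "real (v k) / fact (v k) = 1 / fact (n - 3 * k)" unfolding v by (simp del: of_nat_Suc)
        have "F0 k =
            (-1) ^ k * (bc k * bc (n - k)) * (3 * (y - 2 * real k) * fact (x k + 2)) * (real (v k) / fact (v k))"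
          unfolding F0_def uk by (simp only: mult.assoc times_divide_eq_right)
        also have "\<dots> = real_of_int (term_s18 n k)"
          unfolding vq using term_s18_real[OF True] n n1(2)[of k] k unfolding x_def y_def by simp
        finally show ?thesis ..
      next
        case False
        then have "v k = 0" using k K by (auto simp: v_def)
        then show ?thesis using False by (simp add: term_s18_def F0_def)
      qed
    qed
    finally show ?thesis .
  qed
  have fm: "real_of_int (f (n - 1)) = (\<Sum>k\<le>K. Fm k)"
  proof -
    have "f (n - 1) = (\<Sum>k\<le>K. term_s18 (n - 1) k)"
      unfolding f_def using n by (intro sum.mono_neutral_cong) (auto simp: term_s18_def K_def)
    then have "real_of_int (f (n - 1)) = (\<Sum>k\<le>K. real_of_int (term_s18 (n - 1) k))" by simp
    also have "\<dots> = (\<Sum>k\<le>K. Fm k)"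
    proof (rule sum.cong[OF refl])
      fix k assume k: "k \<in> {..K}"
      show "real_of_int (term_s18 (n - 1) k) = Fm k"
      proof (cases "3 * k \<le> n - 1")
        case True
        have v: "v k = Suc (Suc (n - 1 - 3 * k))" using True n by (simp add: v_def)
        have uk: "bc'' (u k) = bc (n - 1 - k)" using True n by (simp add: u_def bc''_def)
        have vq: "real (v k) * (real (v k) - 1) / fact (v k) = 1 / fact (n - 1 - 3 * k)"
          using falling_div_fact(1)[of "n - 1 - 3 * k"] unfolding v by simp
        have "Fm k =
            (-1) ^ k * (bc k * bc (n - 1 - k)) * (3 * (y - 1 - 2 * real k) * fact (x k)) *
            (real (v k) * (real (v k) - 1) / fact (v k))"
          unfolding Fm_def uk by (simp only: mult.assoc times_divide_eq_right)
        also have "\<dots> = real_of_int (term_s18 (n - 1) k)"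
          unfolding vq using term_s18_real[OF True] n n1(3)[of k] k unfolding x_def y_def
          by (simp add: of_nat_diff)
        finally show ?thesis ..
      next
        case False
        then have "v k = 0 \<or> v k = 1" using k K by (auto simp: v_def)
        then show ?thesis using False by (auto simp: term_s18_def Fm_def)
      qed
    qed
    finally show ?thesis .
  qed
  have tele: "(\<Sum>k\<le>K. h k - g k) = 0"
  proof -
    have hg: "h k = g (k + 1)" if k: "k < K" for k
    proof -
      have le: "3 * k + 3 \<le> n + 1" using k K by (auto simp: K_def)
      have uk: "u k = Suc (u (k + 1))" using le by (simp add: u_def Suc_diff_le)
      have vk: "v k = v (k + 1) + 3" and xk: "x k = x (k + 1) + 3"
        using le n by (simp_all add: v_def x_def)
      have 1: "real (v k) * (real (v k) - 1) * (real (v k) - 2) / fact (v k) = 1 / fact (v (k + 1))"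
        unfolding vk by (rule falling_div_fact(2))
      have 2: "(real k + 1)\<^sup>2 * bc (Suc k) = 2 * (2 * real k + 1) * bc k" by (rule bc_Suc)
      have "h k = - ((-1) ^ k) * (2 * (2 * real k + 1) * bc k) * q (real k + 1) * bc' (u k) / (2 * real (u k) - 3)
         * fact (x k) * (real (v k) * (real (v k) - 1) * (real (v k) - 2) / fact (v k))"
        by (simp add: h_def)
      also have "\<dots> = g (k + 1)"
        unfolding 1 2[symmetric] g_def xk[symmetric] uk bc'_def by (simp add: algebra_simps)
      finally show ?thesis .
    qed
    \<comment> \<open>\<open>v K\<close> is the remainder of n + 1 modulo 3, so the last term of the
      telescoping sum is cut off.\<close>
    have "real (v K) * (real (v K) - 1) * (real (v K) - 2) = 0"
    proof -
      have "v K = 0 \<or> v K = 1 \<or> v K = 2" unfolding v_def K_def by presburger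
      then show ?thesis by auto
    qed
    then have h0: "h K = 0" by (simp add: h_def)
    have "(\<Sum>k\<le>K. h k) = (\<Sum>k<K. g (Suc k))"
      using hg h0 by (simp add: lessThan_Suc_atMost[symmetric])
    moreover have "(\<Sum>k\<le>K. g k) = g 0 + (\<Sum>k<K. g (Suc k))"
      by (simp only: lessThan_Suc_atMost[symmetric] sum.lessThan_Suc_shift)
    moreover have "g 0 = 0" by (simp add: g_def)
    ultimately show ?thesis by (simp add: sum_subtractf)
  qed
  have key: "(y + 1) ^ 3 * F1 k
      - (2 * y + 1) * (14 * y\<^sup>2 + 14 * y + 6) * F0 k
      + y * (192 * y\<^sup>2 - 12) * Fm k
      = (h k - g k) / 4" if k: "k \<le> K" for k
  proof -
    define z where "z = real k"
    have le: "3 * k \<le> n + 1" using k K by blast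
    have ru: "real (u k) = y + 1 - z" using le by (simp add: u_def y_def z_def of_nat_diff)
    have rv: "real (v k) = y + 1 - 3 * z" using le by (simp add: v_def y_def z_def of_nat_diff)
    have rx: "real (x k) = 2 * y - 3 * z - 3" using le n by (simp add: x_def y_def z_def of_nat_diff)
    define c where "c = (-1) ^ k * bc k * bc (u k) * fact (x k) / fact (v k)"
    define d e where "d = 2 * (y + 1 - z) - 1" and "e = 2 * (y + 1 - z) - 3"
    have ne: "d \<noteq> 0" "e \<noteq> 0" using odd_ne_0[of "u k"] unfolding ru d_def e_def by auto
    have b': "bc' (u k) = (y + 1 - z)\<^sup>2 / (2 * d) * bc (u k)"
      using bc'_eq[of "u k"] ne unfolding ru d_def by (simp add: field_simps)
    have b'': "bc'' (u k) = (y - z)\<^sup>2 / (2 * e) * bc' (u k)"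
      using bc''_eq[of "u k"] ne unfolding ru e_def by (simp add: field_simps)
    have xs: "2 * y - 3 * z - 3 + 1 = 2 * y - 3 * z - 2" "2 * y - 3 * z - 3 + 2 = 2 * y - 3 * z - 1"
      "2 * y - 3 * z - 3 + 3 = 2 * y - 3 * z" "2 * y - 3 * z - 3 + 4 = 2 * y - 3 * z + 1"
      "y + 1 - 3 * z - 1 = y - 3 * z" "y + 1 - 3 * z - 2 = y - 1 - 3 * z"
      by simp_all
    have t1: "F1 k =
       c * (3 * (y + 1 - 2 * z) * ((2 * y - 3 * z + 1) * (2 * y - 3 * z) * (2 * y - 3 * z - 1) * (2 * y - 3 * z - 2)))"
      unfolding F1_def fact_real_add rx xs c_def z_def[symmetric]
      by (simp only: divide_inverse inverse_mult_distrib mult_ac)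
    have t0: "F0 k =
       c * ((y + 1 - z)\<^sup>2 * (3 * (y - 2 * z) * ((2 * y - 3 * z - 1) * (2 * y - 3 * z - 2) * (y + 1 - 3 * z))) / (2 * d))"
      unfolding F0_def fact_real_add rx rv b' c_def z_def[symmetric] xs
      by (simp only: divide_inverse inverse_mult_distrib mult_ac)
    have tm: "Fm k =
       c * ((y - z)\<^sup>2 * (y + 1 - z)\<^sup>2 * (3 * (y - 1 - 2 * z) * ((y + 1 - 3 * z) * (y - 3 * z))) / (2 * e * (2 * d)))"
      unfolding Fm_def rv b'' b' c_def z_def[symmetric] xs
      by (simp only: divide_inverse inverse_mult_distrib mult_ac)
    have hk: "h k = c * (2 * (- (2 * z + 1) * q (z + 1) * (y + 1 - z)\<^sup>2 * ((y + 1 - 3 * z) * (y - 3 * z) * (y - 1 - 3 * z))) / (2 * d * e))"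
      unfolding h_def rv ru b' c_def z_def[symmetric] e_def d_def xs
      by (simp only: divide_inverse inverse_mult_distrib mult_minus_left mult_minus_right mult_ac)
    have gk: "g k = c * (z\<^sup>2 * q z * ((2 * y - 3 * z) * (2 * y - 3 * z - 1) * (2 * y - 3 * z - 2)) / d)"
      unfolding g_def fact_real_add rx ru c_def z_def[symmetric] d_def xs
      by (simp only: divide_inverse inverse_mult_distrib mult_ac)
    have "(y + 1) ^ 3 * (3 * (y + 1 - 2 * z) * ((2 * y - 3 * z + 1) * (2 * y - 3 * z) * (2 * y - 3 * z - 1) * (2 * y - 3 * z - 2))) * (4 * d * e)
      - (2 * y + 1) * (14 * y\<^sup>2 + 14 * y + 6) * ((y + 1 - z)\<^sup>2 * (3 * (y - 2 * z) * ((2 * y - 3 * z - 1) * (2 * y - 3 * z - 2) * (y + 1 - 3 * z)))) * (2 * e)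
      + y * (192 * y\<^sup>2 - 12) * ((y - z)\<^sup>2 * (y + 1 - z)\<^sup>2 * (3 * (y - 1 - 2 * z) * ((y + 1 - 3 * z) * (y - 3 * z))))
      = 1 * (- (2 * z + 1) * q (z + 1) * (y + 1 - z)\<^sup>2 * ((y + 1 - 3 * z) * (y - 3 * z) * (y - 1 - 3 * z))
       - z\<^sup>2 * q z * ((2 * y - 3 * z) * (2 * y - 3 * z - 1) * (2 * y - 3 * z - 2)) * e)"
      unfolding d_def e_def q_def by Groebner_Basis.algebra
    from telescoping_combination[OF ne this, of c] show ?thesis
      unfolding t1 t0 tm hk gk by simp
  qed
  have "(y + 1) ^ 3 * real_of_int (f (n + 1)) - (2 * y + 1) * (14 * y\<^sup>2 + 14 * y + 6) * real_of_int (f n)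
      + y * (192 * y\<^sup>2 - 12) * real_of_int (f (n - 1)) = (\<Sum>k\<le>K. (h k - g k) / 4)"
    unfolding f1 f0 fm sum_distrib_left sum_subtractf[symmetric] sum.distrib[symmetric]
    by (rule sum.cong[OF refl]) (use key in auto)
  also have "\<dots> = 0" using tele by (simp flip: sum_divide_distrib)
  finally have "real_of_int ((int n + 1) ^ 3 * f (n + 1)) =
      real_of_int ((2 * int n + 1) * (14 * (int n)\<^sup>2 + 14 * int n + 6) * f n - int n * (192 * (int n)\<^sup>2 - 12) * f (n - 1))"
    by (simp add: y_def)
  then show ?thesis by (simp only: of_int_eq_iff)
qed

text \<open>Together with the value 1 at 0, these settle the recurrence for n = 1, 2, 3.\<close>

lemma sum_s18_small:
  "(\<Sum>k\<le>1. term_s18 1 k) = 6" "(\<Sum>k\<le>2. term_s18 2 k) = 54"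
  "(\<Sum>k\<le>3. term_s18 3 k) = 564" "(\<Sum>k\<le>4. term_s18 4 k) = 6390"
  by code_simp+

lemma supercongruence_s18:
  assumes A: "cooper_sequence 14 6 192 (-12) A" and p: "prime p" "odd p" and r: "r \<ge> 1" and n: "n \<ge> 1"
  shows "[A (p ^ r * n) = A (p ^ (r - 1) * n)] (mod int p ^ (2 * r))"
proof -
  \<comment> \<open>The bare sum would be 0 at n = 0. As n >= 1, neither p^r n nor p^(r - 1) n meets
    the patched value.\<close>
  define F where "F = (\<lambda>n. if n = 0 then 1 else \<Sum>k\<le>n. term_s18 n k)"
  have val: "F 0 = 1" "F 1 = 6" "F 2 = 54" "F 3 = 564" "F 4 = 6390"
    using sum_s18_small by (simp_all add: F_def)
  have "of_int (A n) = F n" for n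
  proof (rule rec_seq_unique[OF cooper_rec_seq[OF A]])
    fix n :: nat assume n: "n \<ge> 1"
    show "of_int ((int n + 1) ^ 3) * F (n + 1) =
       of_int ((2 * int n + 1) * (14 * (int n)\<^sup>2 + 14 * int n + 6)) * F n -
       of_int (int n * (192 * (int n)\<^sup>2 + - 12)) * F (n - 1)"
    proof (cases "n \<ge> 4")
      case True
      then show ?thesis using sum_s18_recurrence_large[OF True] by (simp add: F_def)
    next
      case False
      then consider "n = 1" | "n = 2" | "n = 3" using n by linarith
      then show ?thesis
        by cases (use val in \<open>simp_all add: numeral_eq_Suc\<close>)
    qed
  qed (use val in simp_all)
  then have A: "A n = F n" for n by simp
  have sq: "(int (n choose k))\<^sup>2 dvd term_s18 n k" if "k \<le> n" for n k
    using that by (simp add: term_s18_def term_E_square)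
  have "p > 0" using p prime_gt_0_nat by blast
  then show ?thesis
    using sum_supercongruence[OF p r sq ucong_term_s18[OF p], of n] n by (simp add: A F_def)
qed

section \<open>The sequence \<open>B\<close>\<close>

text \<open>The exponent (1, 1) is the centre of gravity of (0, 0), (3, 0), (0, 3) and has
  coefficient 3, so \<open>sparse\<close> does not apply to this polynomial directly.\<close>

definition poly_B :: poly where "poly_B = [(-1, 0, 0, 0), (-1, 0, 3, 0), (3, 1, 1, 0), (-1, 3, 0, 0)]"

definition field_B1 :: wpoly where "field_B1 =
  [(0,0,0,[[-2,-2]]), (0,3,0,[[-4,-4]]), (0,6,0,[[-2,-2]]), (1,1,0,[[6]]), (1,4,0,[[6]]), (3,0,0,[[-1,-1]]),
   (3,3,0,[[-1,8]]), (4,1,0,[[-3]]), (6,0,0,[[1,1]])]"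

definition field_B2 :: wpoly where "field_B2 =
  [(3,0,0,[[0,-9]]), (3,3,0,[[0,9]])]"

lemma cert_B: "zagier_cert 2 9 3 27 (w :: 'a::idom) x y z (1, 1, 0) poly_B field_B1 field_B2 []"
  unfolding poly_B_def field_B1_def field_B2_def cert_unfold
  by (simp only: cert_eval) Groebner_Basis.algebra

text \<open>\<open>X\<close> splits into orbits of three distinct elements on which \<open>f\<close>
  is constant; the induction removes one orbit at a time.\<close>

lemma sum_dvd_of_free_rotation:
  fixes f :: "'b \<Rightarrow> int"
  assumes "finite X" and "\<And>x. x \<in> X \<Longrightarrow> \<rho> x \<in> X \<and> \<rho> (\<rho> (\<rho> x)) = x \<and> \<rho> x \<noteq> x \<and> f (\<rho> x) = f x \<and> d dvd f x"
  shows "3 * d dvd sum f X"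
  using assms
proof (induction "card X" arbitrary: X rule: less_induct)
  case less
  show ?case
  proof (cases "X = {}")
    case False
    then obtain x where x: "x \<in> X" by blast
    note P = less.prems(2)
    define O3 where "O3 = {x, \<rho> x, \<rho> (\<rho> x)}"
    have sub: "O3 \<subseteq> X" using P x unfolding O3_def by blast
    have dist: "x \<noteq> \<rho> x" "\<rho> x \<noteq> \<rho> (\<rho> x)" "x \<noteq> \<rho> (\<rho> x)"
      using P x by metis+
    have f: "f (\<rho> x) = f x" "f (\<rho> (\<rho> x)) = f x" using P x by metis+
    have sO: "sum f O3 = 3 * f x" unfolding O3_def using dist f by simp
    have "3 * d dvd sum f (X - O3)"
    proof (rule less.hyps)
      show "card (X - O3) < card X"
        using x sub less.prems(1) by (intro psubset_card_mono) (auto simp: O3_def)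
      fix y assume y: "y \<in> X - O3"
      have "\<rho> y \<notin> O3"
      proof
        assume "\<rho> y \<in> O3"
        then have "\<rho> (\<rho> (\<rho> y)) \<in> O3" using P x unfolding O3_def by (metis insert_iff singletonD)
        then show False using P y by (metis DiffE)
      qed
      then show "\<rho> y \<in> X - O3 \<and> \<rho> (\<rho> (\<rho> y)) = y \<and> \<rho> y \<noteq> y \<and> f (\<rho> y) = f y \<and> d dvd f y"
        using P y by blast
    qed (use less.prems(1) in simp)
    moreover have "3 * d dvd sum f O3" unfolding sO using P x by (intro mult_dvd_mono) auto
    moreover have "sum f X = sum f (X - O3) + sum f O3"
      using sub less.prems(1) by (rule sum.subset_diff)
    ultimately show ?thesis by simp
  qed simp
qed

section \<open>Matrices with constant row and column sums\<close>

definition tri_expo :: "expo list" where "tri_expo = [(1, 0, 0), (0, 1, 0), (0, 0, 0)]"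

text \<open>The \<open>3 \<times> 3\<close> matrices with rows \<open>is\<close>, \<open>js\<close>, \<open>ks\<close> and all row and column sums equal to \<open>N\<close>.\<close>
definition squares :: "nat \<Rightarrow> (nat list \<times> nat list \<times> nat list) set" where
  "squares N = {(is, js, ks). is \<in> mindex 3 N \<and> js \<in> mindex 3 N \<and> ks \<in> mindex 3 N \<and>
     wt tri_expo is + wt tri_expo js + wt tri_expo ks = scale (int N) (1, 1, 0)}"

definition square_coeff :: "nat list \<times> nat list \<times> nat list \<Rightarrow> int" where
  "square_coeff = (\<lambda>(is, js, ks). int (mnom is) * int (mnom js) * int (mnom ks))"

definition row_phase :: "nat list \<Rightarrow> nat" where "row_phase is = is ! 1 + 2 * is ! 2"

text \<open>The exponent of \<open>omega\<close> when the rows select monomials from powers of x + t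
  y + t^2 with t = 1, \<open>omega\<close>, \<open>omega\<close>^2; the first row contributes
  nothing because its t is 1.\<close>

definition phase :: "nat list \<times> nat list \<times> nat list \<Rightarrow> nat" where
  "phase = (\<lambda>(is, js, ks). row_phase js + 2 * row_phase ks)"

lemma mindex_3E:
  assumes "is \<in> mindex 3 N"
  obtains a b c where "is = [a, b, c]" "a + b + c = N"
  using assms by (auto simp: mindex_def numeral_3_eq_3 length_Suc_conv)

lemma wt_tri_expo: "wt tri_expo [a, b, c] = (int a, int b, 0)"
  by (simp add: tri_expo_def scale_def zero_prod_def)

lemma squares_iff:
  "([a1, b1, c1], [a2, b2, c2], [a3, b3, c3]) \<in> squares N \<longleftrightarrow>
    a1 + b1 + c1 = N \<and> a2 + b2 + c2 = N \<and> a3 + b3 + c3 = N \<and> a1 + a2 + a3 = N \<and> b1 + b2 + b3 = N"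
  by (auto simp: squares_def mindex_def wt_tri_expo scale_def)

lemma squaresE:
  assumes "X \<in> squares N"
  obtains a1 b1 c1 a2 b2 c2 a3 b3 c3 where "X = ([a1, b1, c1], [a2, b2, c2], [a3, b3, c3])"
    "a1 + b1 + c1 = N" "a2 + b2 + c2 = N" "a3 + b3 + c3 = N" "a1 + a2 + a3 = N" "b1 + b2 + b3 = N"
proof -
  obtain "is" js ks where X: "X = (is, js, ks)" by (metis surj_pair)
  have "is \<in> mindex 3 N" "js \<in> mindex 3 N" "ks \<in> mindex 3 N" using assms by (auto simp: X squares_def)
  then obtain a1 b1 c1 a2 b2 c2 a3 b3 c3 where "X = ([a1, b1, c1], [a2, b2, c2], [a3, b3, c3])"
    unfolding X by (metis mindex_3E)
  with assms that show ?thesis by (metis squares_iff)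
qed

lemma finite_squares [simp]: "finite (squares N)"
  by (rule finite_subset[of _ "mindex 3 N \<times> mindex 3 N \<times> mindex 3 N"]) (auto simp: squares_def)

text \<open>If p^(t + 1) divided two rows, the column sums would make it divide the third. So at
  least two rows fail, and each of their multinomials has r - t factors p.\<close>

lemma square_coeff_dvd:
  assumes p: "prime p" and N: "p ^ r dvd N" and X: "X \<in> squares N"
    and nd: "\<not> (case X of (is, js, ks) \<Rightarrow> \<forall>i\<in>set is \<union> set js \<union> set ks. p ^ Suc t dvd i)"
  shows "int p ^ (2 * (r - t)) dvd square_coeff X"
proof (cases "t < r")
  case True
  from X obtain a1 b1 c1 a2 b2 c2 a3 b3 c3 where X': "X = ([a1, b1, c1], [a2, b2, c2], [a3, b3, c3])"
    and s: "a1 + b1 + c1 = N" "a2 + b2 + c2 = N" "a3 + b3 + c3 = N" "a1 + a2 + a3 = N" "b1 + b2 + b3 = N"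
    by (rule squaresE)
  define q where "q = p ^ Suc t"
  have qN: "q dvd N" using N True unfolding q_def by (meson Suc_leI dvd_trans le_imp_power_dvd)
  have c: "c1 + c2 + c3 = N" using s by linarith
  define ok where "ok = (\<lambda>is :: nat list. \<forall>i\<in>set is. q dvd i)"
  have sum3: "q dvd z" if "x + y + z = N" "q dvd x" "q dvd y" for x y z
    using that qN by (metis dvd_add dvd_add_right_iff)
  have two: "\<not> (ok [a1, b1, c1] \<and> ok [a2, b2, c2])" "\<not> (ok [a1, b1, c1] \<and> ok [a3, b3, c3])"
    "\<not> (ok [a2, b2, c2] \<and> ok [a3, b3, c3])"
  proof -
    have e: "a1 + a3 + a2 = N" "b1 + b3 + b2 = N" "c1 + c3 + c2 = N" "a2 + a3 + a1 = N" "b2 + b3 + b1 = N" "c2 + c3 + c1 = N"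
      using s c by linarith+
    have "ok [a3, b3, c3]" if "ok [a1, b1, c1]" "ok [a2, b2, c2]"
      using that sum3[OF s(4)] sum3[OF s(5)] sum3[OF c] by (simp add: ok_def)
    moreover have "ok [a2, b2, c2]" if "ok [a1, b1, c1]" "ok [a3, b3, c3]"
      using that sum3[OF e(1)] sum3[OF e(2)] sum3[OF e(3)] by (simp add: ok_def)
    moreover have "ok [a1, b1, c1]" if "ok [a2, b2, c2]" "ok [a3, b3, c3]"
      using that sum3[OF e(4)] sum3[OF e(5)] sum3[OF e(6)] by (simp add: ok_def)
    moreover have "\<not> (ok [a1, b1, c1] \<and> ok [a2, b2, c2] \<and> ok [a3, b3, c3])"
      using nd unfolding X' ok_def q_def by auto
    ultimately show "\<not> (ok [a1, b1, c1] \<and> ok [a2, b2, c2])" "\<not> (ok [a1, b1, c1] \<and> ok [a3, b3, c3])"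
      "\<not> (ok [a2, b2, c2] \<and> ok [a3, b3, c3])"
      by blast+
  qed
  have row: "int p ^ (r - t) dvd int (mnom is)" if "\<not> ok is" "sum_list is = N" for "is"
    using that N mnom_dvd[OF p, of r "is"] unfolding ok_def q_def by blast
  have sums: "sum_list [a1, b1, c1] = N" "sum_list [a2, b2, c2] = N" "sum_list [a3, b3, c3] = N"
    using s by simp_all
  define A B C where "A = int (mnom [a1, b1, c1])" and "B = int (mnom [a2, b2, c2])" and "C = int (mnom [a3, b3, c3])"
  have mm: "int p ^ (2 * (r - t)) dvd x * y" if "int p ^ (r - t) dvd x" "int p ^ (r - t) dvd y" for x y
    unfolding mult_2 power_add using that by (rule mult_dvd_mono)
  have eq: "square_coeff X = A * B * C" by (simp only: square_coeff_def X' prod.case A_def B_def C_def)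
  consider "\<not> ok [a1, b1, c1]" "\<not> ok [a2, b2, c2]" | "\<not> ok [a1, b1, c1]" "\<not> ok [a3, b3, c3]"
    | "\<not> ok [a2, b2, c2]" "\<not> ok [a3, b3, c3]" using two by blast
  then show ?thesis
  proof cases
    case 1
    have "int p ^ (2 * (r - t)) dvd A * B" unfolding A_def B_def by (intro mm row 1 sums)
    then show ?thesis unfolding eq by (rule dvd_mult2)
  next
    case 2
    have "int p ^ (2 * (r - t)) dvd A * C" unfolding A_def C_def by (intro mm row 2 sums)
    then show ?thesis unfolding eq by (metis dvd_mult2 mult.assoc mult.commute)
  next
    case 3
    have "int p ^ (2 * (r - t)) dvd B * C" unfolding B_def C_def by (intro mm row 3 sums)
    then show ?thesis unfolding eq mult.assoc by (rule dvd_mult)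
  qed
qed simp

definition smult :: "nat \<Rightarrow> nat list \<times> nat list \<times> nat list \<Rightarrow> nat list \<times> nat list \<times> nat list" where
  "smult p = (\<lambda>(is, js, ks). (map ((*) p) is, map ((*) p) js, map ((*) p) ks))"

lemma phase_smult: "X \<in> squares N \<Longrightarrow> phase (smult p X) = p * phase X"
  by (erule squaresE) (simp add: phase_def smult_def row_phase_def algebra_simps)

text \<open>The weight \<open>w\<close> can be arbitrary, because scaling a matrix by p multiplies
  its phase by exactly p.\<close>

lemma square_sum_cong:
  fixes w :: "nat \<Rightarrow> int"
  assumes p: "prime p" "odd p" and r: "r \<ge> 1"
  shows "[(\<Sum>X\<in>squares (p ^ r * n). square_coeff X * w (phase X)) =
    (\<Sum>X\<in>squares (p ^ (r - 1) * n). square_coeff X * w (p * phase X))] (mod int p ^ (2 * r))"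
proof -
  define N M where "N = p ^ r * n" and "M = p ^ (r - 1) * n"
  have NM: "N = p * M" using r by (cases r) (auto simp: N_def M_def)
  have p0: "p > 0" using p prime_gt_0_nat by blast
  have prN: "p ^ r dvd N" by (simp add: N_def)
  define \<phi> where "\<phi> = smult p"
  have inj1: "inj (map ((*) p))" using p0 by (intro inj_mapI) (auto simp: inj_on_def)
  have inj: "inj_on \<phi> (squares M)"
    unfolding \<phi>_def smult_def by (rule inj_onI) (auto dest: injD[OF inj1])
  have sub: "\<phi> ` squares M \<subseteq> squares N"
  proof
    fix Y assume "Y \<in> \<phi> ` squares M"
    then obtain X where X: "X \<in> squares M" "Y = \<phi> X" by blast
    from X(1) show "Y \<in> squares N"
      by (rule squaresE) (simp add: X(2) \<phi>_def smult_def squares_iff NM flip: distrib_left)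
  qed
  have d1: "int p ^ (2 * r) dvd square_coeff X * w (phase X)" if X: "X \<in> squares N - \<phi> ` squares M" for X
  proof (rule dvd_mult2)
    from X have XN: "X \<in> squares N" by blast
    from XN obtain a1 b1 c1 a2 b2 c2 a3 b3 c3 where X': "X = ([a1, b1, c1], [a2, b2, c2], [a3, b3, c3])"
      and s: "a1 + b1 + c1 = N" "a2 + b2 + c2 = N" "a3 + b3 + c3 = N" "a1 + a2 + a3 = N" "b1 + b2 + b3 = N"
      by (rule squaresE)
    have "\<not> (case X of (is, js, ks) \<Rightarrow> \<forall>i\<in>set is \<union> set js \<union> set ks. p ^ Suc 0 dvd i)"
    proof
      assume "case X of (is, js, ks) \<Rightarrow> \<forall>i\<in>set is \<union> set js \<union> set ks. p ^ Suc 0 dvd i"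
      then have "p dvd a1" "p dvd b1" "p dvd c1" "p dvd a2" "p dvd b2" "p dvd c2" "p dvd a3" "p dvd b3" "p dvd c3"
        by (auto simp: X')
      then obtain A1 B1 C1 A2 B2 C2 A3 B3 C3 where e: "a1 = p * A1" "b1 = p * B1" "c1 = p * C1"
        "a2 = p * A2" "b2 = p * B2" "c2 = p * C2" "a3 = p * A3" "b3 = p * B3" "c3 = p * C3"
        by (elim dvdE) blast
      have "([A1, B1, C1], [A2, B2, C2], [A3, B3, C3]) \<in> squares M"
        using s p0 unfolding squares_iff e NM by (simp flip: distrib_left)
      moreover have "X = \<phi> ([A1, B1, C1], [A2, B2, C2], [A3, B3, C3])"
        by (simp add: X' \<phi>_def smult_def e)
      ultimately show False using X by blast
    qed
    from square_coeff_dvd[OF p(1) prN XN this] show "int p ^ (2 * r) dvd square_coeff X" by simp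
  qed
  have d2: "int p ^ (2 * r) dvd square_coeff (\<phi> X) * w (phase (\<phi> X)) - square_coeff X * w (p * phase X)"
    if X: "X \<in> squares M" for X
  proof -
    obtain "is" js ks where X': "X = (is, js, ks)" by (metis surj_pair)
    define U where "U = set is \<union> set js \<union> set ks"
    have \<phi>X: "\<phi> X = (map ((*) p) is, map ((*) p) js, map ((*) p) ks)" by (simp add: \<phi>_def smult_def X')
    have u: "ucong p (2 * t) (square_coeff (\<phi> X)) (square_coeff X)" if "\<forall>i\<in>U. p ^ t dvd p * i" for t
      unfolding \<phi>X unfolding X' square_coeff_def prod.case
      using that by (intro ucong_mult ucong_mnom p) (auto simp: U_def)
    have "int p ^ (2 * r) dvd square_coeff (\<phi> X) - square_coeff X"
    proof (rule ucong_diff_dvd_levels[OF p(1), where D = "\<lambda>t. \<forall>i\<in>U. p ^ t dvd p * i"])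
      fix t assume "\<not> (\<forall>i\<in>U. p ^ Suc t dvd p * i)"
      then have "\<not> (case \<phi> X of (is, js, ks) \<Rightarrow> \<forall>i\<in>set is \<union> set js \<union> set ks. p ^ Suc t dvd i)"
        unfolding \<phi>X U_def prod.case set_map by blast
      moreover have "\<phi> X \<in> squares N" using sub X by blast
      ultimately show "int p ^ (2 * (r - t)) dvd square_coeff (\<phi> X)"
        by (intro square_coeff_dvd[OF p(1) prN])
    qed (use u in auto)
    moreover have "phase (\<phi> X) = p * phase X" unfolding \<phi>_def by (rule phase_smult[OF X])
    ultimately show ?thesis by (simp flip: left_diff_distrib)
  qed
  show ?thesis
    unfolding cong_iff_dvd_diff N_def[symmetric] M_def[symmetric]
    by (rule sum_diff_dvd[OF finite_squares inj sub]) (erule d1, erule d2)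
qed

text \<open>The trace to the rationals of the m-th power of a primitive cube root of unity.\<close>

definition root_trace :: "nat \<Rightarrow> int" where "root_trace m = (if 3 dvd m then 2 else -1)"

text \<open>
  Only \<open>p = 3\<close> needs more: rotating the three columns simultaneously preserves the
  phase modulo 3 and has no fixed point of phase prime to 3, which yields the missing factor 3.
\<close>
lemma square_sum_three:
  assumes r: "r \<ge> 1"
  shows "[(\<Sum>X\<in>squares (3 ^ (r - 1) * n). square_coeff X * root_trace (3 * phase X)) =
    (\<Sum>X\<in>squares (3 ^ (r - 1) * n). square_coeff X * root_trace (phase X))] (mod 3 ^ (2 * r))"
proof -
  define M where "M = 3 ^ (r - 1) * n"
  define Y where "Y = {X \<in> squares M. \<not> 3 dvd phase X}"
  define \<rho> where "\<rho> = (\<lambda>(is, js, ks). (rotate1 is, rotate1 js, rotate1 ks) :: nat list \<times> nat list \<times> nat list)"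
  have mrot: "mnom [b, c, a] = mnom [a, b, c]" for a b c
  proof -
    have "mnom [b, c, a] * (fact a * fact b * fact c) = mnom [a, b, c] * (fact a * fact b * fact c)"
      using mnom_fact[of "[b, c, a]"] mnom_fact[of "[a, b, c]"] by (simp add: ac_simps del: mnom.simps)
    then show ?thesis by (subst (asm) mult_cancel2) simp
  qed
  \<comment> \<open>Of the 2 r factors 3, 2 (r - 1) divide every coefficient, one comes from the
    orbits of the rotation, and the last from the jump 2 - (-1) = 3 of
    \<open>root_trace\<close>.\<close>
  have "3 * 3 ^ (2 * (r - 1)) dvd sum square_coeff Y"
  proof (rule sum_dvd_of_free_rotation[where \<rho> = \<rho>])
    show "finite Y" by (simp add: Y_def)
    fix X assume X: "X \<in> Y"
    then have XM: "X \<in> squares M" and nd: "\<not> 3 dvd phase X" by (auto simp: Y_def)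
    from XM obtain a1 b1 c1 a2 b2 c2 a3 b3 c3 where X': "X = ([a1, b1, c1], [a2, b2, c2], [a3, b3, c3])"
      and s: "a1 + b1 + c1 = M" "a2 + b2 + c2 = M" "a3 + b3 + c3 = M" "a1 + a2 + a3 = M" "b1 + b2 + b3 = M"
      by (rule squaresE)
    have ph: "phase X = b2 + 2 * c2 + 2 * (b3 + 2 * c3)" by (simp add: X' phase_def row_phase_def)
    have \<rho>X: "\<rho> X = ([b1, c1, a1], [b2, c2, a2], [b3, c3, a3])" by (simp add: \<rho>_def X')
    have ph': "phase (\<rho> X) = c2 + 2 * a2 + 2 * (c3 + 2 * a3)" by (simp add: \<rho>X phase_def row_phase_def)
    have "3 * M = (a2 + b2 + c2) + 2 * (a3 + b3 + c3)" using s(2,3) by simp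
    then have "phase (\<rho> X) + 3 * M = phase X + 3 * (a2 + 2 * a3)" unfolding ph ph' by simp
    then have "3 dvd phase (\<rho> X) \<longleftrightarrow> 3 dvd phase X" by presburger
    moreover have "\<rho> X \<in> squares M" unfolding \<rho>X squares_iff using s by linarith
    ultimately have 1: "\<rho> X \<in> Y" using nd by (simp add: Y_def)
    have 2: "\<rho> (\<rho> (\<rho> X)) = X" unfolding \<rho>X by (simp add: \<rho>_def X')
    have 3: "\<rho> X \<noteq> X"
    proof
      assume "\<rho> X = X"
      from trans[OF \<rho>X[symmetric] this] have "([b1, c1, a1], [b2, c2, a2], [b3, c3, a3]) = X" .
      then have "b2 = c2" "b3 = c3" unfolding X' prod.inject list.inject by blast+
      then have "phase X = 3 * (c2 + 2 * c3)" unfolding ph by simp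
      then show False using nd by simp
    qed
    have 4: "square_coeff (\<rho> X) = square_coeff X"
      unfolding \<rho>X unfolding X' square_coeff_def prod.case
      by (simp only: mrot[of b1 c1 a1] mrot[of b2 c2 a2] mrot[of b3 c3 a3])
    have "\<not> (case X of (is, js, ks) \<Rightarrow> \<forall>i\<in>set is \<union> set js \<union> set ks. 3 ^ Suc 0 dvd i)"
    proof
      assume "case X of (is, js, ks) \<Rightarrow> \<forall>i\<in>set is \<union> set js \<union> set ks. 3 ^ Suc 0 dvd i"
      then have "3 dvd b2" "3 dvd c2" "3 dvd b3" "3 dvd c3" by (auto simp: X')
      then show False using nd unfolding ph by simp
    qed
    from square_coeff_dvd[OF _ _ XM this, of "r - 1"]
    have 5: "3 ^ (2 * (r - 1)) dvd square_coeff X" by (simp add: M_def)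
    show "\<rho> X \<in> Y \<and> \<rho> (\<rho> (\<rho> X)) = X \<and> \<rho> X \<noteq> X \<and> square_coeff (\<rho> X) = square_coeff X \<and> 3 ^ (2 * (r - 1)) dvd square_coeff X"
      using 1 2 3 4 5 by blast
  qed
  then have "3 * (3 * 3 ^ (2 * (r - 1))) dvd 3 * sum square_coeff Y" by (rule mult_dvd_mono[OF dvd_refl])
  moreover have "3 * (3 * 3 ^ (2 * (r - 1))) = (3 :: int) ^ (2 * r)" using r by (cases r) simp_all
  moreover have "(\<Sum>X\<in>squares M. square_coeff X * root_trace (3 * phase X)) -
      (\<Sum>X\<in>squares M. square_coeff X * root_trace (phase X)) = 3 * sum square_coeff Y"
  proof -
    have "(\<Sum>X\<in>squares M. square_coeff X * root_trace (3 * phase X)) -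
      (\<Sum>X\<in>squares M. square_coeff X * root_trace (phase X)) =
      (\<Sum>X\<in>squares M. if \<not> 3 dvd phase X then 3 * square_coeff X else 0)"
      unfolding sum_subtractf[symmetric] by (rule sum.cong[OF refl]) (simp add: root_trace_def)
    also have "\<dots> = 3 * sum square_coeff Y"
      unfolding Y_def sum_distrib_left by (rule sum.inter_filter[symmetric]) simp
    finally show ?thesis .
  qed
  ultimately show ?thesis unfolding cong_iff_dvd_diff M_def[symmetric] by simp
qed

lemma cf_three_powers:
  fixes L1 L2 L3 :: "(expo \<times> 'a::comm_ring_1) list"
  assumes "map fst L1 = tri_expo" "map fst L2 = tri_expo" "map fst L3 = tri_expo"
  shows "cf (terms L1 ^ N * terms L2 ^ N * terms L3 ^ N) (scale (int N) (1, 1, 0)) =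
    (\<Sum>(is, js, ks)\<in>squares N. of_int (square_coeff (is, js, ks)) *
      (pows (map snd L1) is * pows (map snd L2) js * pows (map snd L3) ks))"
proof -
  define I where "I = mindex 3 N"
  define C where "C = (\<lambda>L :: (expo \<times> 'a) list. \<lambda>is. of_nat (mnom is) * pows (map snd L) is)"
  have len: "length L1 = 3" "length L2 = 3" "length L3 = 3"
    using assms[THEN arg_cong[where f = length]] by (simp_all add: tri_expo_def)
  have T: "terms L ^ N = (\<Sum>is\<in>I. Poly_Mapping.single (wt tri_expo is) (C L is))"
    if "map fst L = tri_expo" "length L = 3" for L :: "(expo \<times> 'a) list"
    unfolding terms_power that I_def C_def ..
  have "terms L1 ^ N * terms L2 ^ N * terms L3 ^ N =
      (\<Sum>is\<in>I. \<Sum>js\<in>I. \<Sum>ks\<in>I. Poly_Mapping.single (wt tri_expo is + wt tri_expo js + wt tri_expo ks)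
        (C L1 is * C L2 js * C L3 ks))"
  proof -
    have "terms L1 ^ N * terms L2 ^ N =
        (\<Sum>is\<in>I. \<Sum>js\<in>I. Poly_Mapping.single (wt tri_expo is + wt tri_expo js) (C L1 is * C L2 js))"
      unfolding T[OF assms(1) len(1)] T[OF assms(2) len(2)] sum_product mult_single ..
    then show ?thesis
      unfolding T[OF assms(3) len(3)] by (simp only: sum_distrib_right) (simp only: sum_distrib_left mult_single)
  qed
  then have "cf (terms L1 ^ N * terms L2 ^ N * terms L3 ^ N) (scale (int N) (1, 1, 0)) =
      (\<Sum>is\<in>I. \<Sum>js\<in>I. \<Sum>ks\<in>I. if wt tri_expo is + wt tri_expo js + wt tri_expo ks = scale (int N) (1, 1, 0)
        then C L1 is * C L2 js * C L3 ks else 0)"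
    by (simp add: lookup_sum lookup_single when_def)
  also have "\<dots> = (\<Sum>X\<in>I \<times> I \<times> I. if X \<in> squares N then (case X of (is, js, ks) \<Rightarrow> C L1 is * C L2 js * C L3 ks) else 0)"
    unfolding sum.cartesian_product
    by (rule sum.cong[OF refl]) (auto simp: squares_def I_def split: prod.splits)
  also have "\<dots> = (\<Sum>X\<in>{X \<in> I \<times> I \<times> I. X \<in> squares N}. (case X of (is, js, ks) \<Rightarrow> C L1 is * C L2 js * C L3 ks))"
    by (rule sum.inter_filter[symmetric]) (simp add: I_def)
  also have "{X \<in> I \<times> I \<times> I. X \<in> squares N} = squares N"
    by (auto simp: squares_def I_def)
  also have "(\<Sum>X\<in>squares N. (case X of (is, js, ks) \<Rightarrow> C L1 is * C L2 js * C L3 ks)) =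
    (\<Sum>(is, js, ks)\<in>squares N. of_int (square_coeff (is, js, ks)) *
      (pows (map snd L1) is * pows (map snd L2) js * pows (map snd L3) ks))"
    by (rule sum.cong[OF refl]) (auto simp: C_def square_coeff_def mult_ac)
  finally show ?thesis .
qed

section \<open>Splitting over the cube roots of unity\<close>

definition omega :: complex where "omega = Complex (- 1 / 2) (sqrt 3 / 2)"

lemma omega_eq: "omega\<^sup>2 + omega + 1 = 0"
  by (simp add: omega_def power2_eq_square complex_eq_iff)

lemma omega_cube: "omega ^ 3 = 1"
proof -
  have "omega ^ 3 - 1 = (omega - 1) * (omega\<^sup>2 + omega + 1)"
    by (simp add: power2_eq_square power3_eq_cube algebra_simps)
  then show ?thesis using omega_eq by simp
qed

lemma Re_omega_power: "2 * Re (omega ^ m) = real_of_int (root_trace m)"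
proof -
  have "m = 3 * (m div 3) + m mod 3" by simp
  then have "omega ^ m = (omega ^ 3) ^ (m div 3) * omega ^ (m mod 3)"
    by (metis power_add power_mult)
  then have m: "omega ^ m = omega ^ (m mod 3)" by (simp add: omega_cube)
  have "m mod 3 = 0 \<or> m mod 3 = 1 \<or> m mod 3 = 2" by presburger
  moreover have "Re (omega\<^sup>2) = - 1 / 2" by (simp add: omega_def power2_eq_square)
  ultimately show ?thesis
    unfolding m root_trace_def dvd_eq_mod_eq_0 by (auto simp: omega_def)
qed

definition line :: "complex \<Rightarrow> (expo \<times> complex) list" where
  "line t = [((1, 0, 0), 1), ((0, 1, 0), t), ((0, 0, 0), t\<^sup>2)]"

lemma pows_line: "is \<in> mindex 3 N \<Longrightarrow> pows (map snd (line t)) is = t ^ row_phase is"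
  by (elim mindex_3E) (simp add: line_def row_phase_def power_add power_mult)

lemma poly_B_factor:
  "lpoly poly_B = - (terms (line 1) * terms (line omega) * terms (line (omega\<^sup>2)) :: complex laurent)"
proof -
  define W where "W = (Poly_Mapping.single 0 omega :: complex laurent)"
  have W2: "W\<^sup>2 = Poly_Mapping.single 0 (omega\<^sup>2)" and W4: "W ^ 4 = Poly_Mapping.single 0 ((omega\<^sup>2)\<^sup>2)"
    by (simp_all add: W_def single_power scale_def zero_prod_def flip: power_mult)
  have W: "W\<^sup>2 + W + 1 = 0"
  proof -
    have "W\<^sup>2 + W + 1 = Poly_Mapping.single 0 (omega\<^sup>2 + omega + 1)"
      unfolding W2 unfolding W_def by (simp add: single_add)
    then show ?thesis unfolding omega_eq by simp
  qed
  have t: "terms (line 1) = LX + LY + 1" "terms (line omega) = LX + W * LY + W\<^sup>2"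
    "terms (line (omega\<^sup>2)) = LX + W\<^sup>2 * LY + W ^ 4"
    unfolding W2 W4 by (simp_all add: terms_def line_def W_def mult_single zero_prod_def[symmetric])
  have n: "lpoly poly_B = (- 1 - LY ^ 3 + 3 * (LX * LY) - LX ^ 3 :: complex laurent)"
    unfolding poly_B_def peval_def by simp
  have *: "- 1 - y ^ 3 + 3 * (x * y) - x ^ 3 = - ((x + y + 1) * (x + w * y + w\<^sup>2) * (x + w\<^sup>2 * y + w ^ 4))"
    if "w\<^sup>2 + w + 1 = 0" for x y w :: "complex laurent"
    using that by Groebner_Basis.algebra
  show ?thesis unfolding t n by (rule *[OF W])
qed

text \<open>\<open>A N\<close> is real, so real parts may be taken term by term; doubling replaces
  each power of \<open>omega\<close> by its integral trace.\<close>

lemma square_sum_B: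
  assumes A: "zagier_sequence 9 3 27 A"
  shows "2 * A N = (-1) ^ N * (\<Sum>X\<in>squares N. square_coeff X * root_trace (phase X))"
proof -
  have "of_int (A N) = (cf (lpoly poly_B ^ N) (scale (int N) (int 1, int 1, int 0)) :: complex)"
    by (rule zagier_eq_ct[OF A cert_B]) (simp_all add: poly_B_def)
  also have "lpoly poly_B ^ N = of_int ((-1) ^ N) *
      (terms (line 1) ^ N * terms (line omega) ^ N * terms (line (omega\<^sup>2)) ^ N :: complex laurent)"
    unfolding poly_B_factor by (simp add: power_minus[of "_ * _"] power_mult_distrib)
  also have "cf \<dots> (scale (int N) (int 1, int 1, int 0)) = of_int ((-1) ^ N) *
      (\<Sum>(is, js, ks)\<in>squares N. of_int (square_coeff (is, js, ks)) *
      (pows (map snd (line 1)) is * pows (map snd (line omega)) js * pows (map snd (line (omega\<^sup>2))) ks))"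
    unfolding cf_of_int_mult by (subst cf_three_powers[symmetric]) (simp_all add: line_def tri_expo_def)
  also have "(\<Sum>(is, js, ks)\<in>squares N. of_int (square_coeff (is, js, ks)) *
      (pows (map snd (line 1)) is * pows (map snd (line omega)) js * pows (map snd (line (omega\<^sup>2))) ks)) =
      (\<Sum>X\<in>squares N. of_int (square_coeff X) * omega ^ phase X)"
    by (rule sum.cong[OF refl]) (auto simp: squares_def pows_line phase_def power_add power_mult)
  finally have "2 * Re (of_int (A N)) = 2 * Re (of_int ((-1) ^ N) * (\<Sum>X\<in>squares N. of_int (square_coeff X) * omega ^ phase X))"
    by (simp only:)
  also have "\<dots> = of_int ((-1) ^ N) * (\<Sum>X\<in>squares N. of_int (square_coeff X) * (2 * Re (omega ^ phase X)))"
    by (simp add: sum_distrib_left mult_ac)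
  also have "\<dots> = real_of_int ((-1) ^ N * (\<Sum>X\<in>squares N. square_coeff X * root_trace (phase X)))"
    unfolding Re_omega_power by simp
  finally have "real_of_int (2 * A N) = real_of_int ((-1) ^ N * (\<Sum>X\<in>squares N. square_coeff X * root_trace (phase X)))"
    by simp
  then show ?thesis by (simp only: of_int_eq_iff)
qed

lemma supercongruence_B:
  assumes A: "zagier_sequence 9 3 27 A" and p: "prime p" "odd p" and r: "r \<ge> 1"
  shows "[A (p ^ r * n) = A (p ^ (r - 1) * n)] (mod int p ^ (2 * r))"
proof -
  define S where "S = (\<lambda>N. \<Sum>X\<in>squares N. square_coeff X * root_trace (phase X))"
  define T where "T = (\<lambda>N. \<Sum>X\<in>squares N. square_coeff X * root_trace (p * phase X))"
  have 1: "[S (p ^ r * n) = T (p ^ (r - 1) * n)] (mod int p ^ (2 * r))"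
    unfolding S_def T_def by (rule square_sum_cong[OF p r])
  \<comment> \<open>For p other than 3, taking p-th powers at most conjugates the cube roots of
    unity, so the traces agree term by term; for p = 3 it sends all of them to 1.\<close>
  have 2: "[T (p ^ (r - 1) * n) = S (p ^ (r - 1) * n)] (mod int p ^ (2 * r))"
  proof (cases "p = 3")
    case True
    then show ?thesis using square_sum_three[OF r] unfolding S_def T_def by simp
  next
    case False
    have "coprime 3 p" using False p primes_coprime[of 3 p] by simp
    then have "3 dvd p * m \<longleftrightarrow> 3 dvd m" for m by (simp add: coprime_dvd_mult_right_iff)
    then show ?thesis unfolding S_def T_def root_trace_def by simp
  qed
  have sign: "(-1 :: int) ^ (p ^ r * n) = (-1) ^ (p ^ (r - 1) * n)"
    using p(2) by (simp add: uminus_power_if)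
  have "[2 * A (p ^ r * n) = 2 * A (p ^ (r - 1) * n)] (mod int p ^ (2 * r))"
  proof -
    have B: "2 * A N = (-1) ^ N * S N" for N unfolding S_def by (rule square_sum_B[OF A])
    show ?thesis unfolding B sign by (rule cong_mult[OF cong_refl cong_trans[OF 1 2]])
  qed
  moreover have "coprime 2 (int p ^ (2 * r))" using p(2) by simp
  ultimately show ?thesis by (simp add: cong_mult_lcancel)
qed

theorem theorem1p1:
  fixes A :: "nat \<Rightarrow> int" and p n r :: nat
  assumes "sporadic_apery_like A"
    and "prime p" and "p \<ge> 3"
    and "n \<ge> 1" and "r \<ge> 1"
  shows "[A (p ^ r * n) = A (p ^ (r - 1) * n)] (mod (int p) ^ (2 * r))"
proof -
  have "odd p" using assms(2,3) prime_odd_nat[of p] by simp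
  note pr = assms(2) this assms(5)
  from assms(1) show ?thesis
    unfolding sporadic_apery_like_def
  proof
    assume "\<exists>(a, b, c)\<in>zagier_params. zagier_sequence a b c A"
    then consider "zagier_sequence 7 2 (-8) A" | "zagier_sequence 9 3 27 A" | "zagier_sequence 10 3 9 A"
      | "zagier_sequence 11 3 (-1) A" | "zagier_sequence 12 4 32 A" | "zagier_sequence 17 6 72 A"
      unfolding zagier_params_def by auto
    then show ?thesis
      by cases (use supercongruence_A[OF _ pr] supercongruence_B[OF _ pr] supercongruence_C[OF _ pr]
          supercongruence_D[OF _ pr] supercongruence_E[OF _ pr] supercongruence_F[OF _ pr] in blast)+
  next
    assume "\<exists>(a, b, c, d)\<in>cooper_params. cooper_sequence a b c d A"
    then consider "cooper_sequence 10 4 64 0 A" | "cooper_sequence 17 5 1 0 A" | "cooper_sequence 7 3 81 0 A"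
      | "cooper_sequence 12 4 16 0 A" | "cooper_sequence 11 5 125 0 A" | "cooper_sequence 9 3 (-27) 0 A"
      | "cooper_sequence 13 4 (-27) 3 A" | "cooper_sequence 6 2 (-64) 4 A" | "cooper_sequence 14 6 192 (-12) A"
      unfolding cooper_params_def by auto
    then show ?thesis
      by cases (use supercongruence_alpha[OF _ pr] supercongruence_gamma[OF _ pr] supercongruence_delta[OF _ pr]
          supercongruence_eps[OF _ pr] supercongruence_eta[OF _ pr] supercongruence_zeta[OF _ pr]
          supercongruence_s7[OF _ pr] supercongruence_s10[OF _ pr] supercongruence_s18[OF _ pr assms(4)] in blast)+
  qed
qed

end
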